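(* Let $X$ be a smooth vector field on an orientable $m$-dimensional smooth manifold $M$, $m\ge 2$, admitting $m-2$ first integrals $c_1,\dots,c_{m-2}\in C^\infty(M)$. Let $U\subseteq M$ be the open set of points at which $\mathrm{d}c_1,\dots,\mathrm{d}c_{m-2}$ are linearly independent, and assume that $U$ is dense in $M$. Suppose that 1) there exists an $X$-invariant volume form on $M$; 2) the level sets of $\boldsymbol{c}:=(c_1,\dots,c_{m-2})|_U: U\to\mathbb{R}^{m-2}$ are connected and simply connected. Then there exists a unimodular Poisson structure $\pi$ on $M$, of rank two on $U$ and zero on $M\setminus U$, admitting $c_1,\dots,c_{m-2}$ as Casimir functions, and such that $X$ is Hamiltonian on $U$ with respect to $\pi$, i.e. $X|_U=\pi^\sharp\mathrm{d}h$ for some $h\in C^\infty(U)$.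
   Context: A Poisson structure is a bivector field $\pi$ with $[\pi,\pi]=0$ (Schouten–Nijenhuis bracket). $\pi^\sharp\alpha=\mathbf{i}_\alpha\pi=\pi(\alpha,\cdot)$; the rank of $\pi$ at $x$ is $\dim\pi^\sharp(T_x^*M)$. Hamiltonian vector fields are those of the form $\pi^\sharp\mathrm{d}h$; a Casimir function is a smooth $c$ with $\pi^\sharp\mathrm{d}c=0$. A Poisson structure on an orientable manifold is unimodular if there is a volume form invariant under the flows of all Hamiltonian vector fields. A first integral of $X$ is a function $c$ with $\mathrm{d}c(X)=0$. A volume form $\Omega$ is $X$-invariant if $\mathrm{L}_X\Omega=0$. *)

theory Defs
  imports "HOL-Analysis.Analysis"
begin

section \<open>Smooth maps between Euclidean spaces\<close>

text \<open>
  \<open>S\<close> is meant to be open: the derivatives at points of \<open>S\<close> are unrestricted ones.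
\<close>

primrec Ck_on :: "nat \<Rightarrow> 'a::euclidean_space set \<Rightarrow> ('a \<Rightarrow> 'b::euclidean_space) \<Rightarrow> bool" where
  "Ck_on 0 S f \<longleftrightarrow> continuous_on S f"
| "Ck_on (Suc k) S f \<longleftrightarrow>
     (\<forall>x\<in>S. f differentiable (at x)) \<and> (\<forall>v. Ck_on k S (\<lambda>x. frechet_derivative f (at x) v))"

definition smooth_on :: "'a::euclidean_space set \<Rightarrow> ('a \<Rightarrow> 'b::euclidean_space) \<Rightarrow> bool" where
  "smooth_on S f \<longleftrightarrow> (\<forall>k. Ck_on k S f)"


section \<open>Smooth manifolds\<close>

text \<open>
  The points of the manifold \<open>M\<close> form a whole type \<open>'a\<close>, Hausdorff and second countable in the
  intended use, the model space is \<open>real ^ 'm\<close>, so that the dimension is \<open>CARD('m)\<close>. A chart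
  consists of its domain and its coordinate map (whose values off the domain are irrelevant).
  The smooth structure is the one generated by an atlas, which need not be maximal.
\<close>

type_synonym ('a, 'm) chart = "'a set \<times> ('a \<Rightarrow> real ^ 'm)"

definition is_chart :: "('a::topological_space, 'm::finite) chart \<Rightarrow> bool" where
  "is_chart \<kappa> \<longleftrightarrow> open (fst \<kappa>) \<and> open (snd \<kappa> ` fst \<kappa>) \<and>
     (\<exists>\<psi>. homeomorphism (fst \<kappa>) (snd \<kappa> ` fst \<kappa>) (snd \<kappa>) \<psi>)"

definition chart_inv :: "('a, 'm::finite) chart \<Rightarrow> real ^ 'm \<Rightarrow> 'a" where
  "chart_inv \<kappa> = inv_into (fst \<kappa>) (snd \<kappa>)"

definition transition :: "('a, 'm::finite) chart \<Rightarrow> ('a, 'm) chart \<Rightarrow> real ^ 'm \<Rightarrow> real ^ 'm" where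
  "transition \<kappa> \<mu> = snd \<mu> \<circ> chart_inv \<kappa>"

definition jacobian ::
    "('a, 'm::finite) chart \<Rightarrow> ('a, 'm) chart \<Rightarrow> 'a \<Rightarrow> real ^ 'm ^ 'm" where
  "jacobian \<kappa> \<mu> p = matrix (frechet_derivative (transition \<kappa> \<mu>) (at (snd \<kappa> p)))"

definition smooth_atlas :: "('a::topological_space, 'm::finite) chart set \<Rightarrow> bool" where
  "smooth_atlas A \<longleftrightarrow>
     (\<forall>\<kappa>\<in>A. is_chart \<kappa>) \<and> (\<Union>\<kappa>\<in>A. fst \<kappa>) = UNIV \<and>
     (\<forall>\<kappa>\<in>A. \<forall>\<mu>\<in>A. smooth_on (snd \<kappa> ` (fst \<kappa> \<inter> fst \<mu>)) (transition \<kappa> \<mu>))"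

text \<open>
  Orientability: some atlas \<open>B\<close> of the same smooth structure has positive transition determinants.
\<close>

definition orientable :: "('a::topological_space, 'm::finite) chart set \<Rightarrow> bool" where
  "orientable A \<longleftrightarrow>
     (\<exists>B. smooth_atlas B \<and> smooth_atlas (A \<union> B) \<and>
        (\<forall>\<kappa>\<in>B. \<forall>\<mu>\<in>B. \<forall>p\<in>fst \<kappa> \<inter> fst \<mu>. det (jacobian \<kappa> \<mu> p) > 0))"

definition smooth_fun_on ::
    "('a::topological_space, 'm::finite) chart set \<Rightarrow> 'a set \<Rightarrow> ('a \<Rightarrow> real) \<Rightarrow> bool" where
  "smooth_fun_on A S f \<longleftrightarrow>
     (\<forall>\<kappa>\<in>A. smooth_on (snd \<kappa> ` (fst \<kappa> \<inter> S)) (f \<circ> chart_inv \<kappa>))"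

text \<open>The components \<open>\<partial>f/\<partial>x\<^sub>j\<close> of \<open>df\<close> at \<open>p\<close> in the coordinates of \<open>\<kappa>\<close>.\<close>

definition differential ::
    "('a, 'm::finite) chart \<Rightarrow> ('a \<Rightarrow> real) \<Rightarrow> 'a \<Rightarrow> real ^ 'm" where
  "differential \<kappa> f p =
     (\<chi> j. frechet_derivative (f \<circ> chart_inv \<kappa>) (at (snd \<kappa> p)) (axis j 1))"


section \<open>Tensor fields\<close>

text \<open>
  A tensor field is the family of its component functions in the charts of the atlas, subject to
  the transformation law of its type on overlaps. Components in a chart outside the atlas, or at
  a point outside the domain of the chart, carry no meaning.
\<close>

type_synonym ('a, 'm) vfield = "('a, 'm) chart \<Rightarrow> 'a \<Rightarrow> real ^ 'm"
type_synonym ('a, 'm) bivfield = "('a, 'm) chart \<Rightarrow> 'a \<Rightarrow> real ^ 'm ^ 'm"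
type_synonym ('a, 'm) topform = "('a, 'm) chart \<Rightarrow> 'a \<Rightarrow> ('m \<Rightarrow> real ^ 'm) \<Rightarrow> real"

definition vector_field ::
    "('a::topological_space, 'm::finite) chart set \<Rightarrow> ('a, 'm) vfield \<Rightarrow> bool" where
  "vector_field A X \<longleftrightarrow>
     (\<forall>\<kappa>\<in>A. smooth_on (snd \<kappa> ` fst \<kappa>) (X \<kappa> \<circ> chart_inv \<kappa>)) \<and>
     (\<forall>\<kappa>\<in>A. \<forall>\<mu>\<in>A. \<forall>p\<in>fst \<kappa> \<inter> fst \<mu>. X \<mu> p = jacobian \<kappa> \<mu> p *v X \<kappa> p)"

text \<open>
  \<open>P \<kappa> p $ i $ j = P(dx\<^sub>i, dx\<^sub>j)\<close> at \<open>p\<close>.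
\<close>

definition bivector_field ::
    "('a::topological_space, 'm::finite) chart set \<Rightarrow> ('a, 'm) bivfield \<Rightarrow> bool" where
  "bivector_field A P \<longleftrightarrow>
     (\<forall>\<kappa>\<in>A. smooth_on (snd \<kappa> ` fst \<kappa>) (P \<kappa> \<circ> chart_inv \<kappa>)) \<and>
     (\<forall>\<kappa>\<in>A. \<forall>p\<in>fst \<kappa>. transpose (P \<kappa> p) = - P \<kappa> p) \<and>
     (\<forall>\<kappa>\<in>A. \<forall>\<mu>\<in>A. \<forall>p\<in>fst \<kappa> \<inter> fst \<mu>.
        P \<mu> p = jacobian \<kappa> \<mu> p ** P \<kappa> p ** transpose (jacobian \<kappa> \<mu> p))"

text \<open>
  Forms of top degree. The \<open>CARD('m)\<close> arguments are indexed by \<open>'m\<close> itself, so that no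
  numbering of the coordinates has to be chosen.
\<close>

definition alternating_multilinear :: "(('m::finite \<Rightarrow> real ^ 'm) \<Rightarrow> real) \<Rightarrow> bool" where
  "alternating_multilinear \<omega> \<longleftrightarrow>
     (\<forall>V i. linear (\<lambda>v. \<omega> (V(i := v)))) \<and>
     (\<forall>V i j. i \<noteq> j \<and> V i = V j \<longrightarrow> \<omega> V = 0)"

definition top_form ::
    "('a::topological_space, 'm::finite) chart set \<Rightarrow> ('a, 'm) topform \<Rightarrow> bool" where
  "top_form A \<Omega> \<longleftrightarrow>
     (\<forall>\<kappa>\<in>A. \<forall>V. smooth_on (snd \<kappa> ` fst \<kappa>) (\<lambda>x. \<Omega> \<kappa> (chart_inv \<kappa> x) V)) \<and>
     (\<forall>\<kappa>\<in>A. \<forall>p\<in>fst \<kappa>. alternating_multilinear (\<Omega> \<kappa> p)) \<and>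
     (\<forall>\<kappa>\<in>A. \<forall>\<mu>\<in>A. \<forall>p\<in>fst \<kappa> \<inter> fst \<mu>. \<forall>V.
        \<Omega> \<kappa> p V = \<Omega> \<mu> p (\<lambda>i. jacobian \<kappa> \<mu> p *v V i))"

definition volume_form ::
    "('a::topological_space, 'm::finite) chart set \<Rightarrow> ('a, 'm) topform \<Rightarrow> bool" where
  "volume_form A \<Omega> \<longleftrightarrow> top_form A \<Omega> \<and> (\<forall>\<kappa>\<in>A. \<forall>p\<in>fst \<kappa>. \<exists>V. \<Omega> \<kappa> p V \<noteq> 0)"


section \<open>First integrals and invariant volume forms\<close>

definition first_integral ::
    "('a::topological_space, 'm::finite) chart set \<Rightarrow> ('a, 'm) vfield \<Rightarrow> ('a \<Rightarrow> real) \<Rightarrow> bool" where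
  "first_integral A X c \<longleftrightarrow> (\<forall>\<kappa>\<in>A. \<forall>p\<in>fst \<kappa>. differential \<kappa> c p \<bullet> X \<kappa> p = 0)"

text \<open>
  For a covariant tensor field \<open>\<Omega>\<close> and constant (coordinate) arguments \<open>V\<close>,
  \<open>(L\<^sub>X \<Omega>)(V\<^sub>1, \<dots>) = X(\<Omega>(V\<^sub>1, \<dots>)) - \<Sum>\<^sub>i \<Omega>(\<dots>, [X, V\<^sub>i], \<dots>)\<close>, where
  \<open>[X, V\<^sub>i] = - DX(V\<^sub>i)\<close>.
\<close>

definition lie_derivative ::
    "('a, 'm::finite) vfield \<Rightarrow> ('a, 'm) topform \<Rightarrow> ('a, 'm) topform" where
  "lie_derivative X \<Omega> \<kappa> p V =
     frechet_derivative (\<lambda>x. \<Omega> \<kappa> (chart_inv \<kappa> x) V) (at (snd \<kappa> p)) (X \<kappa> p) +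
     (\<Sum>i\<in>UNIV. \<Omega> \<kappa> p
        (V(i := frechet_derivative (X \<kappa> \<circ> chart_inv \<kappa>) (at (snd \<kappa> p)) (V i))))"

definition invariant_form ::
    "('a::topological_space, 'm::finite) chart set \<Rightarrow> ('a, 'm) vfield \<Rightarrow> ('a, 'm) topform \<Rightarrow> bool"
  where
  "invariant_form A X \<Omega> \<longleftrightarrow> (\<forall>\<kappa>\<in>A. \<forall>p\<in>fst \<kappa>. \<forall>V. lie_derivative X \<Omega> \<kappa> p V = 0)"


section \<open>Flows\<close>

text \<open>
  A flow of \<open>X\<close> is a smooth map \<open>\<Phi>\<close> on a flow domain \<open>D\<close>, that is, on an open set
  containing \<open>{0} \<times> M\<close> and meeting each line \<open>\<real> \<times> {p}\<close> in an interval, such that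
  \<open>t \<mapsto> \<Phi> t p\<close> is the integral curve of \<open>X\<close> starting at \<open>p\<close>. The maximal flow of \<open>X\<close> is one of
  them and extends all the others.
\<close>

definition flow_domain :: "(real \<times> 'a::topological_space) set \<Rightarrow> bool" where
  "flow_domain D \<longleftrightarrow> open D \<and> (\<forall>p. (0, p) \<in> D \<and> is_interval {t. (t, p) \<in> D})"

definition is_flow ::
    "('a::topological_space, 'm::finite) chart set \<Rightarrow> ('a, 'm) vfield \<Rightarrow>
     (real \<times> 'a) set \<Rightarrow> (real \<Rightarrow> 'a \<Rightarrow> 'a) \<Rightarrow> bool" where
  "is_flow A X D \<Phi> \<longleftrightarrow>
     flow_domain D \<and>
     continuous_on D (\<lambda>(t, p). \<Phi> t p) \<and>
     (\<forall>\<kappa>\<in>A. \<forall>\<mu>\<in>A.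
        smooth_on {(t, x). x \<in> snd \<kappa> ` fst \<kappa> \<and> (t, chart_inv \<kappa> x) \<in> D \<and>
                           \<Phi> t (chart_inv \<kappa> x) \<in> fst \<mu>}
          (\<lambda>(t, x). snd \<mu> (\<Phi> t (chart_inv \<kappa> x)))) \<and>
     (\<forall>p. \<Phi> 0 p = p) \<and>
     (\<forall>(t, p)\<in>D. \<forall>\<kappa>\<in>A. \<Phi> t p \<in> fst \<kappa> \<longrightarrow>
        ((\<lambda>s. snd \<kappa> (\<Phi> s p)) has_vector_derivative X \<kappa> (\<Phi> t p)) (at t))"

text \<open>
  Invariance under the flow: \<open>\<Phi>\<^sub>t\<^sup>*\<Omega> = \<Omega>\<close> wherever \<open>\<Phi>\<^sub>t\<close> is defined.
\<close>

definition flow_invariant ::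
    "('a::topological_space, 'm::finite) chart set \<Rightarrow> ('a, 'm) vfield \<Rightarrow> ('a, 'm) topform \<Rightarrow> bool"
  where
  "flow_invariant A X \<Omega> \<longleftrightarrow>
     (\<forall>D \<Phi>. is_flow A X D \<Phi> \<longrightarrow>
        (\<forall>(t, p)\<in>D. \<forall>\<kappa>\<in>A. \<forall>\<mu>\<in>A. p \<in> fst \<kappa> \<and> \<Phi> t p \<in> fst \<mu> \<longrightarrow>
           (\<forall>V. \<Omega> \<mu> (\<Phi> t p)
                  (\<lambda>i. frechet_derivative (snd \<mu> \<circ> \<Phi> t \<circ> chart_inv \<kappa>) (at (snd \<kappa> p)) (V i))
                = \<Omega> \<kappa> p V)))"


section \<open>Poisson structures\<close>

text \<open>
  The component \<open>i, j, k\<close> of the Schouten--Nijenhuis bracket of two bivector fields, normalised by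
  \<open>[X\<^sub>1 \<and> X\<^sub>2, Y\<^sub>1 \<and> Y\<^sub>2] = \<Sum>\<^sub>a\<^sub>,\<^sub>b (-1)\<^sup>a\<^sup>+\<^sup>b [X\<^sub>a, Y\<^sub>b] \<and> X\<^sub>a' \<and> Y\<^sub>b'\<close>, with \<open>a'\<close> and \<open>b'\<close> the
  complementary indices: the cyclic sum over \<open>i, j, k\<close> of
  \<open>\<Sum>\<^sub>l P\<^sup>i\<^sup>l \<partial>\<^sub>l Q\<^sup>j\<^sup>k + Q\<^sup>i\<^sup>l \<partial>\<^sub>l P\<^sup>j\<^sup>k\<close>.
\<close>

definition partial_component ::
    "('a, 'm::finite) bivfield \<Rightarrow> ('a, 'm) chart \<Rightarrow> 'a \<Rightarrow> 'm \<Rightarrow> 'm \<Rightarrow> 'm \<Rightarrow> real" where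
  "partial_component P \<kappa> p l j k = differential \<kappa> (\<lambda>q. P \<kappa> q $ j $ k) p $ l"

definition schouten_term ::
    "('a, 'm::finite) bivfield \<Rightarrow> ('a, 'm) bivfield \<Rightarrow> ('a, 'm) chart \<Rightarrow> 'a \<Rightarrow>
     'm \<Rightarrow> 'm \<Rightarrow> 'm \<Rightarrow> real" where
  "schouten_term P Q \<kappa> p i j k =
     (\<Sum>l\<in>UNIV. P \<kappa> p $ i $ l * partial_component Q \<kappa> p l j k +
                Q \<kappa> p $ i $ l * partial_component P \<kappa> p l j k)"

definition schouten_bracket ::
    "('a, 'm::finite) bivfield \<Rightarrow> ('a, 'm) bivfield \<Rightarrow> ('a, 'm) chart \<Rightarrow> 'a \<Rightarrow>
     'm \<Rightarrow> 'm \<Rightarrow> 'm \<Rightarrow> real" where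
  "schouten_bracket P Q \<kappa> p i j k =
     schouten_term P Q \<kappa> p i j k + schouten_term P Q \<kappa> p j k i + schouten_term P Q \<kappa> p k i j"

definition poisson_structure ::
    "('a::topological_space, 'm::finite) chart set \<Rightarrow> ('a, 'm) bivfield \<Rightarrow> bool" where
  "poisson_structure A \<pi> \<longleftrightarrow>
     bivector_field A \<pi> \<and>
     (\<forall>\<kappa>\<in>A. \<forall>p\<in>fst \<kappa>. \<forall>i j k. schouten_bracket \<pi> \<pi> \<kappa> p i j k = 0)"

text \<open>
  \<open>\<pi>\<^sup>\<sharp>\<alpha> = \<pi>(\<alpha>, \<cdot>)\<close>, whose component \<open>j\<close> is \<open>\<Sum>\<^sub>i \<alpha>\<^sub>i \<pi>\<^sup>i\<^sup>j\<close>.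
\<close>

definition sharp :: "real ^ 'm ^ 'm \<Rightarrow> real ^ 'm \<Rightarrow> real ^ 'm" where
  "sharp P \<alpha> = \<alpha> v* P"

definition hamiltonian_vf :: "('a, 'm::finite) bivfield \<Rightarrow> ('a \<Rightarrow> real) \<Rightarrow> ('a, 'm) vfield" where
  "hamiltonian_vf \<pi> h \<kappa> p = sharp (\<pi> \<kappa> p) (differential \<kappa> h p)"

definition has_rank_at ::
    "('a, 'm::finite) chart set \<Rightarrow> ('a, 'm) bivfield \<Rightarrow> 'a \<Rightarrow> nat \<Rightarrow> bool" where
  "has_rank_at A \<pi> p r \<longleftrightarrow> (\<forall>\<kappa>\<in>A. p \<in> fst \<kappa> \<longrightarrow> dim (range (sharp (\<pi> \<kappa> p))) = r)"

definition casimir ::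
    "('a::topological_space, 'm::finite) chart set \<Rightarrow> ('a, 'm) bivfield \<Rightarrow> ('a \<Rightarrow> real) \<Rightarrow> bool" where
  "casimir A \<pi> c \<longleftrightarrow>
     smooth_fun_on A UNIV c \<and> (\<forall>\<kappa>\<in>A. \<forall>p\<in>fst \<kappa>. hamiltonian_vf \<pi> c \<kappa> p = 0)"

definition unimodular ::
    "('a::topological_space, 'm::finite) chart set \<Rightarrow> ('a, 'm) bivfield \<Rightarrow> bool" where
  "unimodular A \<pi> \<longleftrightarrow>
     (\<exists>\<Omega>. volume_form A \<Omega> \<and>
        (\<forall>h. smooth_fun_on A UNIV h \<longrightarrow> flow_invariant A (hamiltonian_vf \<pi> h) \<Omega>))"

text \<open>
  Linear independence of the family \<open>dc\<^sub>0, \<dots>, dc\<^sub>n\<^sub>-\<^sub>1\<close> at \<open>p\<close> (as a family, not just as a set).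
\<close>

definition independent_differentials_at ::
    "('a, 'm::finite) chart set \<Rightarrow> nat \<Rightarrow> (nat \<Rightarrow> 'a \<Rightarrow> real) \<Rightarrow> 'a \<Rightarrow> bool" where
  "independent_differentials_at A n c p \<longleftrightarrow>
     (\<forall>\<kappa>\<in>A. p \<in> fst \<kappa> \<longrightarrow>
        (\<forall>a. (\<Sum>i<n. a i *\<^sub>R differential \<kappa> (c i) p) = 0 \<longrightarrow> (\<forall>i<n. a i = 0)))"

end

theory Submission
  imports Defs
begin

text \<open>
  Write \<open>\<Omega> = \<rho> dx\<^sub>1 \<and> \<dots> \<and> dx\<^sub>m\<close> for the invariant volume form and put
  \<open>\<pi>(\<alpha>, \<beta>) = \<rho>\<inverse> det (\<alpha>, \<beta>, dc\<^sub>1, \<dots>, dc\<^sub>m\<^sub>-\<^sub>2)\<close>. The \<open>c\<^sub>i\<close> are Casimir functions,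
  so they annihilate the trivector \<open>[\<pi>, \<pi>]\<close>, which therefore vanishes on \<open>U\<close> for lack of further
  independent covectors, and everywhere by density. Symmetry of second derivatives makes
  \<open>\<pi>\<^sup>\<sharp>dh\<close> divergence-free for \<open>\<Omega>\<close>, whence unimodularity. On \<open>U\<close> the field \<open>X\<close> is tangent to the
  symplectic leaves, the level sets of \<open>c\<close>; in a foliation box its invariance of \<open>\<Omega>\<close> is exactly
  the integrability condition for a Hamiltonian, unique up to functions of \<open>c\<close>. On a simply
  connected leaf the local Hamiltonians continue to a global one. Normalising it along local
  transversals makes it smooth in a whole saturated neighbourhood of the leaf, and a partition of
  unity in the values of \<open>c\<close> glues these normalisations to a Hamiltonian on \<open>U\<close>.
\<close>

section \<open>Calculus of smooth maps\<close>

text \<open>Leafwise a Hamiltonian is free up to a constant, so potentials chosen leaf by leaf need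
  not even be continuous from one leaf to the next. The submersion \<open>c\<close> on
  \<open>U\<close> need not be a fibration: no neighbourhood of a leaf is known to be a product, and
  one box need not contain a leaf. Smoothness is therefore gained in one box and carried along the
  leaf, which is where connectedness of the level sets enters, while simple connectedness removes
  the periods of the potential. The gluing weights are functions of \<open>c\<close> because these
  are Casimir functions: weighted means of Hamiltonians are then again Hamiltonians, whereas weights
  varying along a leaf would add terms \<open>f d\<eta>\<close>. Continuation along a leaf adds up
  increments of local Hamiltonians over paths and squares, so a leaf is used as a topological space
  only. The factor \<open>1 / \<rho>\<close> in the bivector cancels the Jacobian determinants that
  the plain determinant picks up under a change of chart, and it reduces the divergence of a
  Hamiltonian field with respect to \<open>\<Omega>\<close> to the Euclidean divergence of a row of
  cofactors.\<close>

abbreviation dd :: "('a::euclidean_space \<Rightarrow> 'b::euclidean_space) \<Rightarrow> 'a \<Rightarrow> 'a \<Rightarrow> 'b" where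
  "dd f x \<equiv> frechet_derivative f (at x)"

lemma has_derivative_dd: "f differentiable (at x) \<Longrightarrow> (f has_derivative dd f x) (at x)"
  by (simp add: frechet_derivative_works)

lemma dd_eqI: "(f has_derivative f') (at x) \<Longrightarrow> dd f x = f'"
  by (metis frechet_derivative_at)

lemma linear_dd: "f differentiable (at x) \<Longrightarrow> linear (dd f x)"
  by (rule linear_frechet_derivative)

lemma has_derivative_cong_open:
  assumes "open S" "x \<in> S" "\<And>y. y \<in> S \<Longrightarrow> f y = g y"
  shows "(f has_derivative f') (at x) \<longleftrightarrow> (g has_derivative f') (at x)"
  using assms has_derivative_transform_within_open[of f f' x UNIV S g]
    has_derivative_transform_within_open[of g f' x UNIV S f] by auto

lemma differentiable_cong_open:
  assumes "open S" "x \<in> S" "\<And>y. y \<in> S \<Longrightarrow> f y = g y"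
  shows "f differentiable (at x) \<longleftrightarrow> g differentiable (at x)"
  unfolding differentiable_def using has_derivative_cong_open[OF assms(1,2), of f g] assms(3) by simp

lemma dd_cong_open:
  assumes "open S" "x \<in> S" "\<And>y. y \<in> S \<Longrightarrow> f y = g y"
  shows "dd f x = dd g x"
  unfolding frechet_derivative_def using has_derivative_cong_open[OF assms(1,2), of f g] assms(3) by simp

text \<open>\<open>Ck_on\<close> uses unrestricted derivatives, so agreement on \<open>S\<close> is
  enough only because an open \<open>S\<close> is a neighbourhood of its points.\<close>

lemma Ck_on_cong:
  "open S \<Longrightarrow> (\<And>x. x \<in> S \<Longrightarrow> f x = g x) \<Longrightarrow> Ck_on k S f \<longleftrightarrow> Ck_on k S g"
proof (induction k arbitrary: f g)
  case 0
  then show ?case by (simp cong: continuous_on_cong)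
next
  case (Suc k)
  have "Ck_on k S (\<lambda>x. dd f x v) \<longleftrightarrow> Ck_on k S (\<lambda>x. dd g x v)" for v
    using Suc dd_cong_open[of S _ f g] by (intro Suc.IH) auto
  moreover have "(\<forall>x\<in>S. f differentiable at x) \<longleftrightarrow> (\<forall>x\<in>S. g differentiable at x)"
    using differentiable_cong_open[of S _ f g] Suc.prems by blast
  ultimately show ?case by simp
qed

lemma Ck_on_subset: "Ck_on k S f \<Longrightarrow> T \<subseteq> S \<Longrightarrow> Ck_on k T f"
proof (induction k arbitrary: f)
  case (Suc k)
  then show ?case by (auto simp: subset_iff)
qed (auto intro: continuous_on_subset)

lemma Ck_on_Suc_imp: "Ck_on (Suc k) S f \<Longrightarrow> Ck_on k S f"
proof (induction k arbitrary: f)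
  case 0
  then show ?case
    by (auto intro!: continuous_at_imp_continuous_on differentiable_imp_continuous_within)
next
  case (Suc k)
  then show ?case by auto
qed

lemma Ck_on_local:
  "(\<And>x. x \<in> S \<Longrightarrow> \<exists>N. open N \<and> x \<in> N \<and> Ck_on k N f) \<Longrightarrow> Ck_on k S f"
proof (induction k arbitrary: f)
  case 0
  have "isCont f x" if "x \<in> S" for x
    using 0[OF that] by (auto simp: continuous_on_eq_continuous_at)
  then show ?case by (simp add: continuous_at_imp_continuous_on)
next
  case (Suc k)
  have "f differentiable at x" if "x \<in> S" for x
    using Suc.prems[OF that] by auto
  moreover have "Ck_on k S (\<lambda>x. dd f x v)" for v
  proof (rule Suc.IH)
    fix x assume "x \<in> S"
    from Suc.prems[OF this] show "\<exists>N. open N \<and> x \<in> N \<and> Ck_on k N (\<lambda>x. dd f x v)"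
      by auto
  qed
  ultimately show ?case by simp
qed

lemma Ck_on_const: "Ck_on k S (\<lambda>x. c)"
proof (induction k arbitrary: c)
  case (Suc k)
  show ?case using Suc[of 0] by simp
qed simp

lemma Ck_on_bounded_linear: "bounded_linear f \<Longrightarrow> Ck_on k S f"
proof (induction k)
  case 0
  then show ?case by (simp add: linear_continuous_on)
next
  case (Suc k)
  then have "(f has_derivative f) (at x)" for x
    by (simp add: bounded_linear_imp_has_derivative)
  then have "dd f x = f" "f differentiable (at x)" for x
    by (auto simp: dd_eqI differentiable_def)
  then show ?case by (simp add: Ck_on_const)
qed

lemma Ck_on_add:
  "open S \<Longrightarrow> Ck_on k S f \<Longrightarrow> Ck_on k S g \<Longrightarrow> Ck_on k S (\<lambda>x. f x + g x)"
proof (induction k arbitrary: f g)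
  case 0
  then show ?case by (simp add: continuous_on_add)
next
  case (Suc k)
  have d: "((\<lambda>x. f x + g x) has_derivative (\<lambda>v. dd f x v + dd g x v)) (at x)" if "x \<in> S" for x
    using Suc.prems that by (auto intro!: derivative_eq_intros has_derivative_dd)
  have "Ck_on k S (\<lambda>x. dd (\<lambda>x. f x + g x) x v) \<longleftrightarrow> Ck_on k S (\<lambda>x. dd f x v + dd g x v)" for v
    using Suc.prems(1) dd_eqI[OF d] by (intro Ck_on_cong) auto
  then show ?case using Suc by (auto intro: differentiableI[OF d])
qed

lemma Ck_on_bilinear:
  assumes "bounded_bilinear B" "open S"
  shows "Ck_on k S f \<Longrightarrow> Ck_on k S g \<Longrightarrow> Ck_on k S (\<lambda>x. B (f x) (g x))"
proof (induction k arbitrary: f g)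
  case 0
  then show ?case by (simp add: bounded_bilinear.continuous_on[OF assms(1)])
next
  case (Suc k)
  have d: "((\<lambda>x. B (f x) (g x)) has_derivative (\<lambda>v. B (f x) (dd g x v) + B (dd f x v) (g x))) (at x)"
    if "x \<in> S" for x
    using Suc.prems that
    by (auto intro!: bounded_bilinear.FDERIV[OF assms(1)] has_derivative_dd)
  have "Ck_on k S (\<lambda>x. dd (\<lambda>x. B (f x) (g x)) x v) \<longleftrightarrow>
        Ck_on k S (\<lambda>x. B (f x) (dd g x v) + B (dd f x v) (g x))" for v
    using assms(2) dd_eqI[OF d] by (intro Ck_on_cong) auto
  moreover have "Ck_on k S f" "Ck_on k S g"
    using Suc.prems Ck_on_Suc_imp by blast+
  ultimately have "Ck_on k S (\<lambda>x. dd (\<lambda>x. B (f x) (g x)) x v)" for v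
    using Suc by (auto intro!: Ck_on_add assms)
  then show ?case by (auto intro: differentiableI[OF d])
qed

lemma Ck_on_sum:
  assumes "open S" "\<And>i. i \<in> I \<Longrightarrow> Ck_on k S (f i)"
  shows "Ck_on k S (\<lambda>x. \<Sum>i\<in>I. f i x)"
  using assms(2)
proof (induction I rule: infinite_finite_induct)
  case (insert i I)
  then show ?case using Ck_on_add[OF assms(1)] by auto
qed (auto simp: Ck_on_const)

lemma Ck_on_prod:
  fixes f :: "'i \<Rightarrow> 'a::euclidean_space \<Rightarrow> real"
  assumes "open S" "\<And>i. i \<in> I \<Longrightarrow> Ck_on k S (f i)"
  shows "Ck_on k S (\<lambda>x. \<Prod>i\<in>I. f i x)"
  using assms(2)
proof (induction I rule: infinite_finite_induct)
  case (insert i I)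
  then show ?case using Ck_on_bilinear[OF bounded_bilinear_mult assms(1)] by auto
qed (auto simp: Ck_on_const)

lemma linear_euclidean_sum:
  assumes "linear h"
  shows "h v = (\<Sum>b\<in>Basis. (v \<bullet> b) *\<^sub>R h b)"
  by (metis (no_types, lifting) assms euclidean_representation linear_sum linear_cmul sum.cong)

text \<open>Induction on \<open>k\<close> with \<open>f\<close> fixed and \<open>g\<close> varying.
  Expanding the inner derivative in the basis frees the chain rule from directions that depend on
  \<open>x\<close>: each \<open>dd g (f x) b\<close> is again a composition with \<open>f\<close>,
  now of one order less.\<close>

lemma Ck_on_compose:
  assumes "open S" "open T"
  shows "Ck_on k S f \<Longrightarrow> Ck_on k T g \<Longrightarrow> f ` S \<subseteq> T \<Longrightarrow> Ck_on k S (\<lambda>x. g (f x))"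
proof (induction k arbitrary: g)
  case 0
  then show ?case using continuous_on_compose2 by (metis Ck_on.simps(1))
next
  case (Suc k)
  have d: "((\<lambda>x. g (f x)) has_derivative (\<lambda>v. dd g (f x) (dd f x v))) (at x)" if "x \<in> S" for x
  proof -
    have "(f has_derivative dd f x) (at x)" "(g has_derivative dd g (f x)) (at (f x))"
      using Suc.prems that by (auto intro!: has_derivative_dd)
    from diff_chain_at[OF this] show ?thesis by (simp add: o_def)
  qed
  have eq: "dd (\<lambda>x. g (f x)) x v = (\<Sum>b\<in>Basis. (dd f x v \<bullet> b) *\<^sub>R dd g (f x) b)" if "x \<in> S" for x v
  proof -
    have "linear (dd g (f x))" using Suc.prems that by (auto intro!: linear_dd)
    then show ?thesis using dd_eqI[OF d[OF that]] linear_euclidean_sum by metis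
  qed
  have "Ck_on k S (\<lambda>x. \<Sum>b\<in>Basis. (dd f x v \<bullet> b) *\<^sub>R dd g (f x) b)" for v
  proof (intro Ck_on_sum Ck_on_bilinear[OF bounded_bilinear_scaleR] assms(1))
    fix b :: 'b assume "b \<in> Basis"
    show "Ck_on k S (\<lambda>x. dd f x v \<bullet> b)"
      using Suc.prems by (intro Ck_on_bilinear[OF bounded_bilinear_inner assms(1)] Ck_on_const) auto
    show "Ck_on k S (\<lambda>x. dd g (f x) b)"
      using Suc.prems Ck_on_Suc_imp[OF Suc.prems(1)] by (intro Suc.IH[where g = "\<lambda>y. dd g y b"]) auto
  qed
  then have "Ck_on k S (\<lambda>x. dd (\<lambda>x. g (f x)) x v)" for v
    using Ck_on_cong[OF assms(1), of "\<lambda>x. dd (\<lambda>x. g (f x)) x v"] eq by auto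
  then show ?case by (auto intro: differentiableI[OF d])
qed

text \<open>The derivative of \<open>1 / f\<close> involves only \<open>1 / f\<close> and the
  derivative of \<open>f\<close>, so the order can be raised by one at each step.\<close>

lemma Ck_on_inverse:
  fixes f :: "'a::euclidean_space \<Rightarrow> real"
  assumes "open S" "\<And>x. x \<in> S \<Longrightarrow> f x \<noteq> 0"
  shows "Ck_on k S f \<Longrightarrow> Ck_on k S (\<lambda>x. inverse (f x))"
proof (induction k)
  case 0
  then show ?case using assms by (simp add: continuous_on_inverse)
next
  case (Suc k)
  have d: "((\<lambda>x. inverse (f x)) has_derivative (\<lambda>v. - (inverse (f x) * dd f x v * inverse (f x)))) (at x)"
    if "x \<in> S" for x
    using Suc.prems that assms by (intro Deriv.has_derivative_inverse has_derivative_dd) auto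
  have "Ck_on k S (\<lambda>x. (-1) * (inverse (f x) * dd f x v * inverse (f x)))" for v
    using Suc Ck_on_Suc_imp by (intro Ck_on_bilinear[OF bounded_bilinear_mult assms(1)] Ck_on_const) auto
  then have "Ck_on k S (\<lambda>x. dd (\<lambda>x. inverse (f x)) x v)" for v
    using Ck_on_cong[OF assms(1), of "\<lambda>x. dd (\<lambda>x. inverse (f x)) x v"] dd_eqI[OF d] by auto
  then show ?case by (auto intro: differentiableI[OF d])
qed

lemma Ck_on_componentwise:
  assumes "open S" "\<And>b. b \<in> Basis \<Longrightarrow> Ck_on k S (\<lambda>x. f x \<bullet> b)"
  shows "Ck_on k S f"
proof -
  have "Ck_on k S (\<lambda>x. \<Sum>b\<in>Basis. (f x \<bullet> b) *\<^sub>R b)"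
    using assms by (intro Ck_on_sum Ck_on_bilinear[OF bounded_bilinear_scaleR] Ck_on_const) auto
  then show ?thesis by (simp add: euclidean_representation)
qed

section \<open>Closure rules for smooth maps\<close>

lemma smooth_on_cong:
  "open S \<Longrightarrow> (\<And>x. x \<in> S \<Longrightarrow> f x = g x) \<Longrightarrow> smooth_on S f \<longleftrightarrow> smooth_on S g"
  unfolding smooth_on_def using Ck_on_cong by blast

lemma smooth_on_subset: "smooth_on S f \<Longrightarrow> T \<subseteq> S \<Longrightarrow> smooth_on T f"
  unfolding smooth_on_def using Ck_on_subset by blast

lemma smooth_on_local:
  "(\<And>x. x \<in> S \<Longrightarrow> \<exists>N. open N \<and> x \<in> N \<and> smooth_on N f) \<Longrightarrow> smooth_on S f"
  unfolding smooth_on_def by (metis Ck_on_local)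

lemma smooth_on_const: "smooth_on S (\<lambda>x. c)"
  by (simp add: smooth_on_def Ck_on_const)

lemma smooth_on_bounded_linear: "bounded_linear f \<Longrightarrow> smooth_on S f"
  by (simp add: smooth_on_def Ck_on_bounded_linear)

lemma smooth_on_add:
  "open S \<Longrightarrow> smooth_on S f \<Longrightarrow> smooth_on S g \<Longrightarrow> smooth_on S (\<lambda>x. f x + g x)"
  by (simp add: smooth_on_def Ck_on_add)

lemma smooth_on_mult:
  fixes f :: "'a::euclidean_space \<Rightarrow> real"
  shows "open S \<Longrightarrow> smooth_on S f \<Longrightarrow> smooth_on S g \<Longrightarrow> smooth_on S (\<lambda>x. f x * g x)"
  by (simp add: smooth_on_def Ck_on_bilinear[OF bounded_bilinear_mult])

lemma smooth_on_inner:
  fixes f :: "'a::euclidean_space \<Rightarrow> 'b::euclidean_space"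
  shows "open S \<Longrightarrow> smooth_on S f \<Longrightarrow> smooth_on S g \<Longrightarrow> smooth_on S (\<lambda>x. f x \<bullet> g x)"
  by (simp add: smooth_on_def Ck_on_bilinear[OF bounded_bilinear_inner])

lemma smooth_on_scaleR:
  "open S \<Longrightarrow> smooth_on S f \<Longrightarrow> smooth_on S g \<Longrightarrow> smooth_on S (\<lambda>x. f x *\<^sub>R g x)"
  by (simp add: smooth_on_def Ck_on_bilinear[OF bounded_bilinear_scaleR])

lemma smooth_on_uminus:
  assumes "open S" "smooth_on S f" shows "smooth_on S (\<lambda>x. - f x)"
  using smooth_on_scaleR[OF assms(1) smooth_on_const[of S "-1"] assms(2)] by simp

lemma smooth_on_diff:
  assumes "open S" "smooth_on S f" "smooth_on S g" shows "smooth_on S (\<lambda>x. f x - g x)"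
  using smooth_on_add[OF assms(1,2) smooth_on_uminus[OF assms(1,3)]] by simp

lemma smooth_on_sum:
  "open S \<Longrightarrow> (\<And>i. i \<in> I \<Longrightarrow> smooth_on S (f i)) \<Longrightarrow> smooth_on S (\<lambda>x. \<Sum>i\<in>I. f i x)"
  by (simp add: smooth_on_def Ck_on_sum)

lemma smooth_on_prod:
  fixes f :: "'i \<Rightarrow> 'a::euclidean_space \<Rightarrow> real"
  shows "open S \<Longrightarrow> (\<And>i. i \<in> I \<Longrightarrow> smooth_on S (f i)) \<Longrightarrow> smooth_on S (\<lambda>x. \<Prod>i\<in>I. f i x)"
  by (simp add: smooth_on_def Ck_on_prod)

lemma smooth_on_compose:
  "open S \<Longrightarrow> open T \<Longrightarrow> smooth_on S f \<Longrightarrow> smooth_on T g \<Longrightarrow> f ` S \<subseteq> T \<Longrightarrow>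
    smooth_on S (\<lambda>x. g (f x))"
  by (simp add: smooth_on_def Ck_on_compose)

lemma smooth_on_divide:
  fixes f g :: "'a::euclidean_space \<Rightarrow> real"
  assumes "open S" "smooth_on S f" "smooth_on S g" "\<And>x. x \<in> S \<Longrightarrow> g x \<noteq> 0"
  shows "smooth_on S (\<lambda>x. f x / g x)"
proof -
  have "smooth_on S (\<lambda>x. inverse (g x))"
    using assms by (simp add: smooth_on_def Ck_on_inverse)
  then show ?thesis using smooth_on_mult assms by (simp add: divide_inverse)
qed

lemma smooth_on_vec:
  fixes f :: "'a::euclidean_space \<Rightarrow> 'b::euclidean_space ^ 'n"
  assumes "open S" "\<And>i. smooth_on S (\<lambda>x. f x $ i)"
  shows "smooth_on S f"
  unfolding smooth_on_def
proof
  fix k show "Ck_on k S f"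
  proof (rule Ck_on_componentwise[OF assms(1)])
    fix b :: "'b ^ 'n" assume "b \<in> Basis"
    then obtain u i where b: "b = axis i u" unfolding Basis_vec_def by auto
    have "Ck_on k S (\<lambda>x. f x $ i \<bullet> u)"
      using assms(2)[of i] by (intro Ck_on_bilinear[OF bounded_bilinear_inner assms(1)] Ck_on_const)
        (simp add: smooth_on_def)
    then show "Ck_on k S (\<lambda>x. f x \<bullet> b)" by (simp add: b inner_axis)
  qed
qed

lemma smooth_on_vec_nth:
  fixes f :: "'a::euclidean_space \<Rightarrow> 'b::euclidean_space ^ 'n"
  assumes "open S" "smooth_on S f"
  shows "smooth_on S (\<lambda>x. f x $ i)"
  using smooth_on_compose[OF assms(1) open_UNIV assms(2)
      smooth_on_bounded_linear[OF bounded_linear_vec_nth]] by simp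

lemma smooth_on_imp_differentiable: "smooth_on S f \<Longrightarrow> x \<in> S \<Longrightarrow> f differentiable (at x)"
  unfolding smooth_on_def by (metis Ck_on.simps(2))

lemma smooth_on_imp_has_derivative: "smooth_on S f \<Longrightarrow> x \<in> S \<Longrightarrow> (f has_derivative dd f x) (at x)"
  by (simp add: smooth_on_imp_differentiable has_derivative_dd)

lemma smooth_on_imp_continuous_on: "smooth_on S f \<Longrightarrow> continuous_on S f"
  unfolding smooth_on_def by (metis Ck_on.simps(1))

lemma smooth_on_dd: "smooth_on S f \<Longrightarrow> smooth_on S (\<lambda>x. dd f x v)"
  unfolding smooth_on_def by (metis Ck_on.simps(2))

lemma smooth_on_linear_dd: "smooth_on S f \<Longrightarrow> x \<in> S \<Longrightarrow> linear (dd f x)"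
  by (rule linear_dd[OF smooth_on_imp_differentiable])

lemma smooth_on_det:
  fixes f :: "'a::euclidean_space \<Rightarrow> real ^ 'n ^ 'n"
  assumes "open S" "\<And>i j. smooth_on S (\<lambda>x. f x $ i $ j)"
  shows "smooth_on S (\<lambda>x. det (f x))"
  unfolding det_def using assms
  by (intro smooth_on_sum smooth_on_mult smooth_on_prod smooth_on_const) auto

subsection \<open>Symmetry of second derivatives\<close>

text \<open>The mean value theorem twice: along \<open>v\<close> for the difference of
  \<open>f\<close> between two parallel segments, then along \<open>w\<close> for the derivative in
  direction \<open>v\<close>. The second difference is symmetric in \<open>v\<close> and
  \<open>w\<close>, which is what Schwarz's theorem needs.\<close>

lemma mixed_difference_mean_value:
  fixes f :: "'a::euclidean_space \<Rightarrow> real"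
  assumes conv: "\<And>s t. s \<in> {0..e} \<Longrightarrow> t \<in> {0..e} \<Longrightarrow> x + s *\<^sub>R v + t *\<^sub>R w \<in> S"
    and e: "e > 0"
    and d1: "\<And>y. y \<in> S \<Longrightarrow> f differentiable (at y)"
    and d2: "\<And>y. y \<in> S \<Longrightarrow> (\<lambda>z. dd f z v) differentiable (at y)"
  shows "\<exists>s\<in>{0..e}. \<exists>t\<in>{0..e}. f (x + e *\<^sub>R v + e *\<^sub>R w) - f (x + e *\<^sub>R v) - f (x + e *\<^sub>R w) + f x
            = e * e * dd (\<lambda>z. dd f z v) (x + s *\<^sub>R v + t *\<^sub>R w) w"
proof -
  define g where "g s = f (x + s *\<^sub>R v + e *\<^sub>R w) - f (x + s *\<^sub>R v)" for s
  have der: "((\<lambda>s. f (x + s *\<^sub>R v + t *\<^sub>R w)) has_real_derivative dd f (x + s *\<^sub>R v + t *\<^sub>R w) v) (at s)"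
    if "s \<in> {0..e}" "t \<in> {0..e}" for s t
  proof -
    have 1: "(f has_derivative dd f (x + s *\<^sub>R v + t *\<^sub>R w)) (at (x + s *\<^sub>R v + t *\<^sub>R w))"
      using conv that d1 has_derivative_dd by blast
    have "((\<lambda>s. x + s *\<^sub>R v + t *\<^sub>R w) has_derivative (\<lambda>h. h *\<^sub>R v)) (at s)"
      by (auto intro!: derivative_eq_intros)
    from has_derivative_compose[OF this 1]
    have "((\<lambda>s. f (x + s *\<^sub>R v + t *\<^sub>R w)) has_derivative (\<lambda>h. dd f (x + s *\<^sub>R v + t *\<^sub>R w) (h *\<^sub>R v))) (at s)" .
    moreover have "dd f (x + s *\<^sub>R v + t *\<^sub>R w) (h *\<^sub>R v) = dd f (x + s *\<^sub>R v + t *\<^sub>R w) v * h" for h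
      using linear_dd[OF d1] conv that by (simp add: linear_cmul)
    ultimately show ?thesis by (simp add: has_field_derivative_def)
  qed
  have "\<exists>s. 0 < s \<and> s < e \<and> g e - g 0 = (e - 0) * (dd f (x + s *\<^sub>R v + e *\<^sub>R w) v - dd f (x + s *\<^sub>R v + 0 *\<^sub>R w) v)"
    using e der[of _ e] der[of _ 0] unfolding g_def
    by (intro MVT2) (auto intro!: derivative_eq_intros)
  then obtain s where s: "0 < s" "s < e"
    "g e - g 0 = e * (dd f (x + s *\<^sub>R v + e *\<^sub>R w) v - dd f (x + s *\<^sub>R v + 0 *\<^sub>R w) v)" by auto
  have der2: "((\<lambda>t. dd f (x + s *\<^sub>R v + t *\<^sub>R w) v) has_real_derivative dd (\<lambda>z. dd f z v) (x + s *\<^sub>R v + t *\<^sub>R w) w) (at t)"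
    if "t \<in> {0..e}" for t
  proof -
    let ?y = "x + s *\<^sub>R v + t *\<^sub>R w"
    have y: "?y \<in> S" using conv s that by auto
    have "((\<lambda>t. x + s *\<^sub>R v + t *\<^sub>R w) has_derivative (\<lambda>h. h *\<^sub>R w)) (at t)"
      by (auto intro!: derivative_eq_intros)
    from has_derivative_compose[OF this has_derivative_dd[OF d2[OF y]]]
    have "((\<lambda>t. dd f (x + s *\<^sub>R v + t *\<^sub>R w) v) has_derivative (\<lambda>h. dd (\<lambda>z. dd f z v) ?y (h *\<^sub>R w))) (at t)" .
    moreover have "dd (\<lambda>z. dd f z v) ?y (h *\<^sub>R w) = dd (\<lambda>z. dd f z v) ?y w * h" for h
      using linear_dd[OF d2[OF y]] by (simp add: linear_cmul)
    ultimately show ?thesis by (simp add: has_field_derivative_def)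
  qed
  have "\<exists>t. 0 < t \<and> t < e \<and> dd f (x + s *\<^sub>R v + e *\<^sub>R w) v - dd f (x + s *\<^sub>R v + 0 *\<^sub>R w) v
       = (e - 0) * dd (\<lambda>z. dd f z v) (x + s *\<^sub>R v + t *\<^sub>R w) w"
    using e by (intro MVT2 der2) auto
  then obtain t where t: "0 < t" "t < e" "dd f (x + s *\<^sub>R v + e *\<^sub>R w) v - dd f (x + s *\<^sub>R v + 0 *\<^sub>R w) v
       = e * dd (\<lambda>z. dd f z v) (x + s *\<^sub>R v + t *\<^sub>R w) w" by auto
  show ?thesis
    using s t by (intro bexI[of _ s] bexI[of _ t]) (auto simp: g_def)
qed

text \<open>Schwarz's theorem. The same second difference, divided by the square of the step, is a
  value of either mixed derivative at a point near \<open>x\<close>, and both mixed derivatives are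
  continuous.\<close>

lemma dd_dd_commute_real:
  fixes f :: "'a::euclidean_space \<Rightarrow> real"
  assumes "open S" "x \<in> S" "Ck_on 2 S f"
  shows "dd (\<lambda>y. dd f y v) x w = dd (\<lambda>y. dd f y w) x v"
proof -
  have f: "f differentiable at y" "(\<lambda>z. dd f z u) differentiable (at y)" if "y \<in> S" for y u
    using assms(3) that by (auto simp: numeral_2_eq_2)
  have cont: "isCont (\<lambda>y. dd (\<lambda>y. dd f y u) y u') x" for u u'
    using assms by (auto simp: numeral_2_eq_2 continuous_on_eq_continuous_at)
  have "\<bar>dd (\<lambda>y. dd f y v) x w - dd (\<lambda>y. dd f y w) x v\<bar> \<le> 2 * \<epsilon>" if \<epsilon>: "\<epsilon> > 0" for \<epsilon>
  proof -
    have near_x: "eventually (\<lambda>y. dist (F y) (F x) < \<epsilon>) (nhds x)" if "isCont F x" for F :: "'a \<Rightarrow> real"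
    proof -
      have "eventually (\<lambda>y. dist (F y) (F x) < \<epsilon>) (at x)"
        using that \<epsilon> unfolding continuous_at tendsto_iff by blast
      then have "eventually (\<lambda>y. y \<noteq> x \<longrightarrow> dist (F y) (F x) < \<epsilon>) (nhds x)"
        by (simp add: eventually_at_filter)
      then show ?thesis
        by (rule eventually_mono) (use \<epsilon> in auto)
    qed
    have "eventually (\<lambda>y. y \<in> S \<and> dist (dd (\<lambda>y. dd f y v) y w) (dd (\<lambda>y. dd f y v) x w) < \<epsilon> \<and>
       dist (dd (\<lambda>y. dd f y w) y v) (dd (\<lambda>y. dd f y w) x v) < \<epsilon>) (nhds x)"
      using near_x[OF cont] eventually_nhds_in_open[OF assms(1,2)]
      by (intro eventually_conj) auto
    then obtain d where d: "d > 0" and ball: "\<And>y. dist y x < d \<Longrightarrow> y \<in> S \<and> dist (dd (\<lambda>y. dd f y v) y w) (dd (\<lambda>y. dd f y v) x w) < \<epsilon> \<and>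
       dist (dd (\<lambda>y. dd f y w) y v) (dd (\<lambda>y. dd f y w) x v) < \<epsilon>"
      unfolding eventually_nhds_metric by blast
    \<comment> \<open>The summand 1 keeps \<open>M\<close> positive even for
      \<open>v = w = 0\<close>; the step \<open>e\<close> keeps the whole parallelogram within
      distance \<open>d / 2\<close> of \<open>x\<close>.\<close>
    define M where "M = norm v + norm w + 1"
    define e where "e = d / (2 * M)"
    have pos: "M > 0" by (simp add: M_def add_nonneg_pos)
    have e: "e > 0" using d pos by (simp add: e_def)
    have near: "dist (x + s *\<^sub>R v + t *\<^sub>R w) x < d" if "s \<in> {0..e}" "t \<in> {0..e}" for s t
    proof -
      have "dist (x + s *\<^sub>R v + t *\<^sub>R w) x = norm (s *\<^sub>R v + t *\<^sub>R w)" by (simp add: dist_norm add.assoc)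
      also have "\<dots> \<le> s * norm v + t * norm w"
        using that norm_triangle_ineq[of "s *\<^sub>R v" "t *\<^sub>R w"] by auto
      also have "\<dots> \<le> e * norm v + e * norm w"
        using that by (auto intro!: add_mono mult_right_mono)
      also have "\<dots> \<le> e * M" using e by (simp add: M_def algebra_simps)
      also have "\<dots> = d / 2" using pos by (simp add: e_def)
      also have "\<dots> < d" using d by simp
      finally show ?thesis .
    qed
    obtain s t where st: "s \<in> {0..e}" "t \<in> {0..e}"
      "f (x + e *\<^sub>R v + e *\<^sub>R w) - f (x + e *\<^sub>R v) - f (x + e *\<^sub>R w) + f x
            = e * e * dd (\<lambda>z. dd f z v) (x + s *\<^sub>R v + t *\<^sub>R w) w"
      using mixed_difference_mean_value[of e x v w S f] near ball e f by blast
    have near': "dist (x + s *\<^sub>R w + t *\<^sub>R v) x < d" if "s \<in> {0..e}" "t \<in> {0..e}" for s t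
      using near[OF that(2,1)] by (simp add: algebra_simps)
    obtain s' t' where st': "s' \<in> {0..e}" "t' \<in> {0..e}"
      "f (x + e *\<^sub>R w + e *\<^sub>R v) - f (x + e *\<^sub>R w) - f (x + e *\<^sub>R v) + f x
            = e * e * dd (\<lambda>z. dd f z w) (x + s' *\<^sub>R w + t' *\<^sub>R v) v"
      using mixed_difference_mean_value[of e x w v S f] near' ball e f by blast
    have "f (x + e *\<^sub>R v + e *\<^sub>R w) = f (x + e *\<^sub>R w + e *\<^sub>R v)" by (simp add: add_ac)
    then have "e * e * dd (\<lambda>z. dd f z v) (x + s *\<^sub>R v + t *\<^sub>R w) w = e * e * dd (\<lambda>z. dd f z w) (x + s' *\<^sub>R w + t' *\<^sub>R v) v"
      using st(3) st'(3) by linarith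
    then have eq: "dd (\<lambda>z. dd f z v) (x + s *\<^sub>R v + t *\<^sub>R w) w = dd (\<lambda>z. dd f z w) (x + s' *\<^sub>R w + t' *\<^sub>R v) v"
      using e by simp
    have "dist (dd (\<lambda>y. dd f y v) (x + s *\<^sub>R v + t *\<^sub>R w) w) (dd (\<lambda>y. dd f y v) x w) < \<epsilon>"
      "dist (dd (\<lambda>y. dd f y w) (x + s' *\<^sub>R w + t' *\<^sub>R v) v) (dd (\<lambda>y. dd f y w) x v) < \<epsilon>"
      using ball[OF near[OF st(1,2)]] ball[OF near'[OF st'(1,2)]] by blast+
    then show ?thesis using eq by (simp add: dist_real_def)
  qed
  \<comment> \<open>With a quarter of the supposed gap as \<epsilon>, the gap would be at most half
    of itself.\<close>
  from this[of "\<bar>dd (\<lambda>y. dd f y v) x w - dd (\<lambda>y. dd f y w) x v\<bar> / 4"] show ?thesis by (cases "dd (\<lambda>y. dd f y v) x w = dd (\<lambda>y. dd f y w) x v") auto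
qed

lemma dd_inner:
  assumes "f differentiable (at x)"
  shows "dd (\<lambda>y. f y \<bullet> b) x v = dd f x v \<bullet> b"
  using dd_eqI[OF has_derivative_inner_left[OF has_derivative_dd[OF assms]]] by simp

lemma dd_vec_nth:
  fixes f :: "'a::euclidean_space \<Rightarrow> real ^ 'n"
  assumes "f differentiable (at x)"
  shows "dd (\<lambda>y. f y $ i) x v = dd f x v $ i"
  using dd_inner[OF assms, of "axis i 1"] by (simp add: inner_axis)

lemma dd_dd_commute:
  fixes f :: "'a::euclidean_space \<Rightarrow> 'b::euclidean_space"
  assumes "open S" "x \<in> S" "smooth_on S f"
  shows "dd (\<lambda>y. dd f y v) x w = dd (\<lambda>y. dd f y w) x v"
proof (rule euclidean_eqI)
  fix b :: 'b assume "b \<in> Basis"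
  have "smooth_on S (\<lambda>y. f y \<bullet> b)"
    by (rule smooth_on_inner[OF assms(1,3) smooth_on_const])
  then have "Ck_on 2 S (\<lambda>y. f y \<bullet> b)" by (simp add: smooth_on_def)
  from dd_dd_commute_real[OF assms(1,2) this]
  have "dd (\<lambda>y. dd (\<lambda>y. f y \<bullet> b) y v) x w = dd (\<lambda>y. dd (\<lambda>y. f y \<bullet> b) y w) x v" .
  moreover have "dd (\<lambda>y. dd (\<lambda>y. f y \<bullet> b) y v) x w = dd (\<lambda>y. dd f y v) x w \<bullet> b" for v w
  proof -
    have "dd (\<lambda>y. dd (\<lambda>y. f y \<bullet> b) y v) x = dd (\<lambda>y. dd f y v \<bullet> b) x"
      using assms by (intro dd_cong_open[of S]) (auto intro!: dd_inner smooth_on_imp_differentiable)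
    then show ?thesis using smooth_on_imp_differentiable[OF smooth_on_dd[OF assms(3)] assms(2)]
      by (simp add: dd_inner)
  qed
  ultimately show "dd (\<lambda>y. dd f y v) x w \<bullet> b = dd (\<lambda>y. dd f y w) x v \<bullet> b" by simp
qed

section \<open>Determinants as alternating multilinear forms\<close>

text \<open>The argument is a family of rows indexed by \<open>'m\<close>, the kind of argument that
  a \<open>topform\<close> takes, so that replacing a row is a function update.\<close>

definition detv :: "('m::finite \<Rightarrow> real ^ 'm) \<Rightarrow> real" where
  "detv V = det (\<chi> i. V i)"

lemma am_linear: "alternating_multilinear \<omega> \<Longrightarrow> linear (\<lambda>v. \<omega> (V(i := v)))"
  by (simp add: alternating_multilinear_def)

lemma am_zero: "alternating_multilinear \<omega> \<Longrightarrow> i \<noteq> j \<Longrightarrow> V i = V j \<Longrightarrow> \<omega> V = 0"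
  unfolding alternating_multilinear_def by blast

lemma am_detv: "alternating_multilinear (detv :: ('m::finite \<Rightarrow> real ^ 'm) \<Rightarrow> real)"
  unfolding alternating_multilinear_def
proof (intro conjI allI impI)
  fix V :: "'m \<Rightarrow> real ^ 'm" and i
  have eq: "(\<chi> j. (V(i := v)) j) = (\<chi> j. if j = i then v else V j)" for v
    by (simp add: vec_eq_iff)
  show "linear (\<lambda>v. detv (V(i := v)))"
    unfolding detv_def eq
  proof (rule linearI)
    fix u w and r :: real
    show "det (\<chi> j. if j = i then u + w else V j) = det (\<chi> j. if j = i then u else V j) + det (\<chi> j. if j = i then w else V j)"
      by (rule det_row_add)
    show "det (\<chi> j. if j = i then r *\<^sub>R u else V j) = r *\<^sub>R det (\<chi> j. if j = i then u else V j)"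
      using det_row_mul[of i r "\<lambda>_. u" V] by (simp add: scalar_mult_eq_scaleR cong: if_cong)
  qed
next
  fix V :: "'m \<Rightarrow> real ^ 'm" and i j
  assume "i \<noteq> j \<and> V i = V j"
  then show "detv V = 0"
    unfolding detv_def by (intro det_identical_rows[of i j]) (auto simp: row_def vec_eq_iff)
qed

text \<open>Polarisation: the form vanishes with \<open>u + v\<close> in both slots, and expanding
  leaves the two mixed terms.\<close>

lemma am_swap:
  assumes "alternating_multilinear \<omega>" "i \<noteq> j"
  shows "\<omega> (V(i := u, j := v)) = - \<omega> (V(i := v, j := u))"
proof -
  have z: "\<omega> (V(i := w, j := w)) = 0" for w
    using assms by (intro am_zero[OF assms(1,2)]) auto
  have a1: "\<omega> (V(i := x, j := y + y')) = \<omega> (V(i := x, j := y)) + \<omega> (V(i := x, j := y'))" for x y y'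
    using linear_add[OF am_linear[OF assms(1), of "V(i := x)" j]] by simp
  have a2: "\<omega> (V(i := x + x', j := y)) = \<omega> (V(i := x, j := y)) + \<omega> (V(i := x', j := y))" for x x' y
    using linear_add[OF am_linear[OF assms(1), of "V(j := y)" i]] assms(2)
    by (simp add: fun_upd_twist)
  show ?thesis using z[of "u + v"] z[of u] z[of v] by (simp add: a1 a2)
qed

lemma am_expand:
  assumes "alternating_multilinear \<omega>"
  shows "\<omega> (V(i := v)) = (\<Sum>k\<in>UNIV. v $ k * \<omega> (V(i := axis k 1)))"
proof -
  have "v = (\<Sum>k\<in>UNIV. v $ k *\<^sub>R axis k 1)"
    by (simp add: vec_eq_iff axis_def if_distrib cong: if_cong)
  then have "\<omega> (V(i := v)) = \<omega> (V(i := (\<Sum>k\<in>UNIV. v $ k *\<^sub>R axis k 1)))" by simp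
  also have "\<dots> = (\<Sum>k\<in>UNIV. \<omega> (V(i := v $ k *\<^sub>R axis k 1)))"
    by (rule linear_sum[OF am_linear[OF assms]])
  also have "\<dots> = (\<Sum>k\<in>UNIV. v $ k * \<omega> (V(i := axis k 1)))"
    by (intro sum.cong refl) (simp add: linear_cmul[OF am_linear[OF assms]])
  finally show ?thesis .
qed

text \<open>Let \<open>T\<close> collect the slots that may still hold arbitrary vectors. Expanding
  one of them in the standard basis removes it from \<open>T\<close>, so induction on
  \<open>T\<close> ends at rows of basis vectors.\<close>

lemma am_zero_if_axis_zero:
  assumes am: "alternating_multilinear \<omega>" and z: "\<And>\<sigma>. \<omega> (\<lambda>i. axis (\<sigma> i) 1) = 0"
  shows "\<omega> V = 0"
proof -
  have "\<omega> V = 0" if "finite T" "\<And>i. i \<notin> T \<Longrightarrow> \<exists>j. V i = axis j 1" for T V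
    using that
  proof (induction T arbitrary: V rule: finite_induct)
    case empty
    then have "\<forall>i. \<exists>j. V i = axis j 1" by simp
    then obtain \<sigma> where "\<forall>i. V i = axis (\<sigma> i) 1" by metis
    then have "V = (\<lambda>i. axis (\<sigma> i) 1)" by auto
    then show ?case using z by simp
  next
    case (insert i T)
    have z: "\<omega> (V(i := axis k 1)) = 0" for k
    proof (rule insert.IH)
      fix l assume "l \<notin> T"
      then show "\<exists>j. (V(i := axis k 1)) l = axis j 1" using insert.prems[of l] by (cases "l = i") auto
    qed
    have "\<omega> V = \<omega> (V(i := V i))" by simp
    also have "\<dots> = (\<Sum>k\<in>UNIV. V i $ k * \<omega> (V(i := axis k 1)))" by (rule am_expand[OF am])
    also have "\<dots> = 0"
      by (simp add: z)
    finally show ?case .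
  qed
  from this[of UNIV V] show ?thesis by simp
qed

text \<open>The space of top-degree forms is one-dimensional. The difference \<open>\<eta>\<close>
  of both sides vanishes at the standard basis, hence at each permutation of it, which is a product
  of transpositions, and at repeated basis vectors because it is alternating.\<close>

lemma am_unique:
  assumes am: "alternating_multilinear \<omega>"
  shows "\<omega> V = \<omega> (\<lambda>i. axis i 1) * detv V"
proof -
  define \<eta> where "\<eta> V = \<omega> V - \<omega> (\<lambda>i. axis i 1) * detv V" for V
  have "linear (\<lambda>v. \<eta> (V(i := v)))" for V i
    unfolding \<eta>_def
    by (rule linear_compose_sub[OF am_linear[OF am] linear_compose_scale_right[OF am_linear[OF am_detv], simplified]])
  then have am': "alternating_multilinear \<eta>"
    using am_zero[OF am] am_zero[OF am_detv]
    unfolding alternating_multilinear_def \<eta>_def by (metis (no_types, lifting) diff_self mult_zero_right)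
  have \<eta>_id: "\<eta> (\<lambda>i. axis i 1) = 0"
  proof -
    have "(\<chi> i. axis i 1) = (mat 1 :: real ^ 'a ^ 'a)" by (simp add: vec_eq_iff mat_def axis_def)
    then show ?thesis by (simp add: \<eta>_def detv_def)
  qed
  have "\<eta> (\<lambda>i. axis (\<sigma> i) 1) = 0" for \<sigma>
  proof (cases "inj \<sigma>")
    case False
    then obtain i j where "i \<noteq> j" "\<sigma> i = \<sigma> j" by (auto simp: inj_def)
    then show ?thesis by (intro am_zero[OF am', of i j]) auto
  next
    case True
    then have "bij \<sigma>" by (simp add: bij_def finite_UNIV_inj_surj)
    then have "\<sigma> permutes UNIV" by (auto intro: bij_imp_permutes)
    then show ?thesis
    proof (induction rule: permutes_rev_induct[OF finite[of UNIV], consumes 1, case_names id swap])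
      case id
      show ?case using \<eta>_id by simp
    next
      case (swap a b p)
      let ?V = "\<lambda>i. axis (p i) (1::real)"
      have "(\<lambda>i. axis ((p \<circ> Transposition.transpose a b) i) 1) = ?V(a := ?V b, b := ?V a)"
        using swap.hyps by (auto simp: Transposition.transpose_def)
      then have "\<eta> (\<lambda>i. axis ((p \<circ> Transposition.transpose a b) i) 1) = \<eta> (?V(a := ?V b, b := ?V a))"
        by (rule arg_cong)
      also have "\<dots> = - \<eta> (?V(a := ?V a, b := ?V b))" by (rule am_swap[OF am' swap.hyps(3)])
      also have "\<dots> = 0"
      proof -
        have "?V(a := ?V a, b := ?V b) = ?V" by (rule ext) simp
        then have "\<eta> (?V(a := ?V a, b := ?V b)) = \<eta> ?V" by (rule arg_cong)
        then show ?thesis using swap.IH by linarith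
      qed
      finally show ?case .
    qed
  qed
  from am_zero_if_axis_zero[OF am' this] have "\<eta> V = 0" .
  then show ?thesis by (simp add: \<eta>_def)
qed

lemma detv_axis: "detv (\<lambda>i. axis i 1) = 1"
proof -
  have "(\<chi> i. axis i 1) = (mat 1 :: real ^ 'a ^ 'a)" by (simp add: vec_eq_iff mat_def axis_def)
  then show ?thesis by (simp add: detv_def)
qed

lemma detv_matrix_vector_mult: "detv (\<lambda>k. M *v V k) = det M * detv V"
proof -
  have "(\<chi> k. M *v V k) = (\<chi> k. V k) ** transpose M"
    by (simp add: vec_eq_iff matrix_matrix_mult_def matrix_vector_mult_def transpose_def mult.commute)
  then show ?thesis by (simp add: detv_def det_mul det_transpose)
qed

text \<open>Jacobi's formula, read off from the Leibniz expansion: each product over a permutation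
  is differentiated one factor at a time, and exchanging the sums collects the terms of one slot
  into a determinant.\<close>

lemma has_derivative_detv:
  fixes V :: "'m::finite \<Rightarrow> 'a::real_normed_vector \<Rightarrow> real ^ 'm"
  assumes "\<And>i. (V i has_derivative V' i) (at x)"
  shows "((\<lambda>x. detv (\<lambda>k. V k x)) has_derivative (\<lambda>h. \<Sum>i\<in>UNIV. detv ((\<lambda>k. V k x)(i := V' i h)))) (at x)"
proof -
  have comp: "((\<lambda>x. V i x $ j) has_derivative (\<lambda>h. V' i h $ j)) (at x)" for i j
    by (rule bounded_linear.has_derivative[OF bounded_linear_vec_nth assms])
  have "((\<lambda>x. \<Sum>p\<in>{p. p permutes UNIV}. of_int (sign p) * (\<Prod>i\<in>UNIV. V i x $ p i)) has_derivative
     (\<lambda>h. \<Sum>p\<in>{p. p permutes UNIV}. of_int (sign p) * (\<Sum>i\<in>UNIV. V' i h $ p i * (\<Prod>j\<in>UNIV - {i}. V j x $ p j)))) (at x)"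
    by (intro has_derivative_sum has_derivative_mult_right has_derivative_prod comp)
  moreover have "(\<Sum>p\<in>{p. p permutes UNIV}. of_int (sign p) * (\<Sum>i\<in>UNIV. V' i h $ p i * (\<Prod>j\<in>UNIV - {i}. V j x $ p j)))
     = (\<Sum>i\<in>UNIV. detv ((\<lambda>k. V k x)(i := V' i h)))" for h
  proof -
    have "(\<Prod>k\<in>UNIV. ((\<lambda>k. V k x)(i := V' i h)) k $ p k) = V' i h $ p i * (\<Prod>j\<in>UNIV - {i}. V j x $ p j)" for p i
      by (subst prod.remove[of _ i]) (auto intro!: prod.cong)
    then have "(\<Sum>i\<in>UNIV. detv ((\<lambda>k. V k x)(i := V' i h))) =
       (\<Sum>i\<in>UNIV. \<Sum>p\<in>{p. p permutes UNIV}. of_int (sign p) * (V' i h $ p i * (\<Prod>j\<in>UNIV - {i}. V j x $ p j)))"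
      by (simp add: detv_def det_def del: fun_upd_apply)
    also have "\<dots> = (\<Sum>p\<in>{p. p permutes UNIV}. \<Sum>i\<in>UNIV. of_int (sign p) * (V' i h $ p i * (\<Prod>j\<in>UNIV - {i}. V j x $ p j)))"
      by (rule sum.swap)
    finally show ?thesis by (simp add: sum_distrib_left)
  qed
  ultimately show ?thesis by (simp add: detv_def det_def)
qed

text \<open>The sum over the slots is alternating and multilinear in \<open>V\<close>, hence a
  multiple of \<open>detv V\<close> by \<open>am_unique\<close>; the standard basis shows that the
  factor is the trace of \<open>A\<close>.\<close>

lemma detv_trace:
  fixes A :: "real ^ 'm \<Rightarrow> real ^ 'm"
  assumes A: "linear A"
  shows "(\<Sum>i\<in>UNIV. detv (V(i := A (V i)))) = (\<Sum>i\<in>UNIV. A (axis i 1) $ i) * detv V"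
proof -
  define \<omega> where "\<omega> V = (\<Sum>i\<in>UNIV. detv (V(i := A (V i))))" for V :: "'m \<Rightarrow> real ^ 'm"
  note lin = am_linear[OF am_detv]
  have "linear (\<lambda>v. \<omega> (V(k := v)))" for V k
  proof -
    have "linear (\<lambda>v. detv ((V(k := v))(i := A ((V(k := v)) i))))" for i
    proof (cases "i = k")
      case True
      then show ?thesis using linear_compose[OF A lin[of V k]] by (simp add: o_def)
    next
      case False
      then show ?thesis using lin[of "V(i := A (V i))" k] by (simp add: fun_upd_twist)
    qed
    then show ?thesis unfolding \<omega>_def by (intro linear_compose_sum) auto
  qed
  \<comment> \<open>All summands except those for \<open>k\<close> and \<open>l\<close> still have
    two equal rows, and these two cancel by antisymmetry.\<close>
  moreover have "\<omega> V = 0" if kl: "k \<noteq> l" "V k = V l" for V k l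
  proof -
    have "\<omega> V = (\<Sum>i\<in>{k, l}. detv (V(i := A (V i))))"
      unfolding \<omega>_def using kl
    proof (intro sum.mono_neutral_right ballI)
      fix i assume "i \<in> UNIV - {k, l}"
      then show "detv (V(i := A (V i))) = 0" using kl by (intro am_zero[OF am_detv kl(1)]) auto
    qed auto
    also have "\<dots> = detv (V(k := A (V k), l := V k)) + detv (V(k := V k, l := A (V k)))"
      using kl by (simp add: fun_upd_idem)
    also have "\<dots> = 0" using am_swap[OF am_detv kl(1), of V "A (V k)" "V k"] by simp
    finally show ?thesis .
  qed
  ultimately have "alternating_multilinear \<omega>" by (auto simp: alternating_multilinear_def)
  from am_unique[OF this, of V] have "\<omega> V = \<omega> (\<lambda>i. axis i 1) * detv V" .
  moreover have "detv ((\<lambda>i. axis i 1)(i := A (axis i 1))) = A (axis i 1) $ i" for i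
  proof -
    have "detv ((\<lambda>i. axis i 1)(i := A (axis i 1))) = (\<Sum>k\<in>UNIV. A (axis i 1) $ k * detv ((\<lambda>i. axis i 1)(i := axis k 1)))"
      by (rule am_expand[OF am_detv])
    also have "\<dots> = (\<Sum>k\<in>{i}. A (axis i 1) $ k * detv ((\<lambda>i. axis i 1)(i := axis k 1)))"
    proof (intro sum.mono_neutral_right ballI)
      fix k assume "k \<in> UNIV - {i}"
      then have "detv ((\<lambda>i. axis i 1)(i := axis k 1)) = 0"
        by (intro am_zero[OF am_detv, of i k]) auto
      then show "A (axis i 1) $ k * detv ((\<lambda>i. axis i 1)(i := axis k 1)) = 0" by simp
    qed auto
    also have "\<dots> = A (axis i 1) $ i" by (simp add: fun_upd_idem detv_axis)
    finally show ?thesis .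
  qed
  ultimately show ?thesis by (simp add: \<omega>_def)
qed

text \<open>In its use below \<open>H\<close> is a Hessian, and \<open>F\<close> is an array of
  determinants, skew because its indices name the basis vectors in two of their rows.\<close>

lemma symmetric_antisymmetric_sum_zero:
  fixes H :: "'m::finite \<Rightarrow> 'm \<Rightarrow> real"
  assumes "\<And>j l. H j l = H l j" "\<And>j l. F j l = - F l j"
  shows "(\<Sum>j\<in>UNIV. \<Sum>l\<in>UNIV. H j l * F j l) = 0"
proof -
  have "(\<Sum>j\<in>UNIV. \<Sum>l\<in>UNIV. H j l * F j l) = (\<Sum>j\<in>UNIV. \<Sum>l\<in>UNIV. H l j * F l j)"
    by (rule sum.swap)
  also have "\<dots> = (\<Sum>j\<in>UNIV. \<Sum>l\<in>UNIV. - (H j l * F j l))"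
  proof (intro sum.cong refl)
    fix j l show "H l j * F l j = - (H j l * F j l)" using assms(1)[of l j] assms(2)[of l j] by simp
  qed
  also have "\<dots> = - (\<Sum>j\<in>UNIV. \<Sum>l\<in>UNIV. H j l * F j l)" by (simp add: sum_negf)
  finally show ?thesis by simp
qed

lemma detv_nonzero_iff:
  "detv V \<noteq> 0 \<longleftrightarrow> (\<forall>c. (\<Sum>i\<in>UNIV. c i *\<^sub>R V i) = 0 \<longrightarrow> (\<forall>i. c i = 0))"
proof -
  have "detv V \<noteq> 0 \<longleftrightarrow> (\<exists>B. (\<chi> i. V i) ** B = mat 1)"
    by (simp add: detv_def invertible_det_nz[symmetric] invertible_right_inverse)
  also have "\<dots> \<longleftrightarrow> (\<forall>c. (\<Sum>i\<in>UNIV. c i *s row i (\<chi> i. V i)) = 0 \<longrightarrow> (\<forall>i. c i = 0))"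
    by (rule matrix_right_invertible_independent_rows)
  also have "\<dots> \<longleftrightarrow> (\<forall>c. (\<Sum>i\<in>UNIV. c i *\<^sub>R V i) = 0 \<longrightarrow> (\<forall>i. c i = 0))"
    by (simp add: row_def scalar_mult_eq_scaleR)
  finally show ?thesis .
qed

lemma detv_nonzero_span:
  assumes "detv V \<noteq> 0"
  obtains c where "v = (\<Sum>i\<in>UNIV. c i *\<^sub>R V i)"
proof -
  obtain B where B: "B ** (\<chi> i. V i) = mat 1"
    using assms by (auto simp: detv_def invertible_det_nz[symmetric] invertible_left_inverse)
  have "v = v v* (B ** (\<chi> i. V i))" by (simp add: B)
  also have "\<dots> = (v v* B) v* (\<chi> i. V i)" by (simp add: vector_matrix_mul_assoc)
  also have "\<dots> = (\<Sum>i\<in>UNIV. ((v v* B) $ i) *\<^sub>R V i)"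
    by (simp add: vec_eq_iff vector_matrix_mult_def mult.commute)
  finally show ?thesis using that by blast
qed

lemma detv_nonzero_orthogonal_zero:
  assumes "detv V \<noteq> 0" "\<And>i. V i \<bullet> z = 0"
  shows "z = 0"
proof -
  obtain c where "z = (\<Sum>i\<in>UNIV. c i *\<^sub>R V i)" using detv_nonzero_span[OF assms(1)] by blast
  then have "z \<bullet> z = (\<Sum>i\<in>UNIV. c i *\<^sub>R V i) \<bullet> z" by simp
  also have "\<dots> = 0" by (simp add: inner_sum_left assms(2))
  finally show ?thesis by simp
qed

section \<open>The bivector determined by \<open>m - 2\<close> covectors\<close>

text \<open>
  The covectors \<open>dc\<^sub>1, \<dots>, dc\<^sub>m\<^sub>-\<^sub>2\<close> are the rows of an \<open>m \<times> m\<close> array with indices other than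
  \<open>r0\<close> and \<open>r1\<close>; the remaining two rows receive the arguments of the bivector.
\<close>

locale two_slots =
  fixes r0 r1 :: "'m::finite"
  assumes slots_distinct: "r0 \<noteq> r1"
begin

definition rows2 :: "('m \<Rightarrow> real ^ 'm) \<Rightarrow> real ^ 'm \<Rightarrow> real ^ 'm \<Rightarrow> 'm \<Rightarrow> real ^ 'm" where
  "rows2 K \<alpha> \<beta> = K(r0 := \<alpha>, r1 := \<beta>)"

text \<open>The dual, with respect to the standard volume, of the wedge product of the rows outside
  the two slots. The vectors \<open>K r0\<close> and \<open>K r1\<close> are overwritten and carry
  no information.\<close>

definition bv :: "('m \<Rightarrow> real ^ 'm) \<Rightarrow> real ^ 'm ^ 'm" where
  "bv K = (\<chi> i j. detv (rows2 K (axis i 1) (axis j 1)))"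

definition independent_rows :: "('m \<Rightarrow> real ^ 'm) \<Rightarrow> bool" where
  "independent_rows K \<longleftrightarrow>
     (\<forall>a. (\<Sum>k\<in>-{r0, r1}. a k *\<^sub>R K k) = 0 \<longrightarrow> (\<forall>k\<in>-{r0, r1}. a k = 0))"

lemma slot_cases:
  obtains "k = r0" | "k = r1" | "k \<noteq> r0" "k \<noteq> r1"
  by blast

lemma rows2_simps [simp]:
  "rows2 K \<alpha> \<beta> r0 = \<alpha>" "rows2 K \<alpha> \<beta> r1 = \<beta>" "k \<noteq> r0 \<Longrightarrow> k \<noteq> r1 \<Longrightarrow> rows2 K \<alpha> \<beta> k = K k"
  using slots_distinct by (auto simp: rows2_def)

lemma detv_rows2_swap: "detv (rows2 K \<alpha> \<beta>) = - detv (rows2 K \<beta> \<alpha>)"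
  unfolding rows2_def by (rule am_swap[OF am_detv slots_distinct])

lemma detv_rows2_same [simp]: "detv (rows2 K \<alpha> \<alpha>) = 0"
  by (rule am_zero[OF am_detv slots_distinct]) simp

lemma detv_rows2_row:
  assumes "k \<noteq> r0" "k \<noteq> r1"
  shows "detv (rows2 K (K k) \<beta>) = 0" "detv (rows2 K \<alpha> (K k)) = 0"
  using assms am_zero[OF am_detv, of r0 k "rows2 K (K k) \<beta>"]
    am_zero[OF am_detv, of r1 k "rows2 K \<alpha> (K k)"] by auto

lemma sharp_bv_nth: "sharp (bv K) \<alpha> $ j = detv (rows2 K \<alpha> (axis j 1))"
proof -
  have "detv (rows2 K \<alpha> (axis j 1)) = detv ((K(r1 := axis j 1))(r0 := \<alpha>))"
    using slots_distinct by (simp add: rows2_def fun_upd_twist)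
  also have "\<dots> = (\<Sum>k\<in>UNIV. \<alpha> $ k * detv ((K(r1 := axis j 1))(r0 := axis k 1)))"
    by (rule am_expand[OF am_detv])
  also have "\<dots> = (\<Sum>k\<in>UNIV. \<alpha> $ k * bv K $ k $ j)"
    using slots_distinct by (simp add: bv_def rows2_def fun_upd_twist)
  finally show ?thesis by (simp add: sharp_def vector_matrix_mult_def mult.commute)
qed

lemma sharp_bv_inner: "sharp (bv K) \<alpha> \<bullet> \<beta> = detv (rows2 K \<alpha> \<beta>)"
proof -
  have "detv (rows2 K \<alpha> \<beta>) = (\<Sum>k\<in>UNIV. \<beta> $ k * detv (rows2 K \<alpha> (axis k 1)))"
    unfolding rows2_def by (rule am_expand[OF am_detv])
  then show ?thesis by (simp add: inner_vec_def sharp_bv_nth mult.commute)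
qed

lemma sharp_bv_skew: "sharp (bv K) \<alpha> \<bullet> \<beta> = - (\<alpha> \<bullet> sharp (bv K) \<beta>)"
  using detv_rows2_swap[of K \<alpha> \<beta>] by (simp add: sharp_bv_inner inner_commute[of \<alpha>])

lemma sharp_bv_row: "k \<noteq> r0 \<Longrightarrow> k \<noteq> r1 \<Longrightarrow> sharp (bv K) (K k) = 0"
  by (simp add: vec_eq_iff sharp_bv_nth detv_rows2_row)

lemma row_inner_sharp_bv: "k \<noteq> r0 \<Longrightarrow> k \<noteq> r1 \<Longrightarrow> K k \<bullet> sharp (bv K) \<alpha> = 0"
  using sharp_bv_skew[of K \<alpha> "K k"] by (metis inner_commute sharp_bv_inner detv_rows2_row(2))

lemma bv_skew: "bv K $ i $ j = - bv K $ j $ i"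
  using detv_rows2_swap[of K "axis i 1" "axis j 1"] by (simp add: bv_def)

lemma linear_sharp: "linear (sharp P)"
  unfolding sharp_def by (rule linearI) (simp_all add: vec_eq_iff vector_matrix_mult_def
      algebra_simps sum.distrib sum_distrib_left)

text \<open>Both sides pair equally with the rows of \<open>rows2 K \<alpha> \<beta>\<close>, which
  form a basis. The leaf directions are thus spanned by \<open>sharp (bv K) \<alpha>\<close> and
  \<open>sharp (bv K) \<beta>\<close>, with explicit coefficients.\<close>

lemma tangent_eq:
  assumes "\<And>k. k \<noteq> r0 \<Longrightarrow> k \<noteq> r1 \<Longrightarrow> K k \<bullet> E = 0" "detv (rows2 K \<alpha> \<beta>) \<noteq> 0"
  shows "detv (rows2 K \<alpha> \<beta>) *\<^sub>R E = (\<beta> \<bullet> E) *\<^sub>R sharp (bv K) \<alpha> - (\<alpha> \<bullet> E) *\<^sub>R sharp (bv K) \<beta>"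
proof -
  define Z where "Z = detv (rows2 K \<alpha> \<beta>) *\<^sub>R E - ((\<beta> \<bullet> E) *\<^sub>R sharp (bv K) \<alpha> - (\<alpha> \<bullet> E) *\<^sub>R sharp (bv K) \<beta>)"
  have "rows2 K \<alpha> \<beta> k \<bullet> Z = 0" for k
  proof -
    have "\<alpha> \<bullet> Z = 0" "\<beta> \<bullet> Z = 0"
      using detv_rows2_swap[of K \<beta> \<alpha>]
      by (simp_all add: Z_def inner_diff_right sharp_bv_inner inner_commute[of _ "sharp _ _"])
    moreover have "K k \<bullet> Z = 0" if "k \<noteq> r0" "k \<noteq> r1"
      using assms(1)[OF that] row_inner_sharp_bv[OF that]
      by (simp add: Z_def inner_diff_right)
    ultimately show ?thesis by (cases k rule: slot_cases) auto
  qed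
  from detv_nonzero_orthogonal_zero[OF assms(2) this] show ?thesis by (simp add: Z_def)
qed

text \<open>By \<open>tangent_eq\<close> the vector \<open>E\<close> lies in the range of
  \<open>sharp (bv K)\<close>, and by skewness a covector in the kernel annihilates this
  range.\<close>

lemma inner_tangent_zero:
  assumes "\<And>k. k \<noteq> r0 \<Longrightarrow> k \<noteq> r1 \<Longrightarrow> K k \<bullet> E = 0" "bv K \<noteq> 0" "sharp (bv K) \<gamma> = 0"
  shows "\<gamma> \<bullet> E = 0"
proof -
  obtain i j where "bv K $ i $ j \<noteq> 0" using assms(2) by (auto simp: vec_eq_iff)
  then have nz: "detv (rows2 K (axis i 1) (axis j 1)) \<noteq> 0" by (simp add: bv_def)
  from tangent_eq[OF assms(1) nz]
  have "detv (rows2 K (axis i 1) (axis j 1)) * (\<gamma> \<bullet> E) =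
     \<gamma> \<bullet> ((axis j 1 \<bullet> E) *\<^sub>R sharp (bv K) (axis i 1) - (axis i 1 \<bullet> E) *\<^sub>R sharp (bv K) (axis j 1))"
    by (metis inner_scaleR_right)
  moreover have "\<gamma> \<bullet> sharp (bv K) \<alpha> = 0" for \<alpha>
    using sharp_bv_skew[of K \<gamma> \<alpha>] assms(3) by simp
  ultimately show ?thesis using nz by (simp add: inner_diff_right)
qed

text \<open>The converse of the preceding lemma: vectors in the range of \<open>sharp (bv K)\<close>
  are themselves annihilated by the rows, so the assumption applies to them, and skewness moves
  \<open>sharp\<close> over to \<open>\<gamma>\<close>.\<close>

lemma sharp_zeroI:
  assumes "\<And>E. (\<And>k. k \<noteq> r0 \<Longrightarrow> k \<noteq> r1 \<Longrightarrow> K k \<bullet> E = 0) \<Longrightarrow> \<gamma> \<bullet> E = 0"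
  shows "sharp (bv K) \<gamma> = 0"
proof -
  have "sharp (bv K) \<gamma> \<bullet> \<alpha> = 0" for \<alpha>
    using assms[of "sharp (bv K) \<alpha>"] sharp_bv_skew[of K \<gamma> \<alpha>] row_inner_sharp_bv by simp
  then show ?thesis by (metis inner_eq_zero_iff)
qed

lemma dependent_rows_bv_zero:
  assumes "\<not> independent_rows K"
  shows "bv K = 0"
proof -
  obtain a k where a: "(\<Sum>k\<in>-{r0, r1}. a k *\<^sub>R K k) = 0" "k \<in> -{r0, r1}" "a k \<noteq> 0"
    using assms by (auto simp: independent_rows_def)
  have "detv (rows2 K \<alpha> \<beta>) = 0" for \<alpha> \<beta>
  proof -
    have "(\<Sum>i\<in>UNIV. (if i \<in> -{r0, r1} then a i else 0) *\<^sub>R rows2 K \<alpha> \<beta> i) = (\<Sum>k\<in>-{r0, r1}. a k *\<^sub>R K k)"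
      by (intro sum.mono_neutral_cong_right) auto
    then have "(\<Sum>i\<in>UNIV. (if i \<in> -{r0, r1} then a i else 0) *\<^sub>R rows2 K \<alpha> \<beta> i) = 0" using a by simp
    then have "\<exists>c. (\<Sum>i\<in>UNIV. c i *\<^sub>R rows2 K \<alpha> \<beta> i) = 0 \<and> (\<exists>i. c i \<noteq> 0)"
      using a(2,3) by (intro exI[of _ "\<lambda>i. if i \<in> -{r0, r1} then a i else 0"] conjI exI[of _ k]) auto
    then show ?thesis using detv_nonzero_iff[of "rows2 K \<alpha> \<beta>"] by blast
  qed
  then show ?thesis by (simp add: vec_eq_iff bv_def)
qed

text \<open>Two further rows \<open>\<alpha>\<close> and \<open>\<beta>\<close>, each outside the
  span of what precedes it, complete the given ones to a basis, since neither \<open>m - 2\<close>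
  nor \<open>m - 1\<close> vectors span the space. At this basis the determinant is nonzero.\<close>

lemma independent_rows_bv_nonzero:
  assumes "independent_rows K"
  shows "bv K \<noteq> 0"
proof -
  let ?T = "K ` (-{r0, r1})"
  have card_T: "card (-{r0, r1}) + 2 = CARD('m)"
  proof -
    have "card {r0, r1} + card (- {r0, r1}) = CARD('m)"
      by (metis Compl_partition card_Un_disjoint finite Compl_disjoint)
    then show ?thesis using slots_distinct by simp
  qed
  have ex: "\<exists>v. v \<notin> span S" if "finite S" "card S < CARD('m)" for S :: "(real ^ 'm) set"
  proof (rule ccontr)
    assume "\<not> ?thesis"
    then have "span S = UNIV" by auto
    then have "dim S = CARD('m)" by (metis dim_span dim_UNIV DIM_cart DIM_real mult.right_neutral)
    then show False using that dim_le_card'[of S] by simp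
  qed
  have "card ?T \<le> card (-{r0, r1})" by (simp add: card_image_le)
  then obtain \<alpha> where \<alpha>: "\<alpha> \<notin> span ?T" using ex[of ?T] card_T by auto
  have "card (insert \<alpha> ?T) < CARD('m)"
    using card_insert_le_m1[of "CARD('m) - 1" ?T \<alpha>] \<open>card ?T \<le> card (-{r0, r1})\<close> card_T by linarith
  then obtain \<beta> where \<beta>: "\<beta> \<notin> span (insert \<alpha> ?T)" using ex[of "insert \<alpha> ?T"] by auto
  have "\<forall>i. c i = 0" if c: "(\<Sum>i\<in>UNIV. c i *\<^sub>R rows2 K \<alpha> \<beta> i) = 0" for c
  proof -
    define \<Sigma> where "\<Sigma> = (\<Sum>i\<in>-{r0, r1}. c i *\<^sub>R K i)"
    have "(UNIV :: 'm set) = insert r0 (insert r1 (-{r0, r1}))" by auto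
    then have "(\<Sum>i\<in>UNIV. c i *\<^sub>R rows2 K \<alpha> \<beta> i) =
        (\<Sum>i\<in>insert r0 (insert r1 (-{r0, r1})). c i *\<^sub>R rows2 K \<alpha> \<beta> i)" by simp
    also have "\<dots> = c r0 *\<^sub>R \<alpha> + c r1 *\<^sub>R \<beta> + \<Sigma>"
      using slots_distinct by (simp add: \<Sigma>_def)
    finally have eq: "c r0 *\<^sub>R \<alpha> + c r1 *\<^sub>R \<beta> + \<Sigma> = 0" using c by simp
    have \<Sigma>: "\<Sigma> \<in> span ?T" unfolding \<Sigma>_def by (intro span_sum span_scale span_base) auto
    have c1: "c r1 = 0"
    proof (rule ccontr)
      assume nz: "c r1 \<noteq> 0"
      have "c r1 *\<^sub>R \<beta> = - (c r0 *\<^sub>R \<alpha>) - \<Sigma>" using eq by (simp add: algebra_simps eq_neg_iff_add_eq_0)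
      moreover have "- (c r0 *\<^sub>R \<alpha>) - \<Sigma> \<in> span (insert \<alpha> ?T)"
        using \<Sigma> by (intro span_diff span_neg span_scale) (auto intro: span_base span_mono[THEN subsetD, rotated])
      ultimately have "inverse (c r1) *\<^sub>R (c r1 *\<^sub>R \<beta>) \<in> span (insert \<alpha> ?T)"
        using span_scale by metis
      then show False using nz \<beta> by simp
    qed
    have c0: "c r0 = 0"
    proof (rule ccontr)
      assume nz: "c r0 \<noteq> 0"
      have "c r0 *\<^sub>R \<alpha> = - \<Sigma>" using eq c1 by (simp add: eq_neg_iff_add_eq_0)
      then have "inverse (c r0) *\<^sub>R (c r0 *\<^sub>R \<alpha>) \<in> span ?T"
        using span_scale \<Sigma> span_neg by metis
      then show False using nz \<alpha> by simp
    qed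
    have "\<Sigma> = 0" using eq c0 c1 by simp
    then show ?thesis using assms c0 c1 unfolding independent_rows_def \<Sigma>_def
      by (metis ComplI empty_iff insert_iff)
  qed
  then have "detv (rows2 K \<alpha> \<beta>) \<noteq> 0" by (simp add: detv_nonzero_iff)
  then have "sharp (bv K) \<alpha> \<noteq> 0" using sharp_bv_inner[of K \<alpha> \<beta>] by auto
  moreover have "sharp 0 \<alpha> = 0" by (simp add: sharp_def vec_eq_iff vector_matrix_mult_def)
  ultimately show ?thesis by metis
qed

text \<open>Evaluated at basis covectors, all rows of the determinant acquire the common factor
  \<open>transpose J\<close>, which comes out as \<open>det J\<close>. The division by the density
  in \<open>bivector\<close> will cancel it.\<close>

lemma bv_transform:
  assumes "\<And>k. k \<noteq> r0 \<Longrightarrow> k \<noteq> r1 \<Longrightarrow> K k = transpose J *v K' k"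
  shows "J ** bv K ** transpose J = det J *\<^sub>R bv K'"
proof -
  have "(J ** bv K ** transpose J) $ i $ j = det J * bv K' $ i $ j" for i j
  proof -
    have 1: "(J ** bv K ** transpose J) $ i $ j = sharp (bv K) (transpose J *v axis i 1) \<bullet> (transpose J *v axis j 1)"
      by (simp add: sharp_def matrix_matrix_mult_def vector_matrix_mult_def inner_vec_def transpose_def
          matrix_vector_mult_basis column_def mult_ac)
    have "rows2 K (transpose J *v axis i 1) (transpose J *v axis j 1) =
       (\<lambda>k. transpose J *v rows2 K' (axis i 1) (axis j 1) k)"
    proof
      fix k show "rows2 K (transpose J *v axis i 1) (transpose J *v axis j 1) k = transpose J *v rows2 K' (axis i 1) (axis j 1) k"
        using assms[of k] by (cases k rule: slot_cases) auto
    qed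
    then show ?thesis unfolding 1 sharp_bv_inner
      by (simp only: detv_matrix_vector_mult det_transpose) (simp add: bv_def)
  qed
  then show ?thesis by (simp add: vec_eq_iff)
qed

text \<open>On the basis formed by two coordinate covectors and the rows, \<open>sharp\<close> kills
  the rows, so two vectors span the range. Each of them pairs to zero with its own covector and
  nontrivially with the other, whence their independence.\<close>

lemma dim_range_sharp_bv:
  assumes "bv K \<noteq> 0" "s \<noteq> 0"
  shows "dim (range (sharp (s *\<^sub>R bv K))) = 2"
proof -
  let ?P = "s *\<^sub>R bv K"
  obtain i j where "bv K $ i $ j \<noteq> 0" using assms by (auto simp: vec_eq_iff)
  then have nz: "detv (rows2 K (axis i 1) (axis j 1)) \<noteq> 0" by (simp add: bv_def)
  let ?\<alpha> = "axis i 1 :: real ^ 'm" and ?\<beta> = "axis j 1 :: real ^ 'm"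
  have sP: "sharp ?P v = s *\<^sub>R sharp (bv K) v" for v
    by (simp add: sharp_def vec_eq_iff vector_matrix_mult_def sum_distrib_left mult_ac)
  define u w where "u = sharp ?P ?\<alpha>" and "w = sharp ?P ?\<beta>"
  have uw: "u \<bullet> ?\<alpha> = 0" "w \<bullet> ?\<beta> = 0" "u \<bullet> ?\<beta> \<noteq> 0" "w \<bullet> ?\<alpha> \<noteq> 0"
    using nz assms(2) detv_rows2_swap[of K ?\<alpha> ?\<beta>]
    by (simp_all add: u_def w_def sP sharp_bv_inner)
  have "range (sharp ?P) \<subseteq> span {u, w}"
  proof clarify
    fix v
    obtain c where c: "v = (\<Sum>k\<in>UNIV. c k *\<^sub>R rows2 K ?\<alpha> ?\<beta> k)" using detv_nonzero_span[OF nz] by blast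
    have "sharp ?P v = (\<Sum>k\<in>UNIV. c k *\<^sub>R sharp ?P (rows2 K ?\<alpha> ?\<beta> k))"
      by (simp add: c linear_sum[OF linear_sharp] linear_cmul[OF linear_sharp])
    also have "\<dots> \<in> span {u, w}"
    proof (intro span_sum span_scale)
      fix k show "sharp ?P (rows2 K ?\<alpha> ?\<beta> k) \<in> span {u, w}"
        by (cases k rule: slot_cases) (auto simp: u_def w_def sharp_bv_row sP intro: span_base span_zero)
    qed
    finally show "sharp ?P v \<in> span {u, w}" .
  qed
  moreover have "span {u, w} \<subseteq> span (range (sharp ?P))"
    by (intro span_mono) (auto simp: u_def w_def)
  moreover have "span (range (sharp ?P)) = range (sharp ?P)"
    using linear_subspace_image[OF linear_sharp subspace_UNIV] by (simp add: span_eq_iff)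
  ultimately have "range (sharp ?P) = span {u, w}" by blast
  moreover have "independent {u, w}" "u \<noteq> w"
  proof -
    show "u \<noteq> w" using uw by auto
    have "w \<notin> span {}" using uw by auto
    moreover have "u \<notin> span {w}" using uw by (auto simp: span_singleton)
    ultimately show "independent {u, w}" by (simp add: independent_insert)
  qed
  ultimately show ?thesis by (simp add: dim_eq_card_independent)
qed

end

section \<open>The inverse function theorem and parameter integrals\<close>

text \<open>Smoothness of \<open>g\<close> is bootstrapped: Cramer's rule writes its derivative as a
  smooth function \<open>Q v\<close> of \<open>g\<close> itself, so each order of differentiability
  yields the next.\<close>

lemma smooth_inverse_function:
  fixes f :: "real ^ 'm \<Rightarrow> real ^ 'm"
  assumes S: "open S" "x0 \<in> S" and f: "smooth_on S f"
    and inj0: "\<And>v. dd f x0 v = 0 \<Longrightarrow> v = 0"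
  obtains N V g where "open N" "N \<subseteq> S" "x0 \<in> N" "open V" "f x0 \<in> V" "homeomorphism N V f g"
    "smooth_on V g" "\<And>y v. y \<in> V \<Longrightarrow> dd f (g y) (dd g y v) = v"
proof -
  define f' where "f' x = Blinfun (dd f x)" for x
  have bl: "bounded_linear (dd f x)" if "x \<in> S" for x
    using has_derivative_bounded_linear[OF smooth_on_imp_has_derivative[OF f that]] .
  have f'_apply: "blinfun_apply (f' x) = dd f x" if "x \<in> S" for x
    using bounded_linear_Blinfun_apply[OF bl[OF that]] by (simp add: f'_def)
  have "continuous_on S (\<lambda>x. blinfun_apply (f' x) i)" for i
    using smooth_on_imp_continuous_on[OF smooth_on_dd[OF f, of i]] f'_apply
    by (simp cong: continuous_on_cong)
  then have cont: "continuous_on S f'" by (intro continuous_on_blinfun_componentwise)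
  have lin0: "linear (dd f x0)" using smooth_on_linear_dd[OF f S(2)] .
  then have "inj (dd f x0)" using inj0 by (simp add: linear_injective_0)
  then obtain q where q: "linear q" "q \<circ> dd f x0 = id"
    using linear_injective_left_inverse[OF lin0] by blast
  have "Blinfun q o\<^sub>L f' x0 = id_blinfun"
    using q f'_apply[OF S(2)]
    by (intro blinfun_eqI) (simp add: bounded_linear_Blinfun_apply linear_conv_bounded_linear pointfree_idE)
  from inverse_function_theorem[OF S(1) _ cont S(2) this] f'_apply smooth_on_imp_has_derivative[OF f]
  obtain N V g g' where *: "open N" "N \<subseteq> S" "x0 \<in> N" "open V" "f x0 \<in> V" "homeomorphism N V f g"
    and g: "\<And>y. y \<in> V \<Longrightarrow> (g has_derivative (g' y)) (at y)"
    and g': "\<And>y. y \<in> V \<Longrightarrow> g' y = inv (blinfun_apply (f' (g y)))"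
    and bij: "\<And>y. y \<in> V \<Longrightarrow> bij (blinfun_apply (f' (g y)))"
    by metis
  have gN: "g y \<in> N" "f (g y) = y" if "y \<in> V" for y
    using *(6) that by (auto simp: homeomorphism_def)
  have gS: "g y \<in> S" if "y \<in> V" for y using gN that *(2) by auto
  have right_inv: "dd f (g y) (dd g y v) = v" if "y \<in> V" for y v
    using g'[OF that] bij[OF that] dd_eqI[OF g[OF that]] f'_apply[OF gS[OF that]]
    by (simp add: bij_is_surj surj_f_inv_f)
  define a where "a z = matrix (dd f z)" for z
  have a_entry: "a z $ i $ j = dd f z (axis j 1) $ i" for z i j by (simp add: a_def matrix_def)
  have a_smooth: "smooth_on N (\<lambda>z. a z $ i $ j)" for i j
    unfolding a_entry using * by (intro smooth_on_vec_nth smooth_on_dd smooth_on_subset[OF f]) auto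
  define Q where "Q v z = (\<chi> k. det (\<chi> i j. if j = k then v $ i else a z $ i $ j) / det (a z))" for v z
  have det_nz: "det (a z) \<noteq> 0" if "z \<in> N" for z
  proof -
    have "f z \<in> V" "g (f z) = z" using *(6) that by (auto simp: homeomorphism_def)
    then have "inj (dd f z)" using bij[of "f z"] f'_apply[of z] that *(2) by (auto simp: bij_def)
    then show ?thesis unfolding a_def using det_nz_iff_inj smooth_on_linear_dd[OF f] that *(2) by blast
  qed
  have Q_smooth: "smooth_on N (Q v)" for v
  proof (rule smooth_on_vec[OF *(1)])
    fix k
    have "smooth_on N (\<lambda>z. det (\<chi> i j. if j = k then v $ i else a z $ i $ j) / det (a z))"
    proof (intro smooth_on_divide smooth_on_det *(1) a_smooth det_nz)
      fix i j show "smooth_on N (\<lambda>z. (\<chi> i j. if j = k then v $ i else a z $ i $ j) $ i $ j)"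
        using a_smooth[of i j] by (cases "j = k") (auto simp: smooth_on_const)
    qed auto
    then show "smooth_on N (\<lambda>z. Q v z $ k)" by (simp add: Q_def)
  qed
  have dg: "dd g y v = Q v (g y)" if "y \<in> V" for y v
  proof -
    have "a (g y) *v dd g y v = v"
      unfolding a_def using right_inv[OF that] smooth_on_linear_dd[OF f gS[OF that]]
      by (simp add: matrix_works)
    then show ?thesis using cramer[OF det_nz[OF gN(1)[OF that]]] by (simp add: Q_def)
  qed
  have "Ck_on k V g" for k
  proof (induction k)
    case 0
    show ?case using *(6) by (simp add: homeomorphism_def)
  next
    case (Suc k)
    have "Ck_on k V (\<lambda>y. Q v (g y))" for v
    proof (rule Ck_on_compose[OF *(4,1) Suc])
      show "Ck_on k N (Q v)" using Q_smooth[of v] by (simp add: smooth_on_def)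
      show "g ` V \<subseteq> N" using gN(1) by blast
    qed
    then have "Ck_on k V (\<lambda>y. dd g y v)" for v
      using Ck_on_cong[OF *(4), of "\<lambda>y. dd g y v" "\<lambda>y. Q v (g y)"] dg by auto
    moreover have "g differentiable (at y)" if "y \<in> V" for y using differentiableI[OF g[OF that]] .
    ultimately show ?case by simp
  qed
  then have "smooth_on V g" by (simp add: smooth_on_def)
  with that * right_inv show ?thesis by blast
qed

text \<open>Differentiation under the integral sign. The open set \<open>W\<close> around
  \<open>B \<times> {0..1}\<close> is there because smoothness of \<open>G\<close> refers to
  unrestricted derivatives, at the ends of the interval too.\<close>

lemma integral_parameter_derivative:
  fixes G :: "'a::euclidean_space \<times> real \<Rightarrow> real"
  assumes W: "open W" "smooth_on W G" and B: "open B" "B \<times> {0..1} \<subseteq> W" "x0 \<in> B"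
  shows "((\<lambda>x. integral {0..1} (\<lambda>t. G (x, t))) has_derivative
          (\<lambda>v. integral {0..1} (\<lambda>t. dd G (x0, t) (v, 0)))) (at x0)"
proof -
  obtain e where e: "e > 0" "ball x0 e \<subseteq> B" using B openE by blast
  define D where "D x t = Blinfun (\<lambda>v. dd G (x, t) (v, 0))" for x t
  have inW: "(x, t) \<in> W" if "x \<in> ball x0 e" "t \<in> cbox 0 1" for x t
    using e(2) that by (intro subsetD[OF B(2)]) auto
  have bl: "bounded_linear (\<lambda>v. dd G (x, t) (v, 0))" if "x \<in> ball x0 e" "t \<in> cbox 0 1" for x t
  proof -
    have "bounded_linear (dd G (x, t))"
      using has_derivative_bounded_linear[OF smooth_on_imp_has_derivative[OF W(2) inW[OF that]]] .
    then show ?thesis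
      using bounded_linear_compose bounded_linear_Pair bounded_linear_ident bounded_linear_zero by blast
  qed
  have D: "blinfun_apply (D x t) = (\<lambda>v. dd G (x, t) (v, 0))" if "x \<in> ball x0 e" "t \<in> cbox 0 1" for x t
    using bounded_linear_Blinfun_apply[OF bl[OF that]] by (simp add: D_def)
  have der: "((\<lambda>x. G (x, t)) has_derivative blinfun_apply (D x t)) (at x within ball x0 e)"
    if "x \<in> ball x0 e" "t \<in> cbox 0 1" for x t
  proof -
    have "((\<lambda>x. (x, t)) has_derivative (\<lambda>v. (v, 0))) (at x within ball x0 e)"
      by (auto intro!: derivative_eq_intros)
    from has_derivative_compose[OF this smooth_on_imp_has_derivative[OF W(2) inW[OF that]]]
    show ?thesis using D[OF that] by simp
  qed
  have contG: "continuous_on W G" using W smooth_on_imp_continuous_on by blast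
  have cont_line: "continuous_on {0..1} (\<lambda>t. F (x, t))"
    if "continuous_on W F" "x \<in> ball x0 e" for F :: "'a \<times> real \<Rightarrow> real" and x
    using that inW by (intro continuous_on_compose2[OF that(1)]) (auto intro!: continuous_intros)
  have int: "(\<lambda>t. G (x, t)) integrable_on cbox 0 1" if "x \<in> ball x0 e" for x
    using cont_line[OF contG that] by (simp add: integrable_continuous_interval)
  have contD: "continuous_on (ball x0 e \<times> cbox 0 1) (\<lambda>(x, t). D x t)"
  proof (rule continuous_on_blinfun_componentwise)
    fix i :: 'a
    have "continuous_on (ball x0 e \<times> cbox 0 1) (\<lambda>z. dd G z (i, 0))"
      by (rule continuous_on_subset[OF smooth_on_imp_continuous_on[OF smooth_on_dd[OF W(2)]]]) (use inW in auto)
    then show "continuous_on (ball x0 e \<times> cbox 0 1) (\<lambda>z. blinfun_apply (case z of (x, t) \<Rightarrow> D x t) i)"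
      by (rule continuous_on_eq) (auto simp: D simp del: box_real cbox_interval mem_ball)
  qed
  have "((\<lambda>x. integral (cbox 0 1) (\<lambda>t. G (x, t))) has_derivative blinfun_apply (integral (cbox 0 1) (D x0)))
     (at x0 within ball x0 e)"
    using e by (intro leibniz_rule[OF der int contD]) auto
  then have 1: "((\<lambda>x. integral {0..1} (\<lambda>t. G (x, t))) has_derivative blinfun_apply (integral (cbox 0 1) (D x0))) (at x0)"
    using e by (simp add: at_within_open[of x0 "ball x0 e"])
  have "continuous_on (cbox 0 1) (D x0)"
  proof -
    have "continuous_on (cbox 0 1) (\<lambda>t. (x0, t))"
      by (intro continuous_on_Pair continuous_on_const continuous_on_id)
    moreover have "Pair x0 ` cbox 0 1 \<subseteq> ball x0 e \<times> cbox 0 1" using e(1) by auto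
    ultimately show ?thesis using continuous_on_compose2[OF contD] by fastforce
  qed
  then have "blinfun_apply (integral (cbox 0 1) (D x0)) v = integral (cbox 0 1) (\<lambda>t. blinfun_apply (D x0 t) v)" for v
    by (intro blinfun_apply_integral integrable_continuous)
  also have "integral (cbox 0 1) (\<lambda>t. blinfun_apply (D x0 t) v) = integral {0..1} (\<lambda>t. dd G (x0, t) (v, 0))" for v
    using e D[of x0] by (auto intro!: integral_cong simp: fun_eq_iff)
  finally have "blinfun_apply (integral (cbox 0 1) (D x0)) = (\<lambda>v. integral {0..1} (\<lambda>t. dd G (x0, t) (v, 0)))" by auto
  then show ?thesis using 1 by simp
qed

text \<open>The derivative of such an integral is an integral of the same kind with \<open>G\<close>
  replaced by a directional derivative, so the induction is over all \<open>G\<close> at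
  once.\<close>

lemma smooth_on_integral_parameter:
  fixes G :: "'a::euclidean_space \<times> real \<Rightarrow> real"
  assumes W: "open W" "smooth_on W G" and B: "open B" "B \<times> {0..1} \<subseteq> W"
  shows "smooth_on B (\<lambda>x. integral {0..1} (\<lambda>t. G (x, t)))"
proof -
  note der = integral_parameter_derivative[OF W(1) _ B]
  have "Ck_on k B (\<lambda>x. integral {0..1} (\<lambda>t. G (x, t)))" if "smooth_on W G" for k and G :: "'a \<times> real \<Rightarrow> real"
    using that
  proof (induction k arbitrary: G)
    case 0
    have "isCont (\<lambda>x. integral {0..1} (\<lambda>t. G (x, t))) x" if "x \<in> B" for x
      using has_derivative_continuous[OF der[OF 0 that]] .
    then show ?case by (simp add: continuous_at_imp_continuous_on)
  next
    case (Suc k)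
    have "Ck_on k B (\<lambda>x. integral {0..1} (\<lambda>t. dd G (x, t) (v, 0)))" for v
      by (rule Suc.IH[where G = "\<lambda>z. dd G z (v, 0)"]) (rule smooth_on_dd[OF Suc.prems])
    moreover have "Ck_on k B (\<lambda>x. dd (\<lambda>x. integral {0..1} (\<lambda>t. G (x, t))) x v) \<longleftrightarrow>
        Ck_on k B (\<lambda>x. integral {0..1} (\<lambda>t. dd G (x, t) (v, 0)))" for v
      using B(1) dd_eqI[OF der[OF Suc.prems]] by (intro Ck_on_cong) auto
    ultimately show ?case by (auto intro: differentiableI[OF der[OF Suc.prems]])
  qed
  then show ?thesis using W(2) by (simp add: smooth_on_def)
qed

text \<open>
  The primitive is the integral along the segment from the slice point with coordinates
  \<open>p\<^sub>i\<close>, \<open>p\<^sub>j\<close>; only these two coordinates vary along it.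
\<close>

lemma plane_primitive:
  fixes p :: "real ^ 'm" and a b :: "real ^ 'm \<Rightarrow> real"
  assumes ij: "i \<noteq> j" and a: "smooth_on (ball p r) a" and b: "smooth_on (ball p r) b"
    and closed: "\<And>y. y \<in> ball p r \<Longrightarrow> dd a y (axis j 1) = dd b y (axis i 1)"
  obtains H where "smooth_on (ball p r) H"
    "\<And>y. y \<in> ball p r \<Longrightarrow> dd H y (axis i 1) = a y"
    "\<And>y. y \<in> ball p r \<Longrightarrow> dd H y (axis j 1) = b y"
proof -
  define pr :: "'m \<Rightarrow> 'm \<Rightarrow> real ^ 'm \<Rightarrow> real ^ 'm"
    where "pr i j y = (y $ i) *\<^sub>R axis i 1 + (y $ j) *\<^sub>R axis j 1" for i j y
  \<comment> \<open>At time 1 the path is at \<open>fst z\<close>, at time 0 at the point whose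
    coordinates \<open>i\<close> and \<open>j\<close> are those of \<open>p\<close>. The function
    \<open>G\<close> below is the form \<open>a dx_i + b dx_j\<close> evaluated on its
    velocity.\<close>
  define \<gamma> where "\<gamma> i j z = fst z + (snd z - 1) *\<^sub>R pr i j (fst z - p)" for i j and z :: "(real ^ 'm) \<times> real"
  define G where "G i j a b z = (fst z $ i - p $ i) * a (\<gamma> i j z) + (fst z $ j - p $ j) * b (\<gamma> i j z)"
    for i j and a b :: "real ^ 'm \<Rightarrow> real" and z :: "(real ^ 'm) \<times> real"
  define H where "H i j a b y = integral {0..1} (\<lambda>t. G i j a b (y, t))"
    for i j and a b :: "real ^ 'm \<Rightarrow> real" and y :: "real ^ 'm"
  \<comment> \<open>Stated for all \<open>i\<close>, \<open>j\<close>, \<open>a\<close>,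
    \<open>b\<close>, so that exchanging their roles, which leaves \<open>H\<close> unchanged,
    yields the derivative in direction \<open>j\<close>.\<close>
  have main: "smooth_on (ball p r) (H i j a b) \<and> (\<forall>y\<in>ball p r. dd (H i j a b) y (axis i 1) = a y)"
    if ij: "i \<noteq> j" and a: "smooth_on (ball p r) a" and b: "smooth_on (ball p r) b"
      and closed: "\<And>y. y \<in> ball p r \<Longrightarrow> dd a y (axis j 1) = dd b y (axis i 1)" for i j a b
  proof -
    have blfst: "bounded_linear (\<lambda>z :: (real ^ 'm) \<times> real. fst z $ k)" for k
      using bounded_linear_compose[OF bounded_linear_vec_nth bounded_linear_fst] .
    have sm_nth: "smooth_on UNIV (\<lambda>z :: (real ^ 'm) \<times> real. fst z $ k - p $ k)" for k
      by (intro smooth_on_diff smooth_on_const smooth_on_bounded_linear blfst) auto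
    have sm: "smooth_on UNIV (\<lambda>z :: (real ^ 'm) \<times> real. fst z)" "smooth_on UNIV (\<lambda>z :: (real ^ 'm) \<times> real. snd z)"
      "smooth_on UNIV (\<lambda>z :: (real ^ 'm) \<times> real. fst z $ k)" for k
      by (intro smooth_on_bounded_linear bounded_linear_fst bounded_linear_snd blfst)+
    have "linear (pr i j)" by (rule linearI) (simp_all add: pr_def algebra_simps)
    then have blpr: "bounded_linear (pr i j)" by (simp add: linear_conv_bounded_linear)
    have \<gamma>_smooth: "smooth_on UNIV (\<gamma> i j)"
      unfolding \<gamma>_def pr_def vector_minus_component
      by (intro smooth_on_add smooth_on_scaleR smooth_on_diff smooth_on_const open_UNIV sm)
    define W where "W = \<gamma> i j -` ball p r"
    have W: "open W" unfolding W_def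
      using smooth_on_imp_continuous_on[OF \<gamma>_smooth] by (intro open_vimage) auto
    have \<gamma>W: "\<gamma> i j ` W \<subseteq> ball p r" by (auto simp: W_def)
    have sm\<gamma>: "smooth_on W (\<lambda>z. c (\<gamma> i j z))" if "smooth_on (ball p r) c" for c :: "real ^ 'm \<Rightarrow> real"
      by (rule smooth_on_compose[OF W open_ball smooth_on_subset[OF \<gamma>_smooth] that \<gamma>W]) simp
    have G_smooth: "smooth_on W (G i j a b)"
      unfolding G_def using W
      by (intro smooth_on_add smooth_on_mult sm\<gamma> a b smooth_on_subset[OF sm_nth]) auto
    \<comment> \<open>The path point has two of the coordinates of \<open>y - p\<close> shrunk by
      the factor \<open>t\<close> and the others kept, so it never leaves the ball.\<close>
    have BW: "ball p r \<times> {0..1} \<subseteq> W"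
    proof clarify
      fix y :: "real ^ 'm" and t :: real assume y: "y \<in> ball p r" and t: "t \<in> {0..1}"
      have comp: "(\<gamma> i j (y, t) - p) $ k = (if k = i \<or> k = j then t else 1) * (y - p) $ k" for k
        using ij by (auto simp: \<gamma>_def pr_def axis_def algebra_simps)
      have "norm (\<gamma> i j (y, t) - p) \<le> norm (y - p)"
        using t by (intro norm_le_componentwise_cart) (auto simp: comp abs_mult intro: mult_left_le_one_le simp del: vector_minus_component)
      then show "(y, t) \<in> W" using y by (simp add: W_def dist_norm norm_minus_commute)
    qed
    have "smooth_on (ball p r) (H i j a b)"
      unfolding H_def by (rule smooth_on_integral_parameter[OF W G_smooth open_ball BW])
    moreover have "dd (H i j a b) y (axis i 1) = a y" if y: "y \<in> ball p r" for y
    proof -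
      have dH: "dd (H i j a b) y (axis i 1) = integral {0..1} (\<lambda>t. dd (G i j a b) (y, t) (axis i 1, 0))"
        unfolding H_def
        using dd_eqI[OF integral_parameter_derivative[OF W G_smooth open_ball BW y]] by simp
      define u where "u = pr i j (y - p)"
      have \<gamma>in: "\<gamma> i j (y, t) \<in> ball p r" if "t \<in> {0..1}" for t
        using subsetD[OF BW, of "(y, t)"] y that by (simp add: W_def)
      \<comment> \<open>Closedness turns the \<open>i\<close>-derivative of the integrand into a
        total derivative, that of \<open>t * a\<close> along the path; its integral is the value at
        \<open>t = 1\<close>, namely \<open>a y\<close>.\<close>
      have c\<gamma>: "((\<lambda>t. t * a (\<gamma> i j (y, t))) has_vector_derivative dd (G i j a b) (y, t) (axis i 1, 0)) (at t within {0..1})"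
        if t: "t \<in> {0..1}" for t
      proof -
        let ?g = "\<gamma> i j (y, t)"
        have d\<gamma>: "(\<gamma> i j has_derivative (\<lambda>(v, s). v + (t - 1) *\<^sub>R pr i j v + s *\<^sub>R u)) (at (y, t))"
          unfolding \<gamma>_def u_def
          by (auto intro!: derivative_eq_intros bounded_linear.has_derivative[OF blpr])
        have chain: "((\<lambda>z. c (\<gamma> i j z)) has_derivative (\<lambda>(v, s). dd c ?g (v + (t - 1) *\<^sub>R pr i j v + s *\<^sub>R u))) (at (y, t))"
          if "smooth_on (ball p r) c" for c :: "real ^ 'm \<Rightarrow> real"
          using has_derivative_compose[OF d\<gamma> smooth_on_imp_has_derivative[OF that \<gamma>in[OF t]]]
          by (simp add: case_prod_unfold)
        have "(G i j a b has_derivative (\<lambda>(v, s).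
            (fst (y, t) $ i - p $ i) * dd a ?g (v + (t - 1) *\<^sub>R pr i j v + s *\<^sub>R u) + v $ i * a ?g +
            ((fst (y, t) $ j - p $ j) * dd b ?g (v + (t - 1) *\<^sub>R pr i j v + s *\<^sub>R u) + v $ j * b ?g))) (at (y, t))"
        proof -
          have nth: "((\<lambda>z :: (real ^ 'm) \<times> real. fst z $ k - p $ k) has_derivative (\<lambda>z. fst z $ k)) (at (y, t))" for k
            using has_derivative_diff[OF bounded_linear_imp_has_derivative[OF blfst] has_derivative_const] by simp
          show ?thesis
            unfolding G_def using has_derivative_add[OF has_derivative_mult[OF nth chain[OF a]] has_derivative_mult[OF nth chain[OF b]]]
            by (simp add: case_prod_unfold)
        qed
        from dd_eqI[OF this]
        have "dd (G i j a b) (y, t) (axis i 1, 0) =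
            (y $ i - p $ i) * dd a ?g (t *\<^sub>R axis i 1) + a ?g + (y $ j - p $ j) * dd b ?g (t *\<^sub>R axis i 1)"
          using ij by (simp add: pr_def axis_def[of _ 1, THEN arg_cong[where f = "\<lambda>v. v $ _"]] algebra_simps)
        also have "\<dots> = t * ((y $ i - p $ i) * dd a ?g (axis i 1) + (y $ j - p $ j) * dd a ?g (axis j 1)) + a ?g"
          using closed[OF \<gamma>in[OF t]] linear_cmul[OF smooth_on_linear_dd[OF a \<gamma>in[OF t]]]
            linear_cmul[OF smooth_on_linear_dd[OF b \<gamma>in[OF t]]]
          by (simp add: algebra_simps)
        also have "\<dots> = t * dd a ?g u + a ?g"
          using linear_cmul[OF smooth_on_linear_dd[OF a \<gamma>in[OF t]]] linear_add[OF smooth_on_linear_dd[OF a \<gamma>in[OF t]]]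
          by (simp add: u_def pr_def)
        finally have dG: "dd (G i j a b) (y, t) (axis i 1, 0) = t * dd a ?g u + a ?g" .
        have "((\<lambda>t. (y, t)) has_derivative (\<lambda>s. (0, s))) (at t)"
          by (auto intro!: derivative_eq_intros)
        from has_derivative_compose[OF this chain[OF a]]
        have "((\<lambda>t. a (\<gamma> i j (y, t))) has_derivative (\<lambda>s. dd a ?g (s *\<^sub>R u))) (at t)"
          by (simp add: pr_def)
        then have "((\<lambda>t. a (\<gamma> i j (y, t))) has_real_derivative dd a ?g u) (at t)"
          using linear_cmul[OF smooth_on_linear_dd[OF a \<gamma>in[OF t]]]
          by (simp add: has_field_derivative_def mult_commute_abs)
        from DERIV_mult[OF DERIV_ident this]
        have "((\<lambda>t. t * a (\<gamma> i j (y, t))) has_real_derivative (t * dd a ?g u + a ?g)) (at t)"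
          by (simp add: algebra_simps)
        then show ?thesis unfolding dG
          by (simp add: has_real_derivative_iff_has_vector_derivative[symmetric] has_field_derivative_at_within)
      qed
      have "((\<lambda>t. dd (G i j a b) (y, t) (axis i 1, 0)) has_integral 1 * a (\<gamma> i j (y, 1)) - 0 * a (\<gamma> i j (y, 0))) {0..1}"
        by (rule fundamental_theorem_of_calculus[OF _ c\<gamma>]) auto
      then show ?thesis unfolding dH by (simp add: integral_unique \<gamma>_def)
    qed
    ultimately show ?thesis by blast
  qed
  have pr_swap: "pr i j = pr j i" by (simp add: pr_def fun_eq_iff add.commute)
  have "H i j a b = H j i b a"
    by (simp add: H_def G_def \<gamma>_def fun_eq_iff add.commute pr_swap)
  then show ?thesis using main[OF ij a b closed] main[of j i b a] ij a b closed that by metis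
qed

section \<open>Divergence-free fields and local Hamiltonians\<close>

definition grad :: "(real ^ 'm \<Rightarrow> real) \<Rightarrow> real ^ 'm \<Rightarrow> real ^ 'm" where
  "grad f x = (\<chi> j. dd f x (axis j 1))"

lemma grad_inner:
  assumes "f differentiable (at x)"
  shows "grad f x \<bullet> v = dd f x v"
proof -
  have "v = (\<Sum>k\<in>UNIV. v $ k *\<^sub>R axis k 1)"
    by (simp add: vec_eq_iff axis_def if_distrib cong: if_cong)
  then have "dd f x v = dd f x (\<Sum>k\<in>UNIV. v $ k *\<^sub>R axis k 1)" by simp
  also have "\<dots> = (\<Sum>k\<in>UNIV. v $ k * dd f x (axis k 1))"
    by (simp add: linear_sum[OF linear_dd[OF assms]] linear_cmul[OF linear_dd[OF assms]])
  finally show ?thesis by (simp add: grad_def inner_vec_def mult.commute)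
qed

lemma smooth_on_grad: "open S \<Longrightarrow> smooth_on S f \<Longrightarrow> smooth_on S (grad f)"
  by (rule smooth_on_vec) (simp_all add: grad_def smooth_on_dd)

lemma smooth_on_detv:
  assumes "open S" "\<And>k. smooth_on S (V k)"
  shows "smooth_on S (\<lambda>x. detv (\<lambda>k. V k x))"
  unfolding detv_def using assms by (intro smooth_on_det) (auto intro: smooth_on_vec_nth)

lemma dd_grad:
  assumes "open S" "x \<in> S" "smooth_on S f"
  shows "dd (grad f) x v $ l = dd (\<lambda>y. dd f y (axis l 1)) x v"
  using dd_vec_nth[OF smooth_on_imp_differentiable[OF smooth_on_grad[OF assms(1,3)] assms(2)], of l v]
  by (simp add: grad_def)

text \<open>Piola's identity: the cofactors of a Jacobian matrix form divergence-free rows.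
  Differentiating the row \<open>i\<close> pairs the Hessian of \<open>F i\<close>, symmetric in
  \<open>j\<close> and \<open>l\<close>, with a determinant that has the basis vectors
  \<open>j\<close> and \<open>l\<close> in the slots \<open>s\<close> and \<open>i\<close> and is
  therefore skew in them.\<close>

lemma detv_grad_divergence:
  fixes F :: "'m \<Rightarrow> real ^ 'm \<Rightarrow> real"
  assumes S: "open S" "x \<in> S" and F: "\<And>k. k \<noteq> s \<Longrightarrow> smooth_on S (F k)"
  shows "(\<Sum>j\<in>UNIV. dd (\<lambda>x. detv ((\<lambda>k. grad (F k) x)(s := axis j 1))) x (axis j 1)) = 0"
proof -
  define K where "K = (\<lambda>k. grad (F k) x)"
  define Hs where "Hs i j l = dd (\<lambda>y. dd (F i) y (axis l 1)) x (axis j 1)" for i j l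
  have Hs_sym: "Hs i j l = Hs i l j" if "i \<noteq> s" for i j l
    unfolding Hs_def by (rule dd_dd_commute[OF S F[OF that]])
  have 1: "dd (\<lambda>x. detv ((\<lambda>k. grad (F k) x)(s := axis j 1))) x (axis j 1) =
      (\<Sum>i\<in>-{s}. \<Sum>l\<in>UNIV. Hs i j l * detv (K(s := axis j 1, i := axis l 1)))" for j
  proof -
    define V where "V k y = (if k = s then axis j 1 else grad (F k) y)" for k y
    define V' where "V' k h = (if k = s then 0 else dd (grad (F k)) x h)" for k h
    have der: "(V k has_derivative V' k) (at x)" for k
    proof (cases "k = s")
      case True then show ?thesis by (simp add: V_def[abs_def] V'_def[abs_def])
    next
      case False
      have "smooth_on S (grad (F k))" using smooth_on_grad[OF S(1) F[OF False]] .
      from smooth_on_imp_has_derivative[OF this S(2)] show ?thesis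
        using False by (simp add: V_def[abs_def] V'_def[abs_def])
    qed
    have Veq: "(\<lambda>k. V k y) = (\<lambda>k. grad (F k) y)(s := axis j 1)" for y
      by (auto simp: V_def)
    have "dd (\<lambda>x. detv ((\<lambda>k. grad (F k) x)(s := axis j 1))) x (axis j 1) =
       (\<Sum>i\<in>UNIV. detv ((K(s := axis j 1))(i := V' i (axis j 1))))"
      using dd_eqI[OF has_derivative_detv[of V V', OF der]] by (simp add: Veq K_def)
    also have "\<dots> = (\<Sum>i\<in>-{s}. detv ((K(s := axis j 1))(i := V' i (axis j 1))))"
    proof (intro sum.mono_neutral_right ballI)
      fix i assume "i \<in> UNIV - - {s}"
      then have "i = s" by simp
      then show "detv ((K(s := axis j 1))(i := V' i (axis j 1))) = 0"
        using linear_0[OF am_linear[OF am_detv, of K s]] by (simp add: V'_def)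
    qed auto
    also have "\<dots> = (\<Sum>i\<in>-{s}. \<Sum>l\<in>UNIV. Hs i j l * detv (K(s := axis j 1, i := axis l 1)))"
    proof (intro sum.cong refl)
      fix i assume "i \<in> -{s}"
      then have i: "i \<noteq> s" by simp
      have "detv ((K(s := axis j 1))(i := V' i (axis j 1))) =
        (\<Sum>l\<in>UNIV. V' i (axis j 1) $ l * detv ((K(s := axis j 1))(i := axis l 1)))"
        by (rule am_expand[OF am_detv])
      moreover have "V' i (axis j 1) $ l = Hs i j l" for l
        using i dd_grad[OF S F[OF i]] by (simp add: V'_def Hs_def)
      ultimately show "detv ((K(s := axis j 1))(i := V' i (axis j 1))) =
        (\<Sum>l\<in>UNIV. Hs i j l * detv (K(s := axis j 1, i := axis l 1)))"
        by simp
    qed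
    finally show ?thesis .
  qed
  have "(\<Sum>j\<in>UNIV. dd (\<lambda>x. detv ((\<lambda>k. grad (F k) x)(s := axis j 1))) x (axis j 1)) =
     (\<Sum>i\<in>-{s}. \<Sum>j\<in>UNIV. \<Sum>l\<in>UNIV. Hs i j l * detv (K(s := axis j 1, i := axis l 1)))"
    unfolding 1 by (rule sum.swap)
  also have "\<dots> = 0"
  proof (rule sum.neutral, rule ballI)
    fix i assume "i \<in> -{s}"
    then have i: "s \<noteq> i" by simp
    show "(\<Sum>j\<in>UNIV. \<Sum>l\<in>UNIV. Hs i j l * detv (K(s := axis j 1, i := axis l 1))) = 0"
      using Hs_sym i by (intro symmetric_antisymmetric_sum_zero am_swap[OF am_detv i]) auto
  qed
  finally show ?thesis .
qed

context two_slots
begin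

lemma smooth_on_bv_nth:
  assumes S: "open S" and F: "\<And>k. k \<noteq> r0 \<Longrightarrow> k \<noteq> r1 \<Longrightarrow> smooth_on S (F k)"
  shows "smooth_on S (\<lambda>x. bv (\<lambda>k. grad (F k) x) $ i $ j)"
proof -
  have "smooth_on S (\<lambda>x. detv (\<lambda>k. rows2 (\<lambda>k. grad (F k) x) (axis i 1) (axis j 1) k))"
  proof (rule smooth_on_detv[OF S])
    fix k show "smooth_on S (\<lambda>x. rows2 (\<lambda>k. grad (F k) x) (axis i 1) (axis j 1) k)"
      using smooth_on_grad[OF S F] by (cases k rule: slot_cases) (auto simp: smooth_on_const)
  qed
  then show ?thesis by (simp add: bv_def)
qed

text \<open>With \<open>h\<close> placed in the slot \<open>r0\<close>, the components are the
  cofactors of the slot \<open>r1\<close>, and \<open>detv_grad_divergence\<close> applies.\<close>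

lemma divergence_sharp_bv:
  assumes S: "open S" "x \<in> S" and F: "\<And>k. k \<noteq> r0 \<Longrightarrow> k \<noteq> r1 \<Longrightarrow> smooth_on S (F k)"
    and h: "smooth_on S h"
  shows "(\<Sum>j\<in>UNIV. dd (\<lambda>x. sharp (bv (\<lambda>k. grad (F k) x)) (grad h x) $ j) x (axis j 1)) = 0"
proof -
  have "rows2 (\<lambda>k. grad (F k) y) (grad h y) (axis j 1) = (\<lambda>k. grad ((F(r0 := h)) k) y)(r1 := axis j 1)" for j y
    by (auto simp: rows2_def)
  then show ?thesis
    unfolding sharp_bv_nth
    using detv_grad_divergence[OF S, of r1 "F(r0 := h)"] F h by simp
qed

lemma has_derivative_vec_lambda:
  fixes f :: "'n::finite \<Rightarrow> 'a::euclidean_space \<Rightarrow> real"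
  assumes "\<And>k. f k differentiable (at x)"
  shows "((\<lambda>x. \<chi> k. f k x) has_derivative (\<lambda>v. \<chi> k. dd (f k) x v)) (at x)"
proof (subst has_derivative_componentwise_within, intro ballI)
  fix i :: "real ^ 'n" assume "i \<in> Basis"
  then obtain k where "i = axis k 1" by (auto simp: Basis_vec_def)
  then show "((\<lambda>x. (\<chi> k. f k x) \<bullet> i) has_derivative (\<lambda>v. (\<chi> k. dd (f k) x v) \<bullet> i)) (at x)"
    using has_derivative_dd[OF assms[of k]] by (simp add: inner_axis)
qed

text \<open>Near \<open>x0\<close> two of the original coordinates, \<open>x $ a\<close> and
  \<open>x $ b\<close>, together with the \<open>F k\<close> form a chart \<open>\<psi>\<close> that
  straightens the leaves. With \<open>Y c\<close> the image of \<open>axis c 1\<close> under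
  \<open>sharp\<close>, a tangent field satisfies
  \<open>\<rho> X = \<alpha> Y a + \<beta> Y b\<close>, and a Hamiltonian is a function with
  leafwise differential \<open>\<alpha> dx_a + \<beta> dx_b\<close>. Vanishing divergence is exactly
  the closedness of this form along the leaves.\<close>

lemma local_hamiltonian:
  fixes F :: "'m \<Rightarrow> real ^ 'm \<Rightarrow> real"
  assumes S: "open S" "x0 \<in> S"
    and F: "\<And>k. k \<noteq> r0 \<Longrightarrow> k \<noteq> r1 \<Longrightarrow> smooth_on S (F k)"
    and \<rho>: "smooth_on S \<rho>" "\<And>x. x \<in> S \<Longrightarrow> \<rho> x \<noteq> 0"
    and X: "smooth_on S X"
    and tangent: "\<And>x k. x \<in> S \<Longrightarrow> k \<noteq> r0 \<Longrightarrow> k \<noteq> r1 \<Longrightarrow> grad (F k) x \<bullet> X x = 0"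
    and div: "\<And>x. x \<in> S \<Longrightarrow> (\<Sum>j\<in>UNIV. dd (\<lambda>x. \<rho> x * X x $ j) x (axis j 1)) = 0"
    and nz: "bv (\<lambda>k. grad (F k) x0) \<noteq> 0"
  obtains N r \<psi> \<theta> h where "open N" "x0 \<in> N" "N \<subseteq> S" "homeomorphism N (ball (\<psi> x0) r) \<psi> \<theta>"
    "smooth_on N \<psi>" "smooth_on (ball (\<psi> x0) r) \<theta>"
    "\<And>x k. k \<noteq> r0 \<Longrightarrow> k \<noteq> r1 \<Longrightarrow> \<psi> x $ k = F k x"
    "smooth_on N h"
    "\<And>x. x \<in> N \<Longrightarrow> \<rho> x *\<^sub>R X x = sharp (bv (\<lambda>k. grad (F k) x)) (grad h x)"
proof -
  define K where "K x = (\<lambda>k. grad (F k) x)" for x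
  obtain a b where ab: "bv (K x0) $ a $ b \<noteq> 0" using nz by (auto simp: K_def vec_eq_iff)
  \<comment> \<open>This entry, nonzero near \<open>x0\<close>, is the Jacobian determinant of
    \<open>\<psi>\<close> (see \<open>det_D\<close> and \<open>d\<psi>\<close>), so one choice of
    \<open>a\<close> and \<open>b\<close> serves both for the chart and for the
    denominators.\<close>
  define D where "D x = bv (K x) $ a $ b" for x
  have D_smooth: "smooth_on S D" unfolding D_def K_def by (rule smooth_on_bv_nth[OF S(1) F])
  define S' where "S' = S \<inter> D -` (-{0})"
  have S': "open S'" "x0 \<in> S'" "S' \<subseteq> S"
    unfolding S'_def using S ab smooth_on_imp_continuous_on[OF D_smooth]
    by (auto simp: D_def intro!: continuous_open_preimage)
  have Dnz: "D x \<noteq> 0" if "x \<in> S'" for x using that by (auto simp: S'_def)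
  define f where "f k x = (if k = r0 then x $ a else if k = r1 then x $ b else F k x)" for k x
  define \<psi> where "\<psi> x = (\<chi> k. f k x)" for x
  have f_smooth: "smooth_on S (f k)" for k
    using F smooth_on_bounded_linear[OF bounded_linear_vec_nth]
    by (cases k rule: slot_cases) (auto simp: f_def[abs_def] slots_distinct slots_distinct[symmetric])
  have \<psi>_smooth: "smooth_on S \<psi>"
    by (rule smooth_on_vec[OF S(1)]) (simp add: \<psi>_def f_smooth)
  have dcoord: "dd (\<lambda>x. x $ c) x = (\<lambda>v. v $ c)" for c :: 'm and x :: "real ^ 'm"
    by (rule dd_eqI) (rule bounded_linear_imp_has_derivative[OF bounded_linear_vec_nth])
  have grad_coord: "grad (\<lambda>x. x $ c) x = axis c 1" for c :: 'm and x :: "real ^ 'm"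
    by (simp add: grad_def dcoord vec_eq_iff axis_def)
  have d\<psi>: "dd \<psi> x v $ k = rows2 (K x) (axis a 1) (axis b 1) k \<bullet> v" if "x \<in> S" for x v k
  proof -
    have "dd \<psi> x v = (\<chi> k. dd (f k) x v)"
      using dd_eqI[OF has_derivative_vec_lambda[of f, OF smooth_on_imp_differentiable[OF f_smooth that]]]
      by (simp add: \<psi>_def[abs_def])
    moreover have "dd (f k) x v = rows2 (K x) (axis a 1) (axis b 1) k \<bullet> v"
      using grad_inner[OF smooth_on_imp_differentiable[OF F that], of k]
      by (cases k rule: slot_cases)
        (auto simp: f_def[abs_def] dcoord inner_axis' K_def slots_distinct slots_distinct[symmetric])
    ultimately show ?thesis by simp
  qed
  have det_D: "detv (rows2 (K x) (axis a 1) (axis b 1)) = D x" for x by (simp add: D_def bv_def)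
  have "v = 0" if "dd \<psi> x0 v = 0" for v
    using detv_nonzero_orthogonal_zero[of "rows2 (K x0) (axis a 1) (axis b 1)" v] d\<psi>[OF S(2), of v] that
      det_D ab by (auto simp: D_def)
  from smooth_inverse_function[OF S'(1,2) smooth_on_subset[OF \<psi>_smooth S'(3)] this]
  obtain N1 V \<theta> where N1: "open N1" "N1 \<subseteq> S'" "x0 \<in> N1" and V: "open V" "\<psi> x0 \<in> V"
    and hom: "homeomorphism N1 V \<psi> \<theta>" and \<theta>_smooth: "smooth_on V \<theta>"
    and d\<psi>\<theta>: "\<And>y v. y \<in> V \<Longrightarrow> dd \<psi> (\<theta> y) (dd \<theta> y v) = v"
    by metis
  obtain r where r: "r > 0" "ball (\<psi> x0) r \<subseteq> V" using V openE by blast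
  let ?B = "ball (\<psi> x0) r"
  define N where "N = N1 \<inter> \<psi> -` ?B"
  have N: "open N" "x0 \<in> N" "N \<subseteq> S'"
    unfolding N_def using N1 r smooth_on_imp_continuous_on[OF smooth_on_subset[OF \<psi>_smooth, of N1]] S'
    by (auto intro!: continuous_open_preimage)
  have hom': "homeomorphism N ?B \<psi> \<theta>"
  proof (rule homeomorphism_of_subsets[OF hom])
    show "\<psi> ` N = ?B"
    proof (intro equalityI subsetI)
      fix y assume y: "y \<in> ?B"
      then have "\<theta> y \<in> N1" "\<psi> (\<theta> y) = y" using hom r(2) by (auto simp: homeomorphism_def)
      then show "y \<in> \<psi> ` N" using y by (intro image_eqI[of _ _ "\<theta> y"]) (auto simp: N_def)
    qed (auto simp: N_def)
  qed (auto simp: N_def r)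
  have \<theta>N: "\<theta> y \<in> N" "\<psi> (\<theta> y) = y" if "y \<in> ?B" for y
    using hom' that unfolding homeomorphism_def by auto
  have \<psi>N: "\<psi> x \<in> ?B" "\<theta> (\<psi> x) = x" if "x \<in> N" for x
    using hom' that unfolding homeomorphism_def by auto
  have NS: "N \<subseteq> S" using N S' by auto
  define Y where "Y c x = sharp (bv (K x)) (axis c 1)" for c x
  \<comment> \<open>Coefficients from \<open>tangent_eq\<close>, which gives
    \<open>D X = X_b Y a - X_a Y b\<close>, multiplied by \<open>\<rho> / D\<close>.\<close>
  define \<alpha> where "\<alpha> x = \<rho> x * X x $ b / D x" for x
  define \<beta> where "\<beta> x = - (\<rho> x * X x $ a) / D x" for x
  have sm: "smooth_on N \<alpha>" "smooth_on N \<beta>"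
    unfolding \<alpha>_def \<beta>_def using N NS Dnz
    by (auto intro!: smooth_on_divide smooth_on_uminus smooth_on_mult smooth_on_vec_nth
        intro: smooth_on_subset[OF \<rho>(1)] smooth_on_subset[OF X] smooth_on_subset[OF D_smooth])
  have X_eq: "\<rho> x *\<^sub>R X x = \<alpha> x *\<^sub>R Y a x + \<beta> x *\<^sub>R Y b x" if "x \<in> N" for x
  proof -
    have x: "x \<in> S" "D x \<noteq> 0" using that NS N Dnz by auto
    have tangK: "K x k \<bullet> X x = 0" if "k \<noteq> r0" "k \<noteq> r1" for k
      using tangent[OF x(1) that] by (simp add: K_def)
    have "D x *\<^sub>R X x = (X x $ b) *\<^sub>R Y a x - (X x $ a) *\<^sub>R Y b x"
      using tangent_eq[of "K x" "X x" "axis a 1" "axis b 1"] tangK x(2)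
      by (simp add: det_D Y_def inner_axis')
    then have "\<rho> x *\<^sub>R (D x *\<^sub>R X x) = \<rho> x *\<^sub>R ((X x $ b) *\<^sub>R Y a x - (X x $ a) *\<^sub>R Y b x)"
      by (rule arg_cong)
    also have "\<dots> = D x *\<^sub>R (\<alpha> x *\<^sub>R Y a x + \<beta> x *\<^sub>R Y b x)"
      using x by (simp add: \<alpha>_def \<beta>_def algebra_simps)
    finally have "D x *\<^sub>R (\<rho> x *\<^sub>R X x) = D x *\<^sub>R (\<alpha> x *\<^sub>R Y a x + \<beta> x *\<^sub>R Y b x)"
      by (simp add: mult.commute)
    then show ?thesis using x by (metis scaleR_cancel_left)
  qed
  have Y_smooth: "smooth_on N (\<lambda>x. Y c x $ j)" for c j
  proof -
    have "Y c x $ j = bv (K x) $ c $ j" for x unfolding Y_def sharp_bv_nth by (simp add: bv_def)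
    then show ?thesis using smooth_on_bv_nth[OF N(1) smooth_on_subset[OF F NS]] by (simp add: K_def)
  qed
  have Y_div: "(\<Sum>j\<in>UNIV. dd (\<lambda>x. Y c x $ j) x (axis j 1)) = 0" if "x \<in> N" for c x
    using divergence_sharp_bv[OF N(1) that smooth_on_subset[OF F NS] smooth_on_bounded_linear[OF bounded_linear_vec_nth, of N c]]
    by (simp add: grad_coord Y_def K_def)
  \<comment> \<open>By the product rule and \<open>Y_div\<close>, what remains of the divergence of
    \<open>\<rho> X\<close> are the derivatives of the coefficients along \<open>Y a\<close> and
    \<open>Y b\<close>.\<close>
  have transport: "dd \<alpha> x (Y a x) + dd \<beta> x (Y b x) = 0" if x: "x \<in> N" for x
  proof -
    have der: "dd (\<lambda>x. u x * Y c x $ j) x v = u x * dd (\<lambda>x. Y c x $ j) x v + dd u x v * Y c x $ j"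
      if "smooth_on N u" for u c j v
      using dd_eqI[OF has_derivative_mult[OF smooth_on_imp_has_derivative[OF that x] smooth_on_imp_has_derivative[OF Y_smooth x]]]
      by simp
    have diff: "(\<lambda>x. u x * Y c x $ j) differentiable (at x)" if "smooth_on N u" for u c j
      using smooth_on_imp_differentiable[OF smooth_on_mult[OF N(1) that Y_smooth] x] .
    have "dd (\<lambda>x. \<rho> x * X x $ j) x v = dd (\<lambda>x. \<alpha> x * Y a x $ j + \<beta> x * Y b x $ j) x v" for j v
    proof -
      have "\<rho> y * X y $ j = \<alpha> y * Y a y $ j + \<beta> y * Y b y $ j" if "y \<in> N" for y
        using arg_cong[OF X_eq[OF that], of "\<lambda>v. v $ j"] by simp
      from dd_cong_open[of N x "\<lambda>x. \<rho> x * X x $ j" "\<lambda>x. \<alpha> x * Y a x $ j + \<beta> x * Y b x $ j", OF N(1) x this]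
      show ?thesis by (rule fun_cong)
    qed
    also have "dd (\<lambda>x. \<alpha> x * Y a x $ j + \<beta> x * Y b x $ j) x v =
       (\<alpha> x * dd (\<lambda>x. Y a x $ j) x v + dd \<alpha> x v * Y a x $ j) + (\<beta> x * dd (\<lambda>x. Y b x $ j) x v + dd \<beta> x v * Y b x $ j)" for j v
      using dd_eqI[OF has_derivative_add[OF has_derivative_dd[OF diff[OF sm(1)]] has_derivative_dd[OF diff[OF sm(2)]]]]
      by (simp add: der[OF sm(1)] der[OF sm(2)])
    finally have "(\<Sum>j\<in>UNIV. dd (\<lambda>x. \<rho> x * X x $ j) x (axis j 1)) =
       \<alpha> x * (\<Sum>j\<in>UNIV. dd (\<lambda>x. Y a x $ j) x (axis j 1)) + \<beta> x * (\<Sum>j\<in>UNIV. dd (\<lambda>x. Y b x $ j) x (axis j 1))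
       + (grad \<alpha> x \<bullet> Y a x + grad \<beta> x \<bullet> Y b x)"
      by (simp add: sum.distrib sum_distrib_left inner_vec_def grad_def algebra_simps)
    then show ?thesis using div[of x] Y_div[OF x] x NS
      by (simp add: subset_iff grad_inner smooth_on_imp_differentiable[OF sm(1) x] smooth_on_imp_differentiable[OF sm(2) x])
  qed
  \<comment> \<open>The coordinate fields of the slots \<open>r1\<close> and \<open>r0\<close> are
    \<open>Y a / D\<close> and \<open>- Y b / D\<close>. The opposite signs turn
    \<open>transport\<close> into the symmetric condition that \<open>plane_primitive\<close> asks
    for.\<close>
  have frame: "D (\<theta> y) *\<^sub>R dd \<theta> y (axis r1 1) = Y a (\<theta> y)"
      "D (\<theta> y) *\<^sub>R dd \<theta> y (axis r0 1) = - Y b (\<theta> y)" if y: "y \<in> ?B" for y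
  proof -
    have \<theta>y: "\<theta> y \<in> S" "D (\<theta> y) \<noteq> 0" using \<theta>N[OF y] NS N Dnz by auto
    have comp: "rows2 (K (\<theta> y)) (axis a 1) (axis b 1) k \<bullet> dd \<theta> y v = v $ k" for k v
      using d\<psi>[OF \<theta>y(1), of "dd \<theta> y v" k] d\<psi>\<theta>[of y v] y r by auto
    have K: "K (\<theta> y) k \<bullet> dd \<theta> y v = v $ k" if "k \<noteq> r0" "k \<noteq> r1" for k v
      using comp[of k v] that by simp
    have ab': "axis a 1 \<bullet> dd \<theta> y v = v $ r0" "axis b 1 \<bullet> dd \<theta> y v = v $ r1" for v
      using comp[of r0 v] comp[of r1 v] by simp_all
    have ax: "axis c (1::real) $ k = (if k = c then 1 else 0)" for c k :: 'm
      by (simp add: axis_def)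
    show "D (\<theta> y) *\<^sub>R dd \<theta> y (axis r1 1) = Y a (\<theta> y)"
      using tangent_eq[of "K (\<theta> y)" "dd \<theta> y (axis r1 1)" "axis a 1" "axis b 1"] K ab' \<theta>y(2) slots_distinct
      by (simp add: det_D Y_def ax)
    show "D (\<theta> y) *\<^sub>R dd \<theta> y (axis r0 1) = - Y b (\<theta> y)"
      using tangent_eq[of "K (\<theta> y)" "dd \<theta> y (axis r0 1)" "axis a 1" "axis b 1"] K ab' \<theta>y(2) slots_distinct
      by (simp add: det_D Y_def ax)
  qed
  have \<theta>_smooth': "smooth_on ?B \<theta>" using smooth_on_subset[OF \<theta>_smooth r(2)] .
  have chain: "dd (\<lambda>y. u (\<theta> y)) y v = dd u (\<theta> y) (dd \<theta> y v)" if "smooth_on N u" "y \<in> ?B" for u :: "real ^ 'm \<Rightarrow> real" and y v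
    using dd_eqI[OF has_derivative_compose[OF smooth_on_imp_has_derivative[OF \<theta>_smooth' that(2)]
          smooth_on_imp_has_derivative[OF that(1) \<theta>N(1)[OF that(2)]]]] by simp
  have comp_smooth: "smooth_on ?B (\<lambda>y. u (\<theta> y))" if "smooth_on N u" for u :: "real ^ 'm \<Rightarrow> real"
    using \<theta>N by (intro smooth_on_compose[OF open_ball N(1) \<theta>_smooth' that]) auto
  have scale: "D (\<theta> y) * dd u (\<theta> y) (dd \<theta> y v) = dd u (\<theta> y) (D (\<theta> y) *\<^sub>R dd \<theta> y v)"
    if "smooth_on N u" "y \<in> ?B" for u :: "real ^ 'm \<Rightarrow> real" and y v
    using linear_cmul[OF smooth_on_linear_dd[OF that(1) \<theta>N(1)[OF that(2)]]] by simp
  have closed: "dd (\<lambda>y. \<alpha> (\<theta> y)) y (axis r1 1) = dd (\<lambda>y. \<beta> (\<theta> y)) y (axis r0 1)" if y: "y \<in> ?B" for y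
  proof -
    have "D (\<theta> y) * dd (\<lambda>y. \<alpha> (\<theta> y)) y (axis r1 1) = dd \<alpha> (\<theta> y) (Y a (\<theta> y))"
      unfolding chain[OF sm(1) y] scale[OF sm(1) y] frame[OF y] ..
    moreover have "D (\<theta> y) * dd (\<lambda>y. \<beta> (\<theta> y)) y (axis r0 1) = - dd \<beta> (\<theta> y) (Y b (\<theta> y))"
      unfolding chain[OF sm(2) y] scale[OF sm(2) y] frame[OF y]
      using linear_neg[OF smooth_on_linear_dd[OF sm(2) \<theta>N(1)[OF y]]] by simp
    ultimately have "D (\<theta> y) * dd (\<lambda>y. \<alpha> (\<theta> y)) y (axis r1 1) = D (\<theta> y) * dd (\<lambda>y. \<beta> (\<theta> y)) y (axis r0 1)"
      using transport[OF \<theta>N(1)[OF y]] by simp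
    then show ?thesis using Dnz \<theta>N(1)[OF y] N by auto
  qed
  obtain H where H: "smooth_on ?B H" "\<And>y. y \<in> ?B \<Longrightarrow> dd H y (axis r0 1) = \<alpha> (\<theta> y)"
    "\<And>y. y \<in> ?B \<Longrightarrow> dd H y (axis r1 1) = \<beta> (\<theta> y)"
    using plane_primitive[OF slots_distinct comp_smooth[OF sm(1)] comp_smooth[OF sm(2)] closed] by metis
  define h where "h x = H (\<psi> x)" for x
  have h_smooth: "smooth_on N h"
    unfolding h_def using \<psi>N by (intro smooth_on_compose[OF N(1) open_ball smooth_on_subset[OF \<psi>_smooth NS] H(1)]) auto
  have "\<rho> x *\<^sub>R X x = sharp (bv (K x)) (grad h x)" if x: "x \<in> N" for x
  proof -
    let ?y = "\<psi> x"
    have y: "?y \<in> ?B" "\<theta> ?y = x" using \<psi>N[OF x] by auto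
    have Dx: "D x \<noteq> 0" using x N Dnz by auto
    have "dd (\<lambda>y. h (\<theta> y)) ?y = dd H ?y"
      using \<theta>N by (intro dd_cong_open[OF open_ball y(1)]) (auto simp: h_def)
    then have dh: "dd h x (dd \<theta> ?y v) = dd H ?y v" for v
      using chain[OF h_smooth y(1), of v] y(2) by simp
    have dhY: "dd h x (Y a x) = D x * \<beta> x" "dd h x (- Y b x) = D x * \<alpha> x"
      using frame[OF y(1)] scale[OF h_smooth y(1)] dh H(2,3)[OF y(1)] y(2) by metis+
    \<comment> \<open>\<open>Z\<close> is tangent to the leaves, so by \<open>tangent_eq\<close> its
      components \<open>a\<close> and \<open>b\<close> determine it.\<close>
    define Z where "Z = sharp (bv (K x)) (grad h x)"
    have hd: "h differentiable (at x)" using smooth_on_imp_differentiable[OF h_smooth x] .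
    have "axis b 1 \<bullet> Z = D x * \<alpha> x" "axis a 1 \<bullet> Z = - (D x * \<beta> x)"
      using dhY linear_neg[OF linear_dd[OF hd]] sharp_bv_skew[of "K x" "axis b 1" "grad h x"] sharp_bv_skew[of "K x" "axis a 1" "grad h x"]
        grad_inner[OF hd] unfolding Z_def Y_def by (simp_all add: inner_commute)
    moreover have "D x *\<^sub>R Z = (axis b 1 \<bullet> Z) *\<^sub>R Y a x - (axis a 1 \<bullet> Z) *\<^sub>R Y b x"
      using tangent_eq[of "K x" Z "axis a 1" "axis b 1"] row_inner_sharp_bv[of _ "K x"] Dx
      by (simp add: det_D Y_def Z_def)
    ultimately have "D x *\<^sub>R Z = D x *\<^sub>R (\<alpha> x *\<^sub>R Y a x + \<beta> x *\<^sub>R Y b x)"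
      by (simp add: algebra_simps)
    then show ?thesis using Dx X_eq[OF x] by (simp add: Z_def)
  qed
  moreover have "\<psi> x $ k = F k x" if "k \<noteq> r0" "k \<noteq> r1" for x k
    using that by (simp add: \<psi>_def f_def)
  ultimately show ?thesis
    using that[OF N(1,2) NS hom' smooth_on_subset[OF \<psi>_smooth NS] \<theta>_smooth' _ h_smooth] by (simp add: K_def)
qed

end

section \<open>Continuation of local potentials\<close>

text \<open>
  The primitive sums the cocycle along a fine subdivision of the segment from a base point.
\<close>

lemma local_cocycle_primitive:
  fixes D :: "'a::real_normed_vector \<Rightarrow> 'a \<Rightarrow> real"
  assumes S: "convex S" "bounded S" and \<delta>: "\<delta> > 0"
    and cocycle: "\<And>x y z. x \<in> S \<Longrightarrow> y \<in> S \<Longrightarrow> z \<in> S \<Longrightarrow> dist x y < \<delta> \<Longrightarrow> dist y z < \<delta> \<Longrightarrow>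
      dist x z < \<delta> \<Longrightarrow> D x y + D y z = D x z"
  obtains G \<epsilon> where "\<epsilon> > 0" "\<And>x y. x \<in> S \<Longrightarrow> y \<in> S \<Longrightarrow> dist x y < \<epsilon> \<Longrightarrow> G y - G x = D x y"
proof (cases "S = {}")
  case True
  then show ?thesis using that[of 1] by simp
next
  case False
  then obtain x0 where x0: "x0 \<in> S" by blast
  obtain R where R: "\<And>x. x \<in> S \<Longrightarrow> dist x0 x \<le> R"
    using S(2) bounded_any_center[of S x0] by blast
  \<comment> \<open>Large enough that a segment from \<open>x0\<close> to any point of
    \<open>S\<close>, cut into \<open>N\<close> pieces, has steps below
    \<open>\<delta> / 2\<close>.\<close>
  obtain N :: nat where N: "N > (\<bar>R\<bar> + 1) / (\<delta> / 2)" using reals_Archimedean2 by blast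
  have "(\<bar>R\<bar> + 1) / (\<delta> / 2) > 0" using \<delta> by (intro divide_pos_pos) auto
  then have N0: "real N > 0" using N by linarith
  have NR: "\<bar>R\<bar> / N < \<delta> / 2"
  proof -
    have "\<bar>R\<bar> + 1 < N * (\<delta> / 2)" using N \<delta> by (simp add: field_simps)
    then show ?thesis using N0 by (simp add: field_simps)
  qed
  define pt where "pt x k = x0 + (real k / N) *\<^sub>R (x - x0)" for x k
  define G where "G x = (\<Sum>k<N. D (pt x k) (pt x (Suc k)))" for x
  have pt_S: "pt x k \<in> S" if "x \<in> S" "k \<le> N" for x k
  proof -
    have "pt x k = (1 - real k / N) *\<^sub>R x0 + (real k / N) *\<^sub>R x" by (simp add: pt_def algebra_simps)
    then show ?thesis using convexD_alt[OF S(1) x0 that(1), of "real k / N"] that N0 by simp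
  qed
  have step: "dist (pt x k) (pt x (Suc k)) < \<delta> / 2" if "x \<in> S" for x k
  proof -
    have "pt x k - pt x (Suc k) = (- 1 / N) *\<^sub>R (x - x0)"
      by (simp add: pt_def add_divide_distrib algebra_simps flip: scaleR_diff_left)
    then have "dist (pt x k) (pt x (Suc k)) = dist x0 x / N"
      by (simp add: dist_norm norm_minus_commute)
    also have "\<dots> \<le> \<bar>R\<bar> / N" using R[OF that] N0 by (intro divide_right_mono) auto
    finally show ?thesis using NR by linarith
  qed
  have side: "dist (pt x k) (pt y k) < \<delta> / 2" if "dist x y < \<delta> / 2" "k \<le> N" for x y k
  proof -
    have "pt x k - pt y k = (real k / N) *\<^sub>R (x - y)" by (simp add: pt_def algebra_simps)
    then have "dist (pt x k) (pt y k) = (real k / N) * dist x y" by (simp add: dist_norm)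
    also have "\<dots> \<le> 1 * dist x y" using that N0 by (intro mult_right_mono) auto
    finally show ?thesis using that by simp
  qed
  have "G y - G x = D x y" if xy: "x \<in> S" "y \<in> S" "dist x y < \<delta> / 2" for x y
  proof -
    \<comment> \<open>Rungs between the two subdivided segments. The sides of each quadrilateral are
      shorter than \<open>\<delta> / 2\<close>, hence its diagonal is shorter than
      \<open>\<delta>\<close>, so the cocycle condition holds on both triangles and the sum
      telescopes.\<close>
    define e where "e k = D (pt x k) (pt y k)" for k
    have "D (pt y k) (pt y (Suc k)) - D (pt x k) (pt x (Suc k)) = e (Suc k) - e k" if k: "k < N" for k
    proof -
      let ?a = "pt x k" and ?b = "pt x (Suc k)" and ?c = "pt y k" and ?d = "pt y (Suc k)"
      have S': "?a \<in> S" "?b \<in> S" "?c \<in> S" "?d \<in> S" using k pt_S xy by auto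
      have d: "dist ?a ?b < \<delta> / 2" "dist ?c ?d < \<delta> / 2" "dist ?a ?c < \<delta> / 2" "dist ?b ?d < \<delta> / 2"
        using step side xy k by auto
      then have "dist ?a ?d < \<delta>" using dist_triangle[of ?a ?d ?b] by simp
      then have "D ?a ?b + D ?b ?d = D ?a ?d" "D ?a ?c + D ?c ?d = D ?a ?d"
        using d S' \<delta> by (auto intro!: cocycle)
      then show ?thesis by (simp add: e_def)
    qed
    then have "G y - G x = (\<Sum>k<N. e (Suc k) - e k)"
      by (simp add: G_def sum_subtractf[symmetric])
    also have "\<dots> = e N - e 0" by (rule sum_lessThan_telescope)
    also have "e N = D x y" using N0 by (simp add: e_def pt_def)
    also have "e 0 = 0" using cocycle[of x0 x0 x0] x0 \<delta> by (simp add: e_def pt_def)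
    finally show ?thesis by simp
  qed
  then show ?thesis using that[of "\<delta> / 2" G] \<delta> by simp
qed

text \<open>Members of \<open>\<F>\<close> differ by locally constant functions on overlaps: this is
  a closed one-form given by local primitives, in terms that make sense on a topological space. Only
  its periods may prevent a global primitive.\<close>

locale local_potentials =
  fixes L :: "'a::topological_space set" and \<F> :: "('a set \<times> ('a \<Rightarrow> real)) set"
  assumes open_piece: "(W, f) \<in> \<F> \<Longrightarrow> openin (top_of_set L) W"
    and cover: "p \<in> L \<Longrightarrow> \<exists>W f. (W, f) \<in> \<F> \<and> p \<in> W"
    and compatible: "(W, f) \<in> \<F> \<Longrightarrow> (W', f') \<in> \<F> \<Longrightarrow> p \<in> W \<Longrightarrow> p \<in> W' \<Longrightarrow>
      \<exists>N. openin (top_of_set L) N \<and> p \<in> N \<and> (\<forall>q\<in>N \<inter> W \<inter> W'. f q - f' q = f p - f' p)"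
begin

text \<open>The pull-back along \<open>H\<close> of the many-valued potential. Testing only segments
  that \<open>H\<close> maps into a single piece still fixes \<open>G\<close> up to a constant when
  \<open>S\<close> is convex and \<open>H\<close> is a continuous map into \<open>L\<close>.\<close>

definition lifts :: "'b::euclidean_space set \<Rightarrow> ('b \<Rightarrow> 'a) \<Rightarrow> ('b \<Rightarrow> real) \<Rightarrow> bool" where
  "lifts S H G \<longleftrightarrow> (\<forall>(W, f)\<in>\<F>. \<forall>x\<in>S. \<forall>y\<in>S. H ` closed_segment x y \<subseteq> W \<longrightarrow> G y - G x = f (H y) - f (H x))"

lemma liftsD:
  "lifts S H G \<Longrightarrow> (W, f) \<in> \<F> \<Longrightarrow> x \<in> S \<Longrightarrow> y \<in> S \<Longrightarrow> H ` closed_segment x y \<subseteq> W \<Longrightarrow>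
    G y - G x = f (H y) - f (H x)"
  unfolding lifts_def by fast

lemma eventually_in_openin:
  assumes "continuous_on S H" "H ` S \<subseteq> L" "openin (top_of_set L) N" "z \<in> S" "H z \<in> N"
  shows "\<exists>A. open A \<and> z \<in> A \<and> (\<forall>w\<in>S \<inter> A. H w \<in> N)"
proof -
  obtain T where T: "open T" "N = L \<inter> T" using assms(3) by (auto simp: openin_open)
  obtain A where "open A" "z \<in> A" "\<forall>y\<in>S. y \<in> A \<longrightarrow> H y \<in> T"
    using assms T unfolding continuous_on_topological by (metis IntD2)
  then show ?thesis using T assms(2) by (intro exI[of _ A]) auto
qed

text \<open>The overlap of two pieces may be disconnected, so \<open>compatible\<close> alone does
  not fix the difference of their functions; along a segment mapped into both it is locally constant
  on a connected set.\<close>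

lemma compatible_segment:
  fixes S :: "'b::euclidean_space set"
  assumes H: "continuous_on S H" "H ` S \<subseteq> L" and seg: "closed_segment x y \<subseteq> S"
    and W: "(W, f) \<in> \<F>" "H ` closed_segment x y \<subseteq> W"
    and W': "(W', f') \<in> \<F>" "H ` closed_segment x y \<subseteq> W'"
  shows "f (H y) - f (H x) = f' (H y) - f' (H x)"
proof -
  let ?u = "\<lambda>z. f (H z) - f' (H z)"
  have "\<forall>z\<in>closed_segment x y. eventually (\<lambda>w. ?u z = ?u w) (at z within closed_segment x y)"
  proof
    fix z assume z: "z \<in> closed_segment x y"
    then have Hz: "H z \<in> W" "H z \<in> W'" using W W' by auto
    obtain N where N: "openin (top_of_set L) N" "H z \<in> N"
      "\<forall>q\<in>N \<inter> W \<inter> W'. f q - f' q = f (H z) - f' (H z)"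
      using compatible[OF W(1) W'(1) Hz] by blast
    have "z \<in> S" using z seg by blast
    from eventually_in_openin[OF H N(1) this N(2)]
    obtain A where "open A" "z \<in> A" "\<forall>w\<in>S \<inter> A. H w \<in> N" by blast
    then show "eventually (\<lambda>w. ?u z = ?u w) (at z within closed_segment x y)"
      unfolding eventually_at_topological using N(3) W(2) W'(2) seg
      by (intro exI[of _ A]) (auto simp: image_subset_iff subset_iff)
  qed
  then have "?u x = ?u y"
    by (intro connected_local_const[of "closed_segment x y" x y ?u] connected_segment) auto
  then show ?thesis by simp
qed

text \<open>A Lebesgue number \<open>e\<close> of the cover by preimages of pieces makes the
  increments \<open>D x y\<close> a cocycle for points closer than \<open>e\<close>, which
  \<open>local_cocycle_primitive\<close> integrates.\<close>

lemma lift_exists: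
  fixes S :: "'b::euclidean_space set"
  assumes S: "convex S" "compact S" and H: "continuous_on S H" "H ` S \<subseteq> L"
  shows "\<exists>G. lifts S H G"
proof -
  let ?C = "{B. open B \<and> (\<exists>W f. (W, f) \<in> \<F> \<and> H ` (S \<inter> B) \<subseteq> W)}"
  have cov: "S \<subseteq> \<Union>?C"
  proof
    fix z assume z: "z \<in> S"
    then obtain W f where W: "(W, f) \<in> \<F>" "H z \<in> W" using cover H by blast
    obtain A where "open A" "z \<in> A" "\<forall>w\<in>S \<inter> A. H w \<in> W"
      using eventually_in_openin[OF H open_piece[OF W(1)] z W(2)] by blast
    then show "z \<in> \<Union>?C" using W(1) by blast
  qed
  obtain e where e: "e > 0" "\<And>x. x \<in> S \<Longrightarrow> \<exists>B\<in>?C. ball x e \<subseteq> B"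
    by (rule Heine_Borel_lemma[OF S(2) cov]) blast+
  have "\<forall>x\<in>S. \<exists>W f. (W, f) \<in> \<F> \<and> H ` (S \<inter> ball x e) \<subseteq> W"
  proof
    fix x assume "x \<in> S"
    from e(2)[OF this] obtain B where B: "B \<in> ?C" "ball x e \<subseteq> B" by (rule bexE)
    from B(1) obtain W f where "(W, f) \<in> \<F>" "H ` (S \<inter> B) \<subseteq> W" by (elim CollectE conjE exE)
    moreover note B(2)
    moreover from this have "H ` (S \<inter> ball x e) \<subseteq> H ` (S \<inter> B)" by (intro image_mono) auto
    ultimately show "\<exists>W f. (W, f) \<in> \<F> \<and> H ` (S \<inter> ball x e) \<subseteq> W" by blast
  qed
  then obtain W f where Wf: "\<And>x. x \<in> S \<Longrightarrow> (W x, f x) \<in> \<F>" "\<And>x. x \<in> S \<Longrightarrow> H ` (S \<inter> ball x e) \<subseteq> W x"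
    by metis
  define D where "D x y = f x (H y) - f x (H x)" for x y
  have seg: "closed_segment y z \<subseteq> S \<inter> ball x e" if "y \<in> S" "z \<in> S" "dist x y < e" "dist x z < e" for x y z
    using that S(1) by (intro closed_segment_subset) (auto intro: convex_Int)
  have coc: "D x y + D y z = D x z"
    if "x \<in> S" "y \<in> S" "z \<in> S" "dist x y < e" "dist y z < e" "dist x z < e" for x y z
  proof -
    have s: "closed_segment y z \<subseteq> S \<inter> ball x e" "closed_segment y z \<subseteq> S \<inter> ball y e"
      using seg[OF that(2,3,4,6)] seg[OF that(2,3) _ that(5)] e(1) by simp_all
    have "f x (H z) - f x (H y) = f y (H z) - f y (H y)"
      by (rule compatible_segment[OF H order_trans[OF s(1) Int_lower1]
            Wf(1)[OF that(1)] order_trans[OF image_mono[OF s(1)] Wf(2)[OF that(1)]]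
            Wf(1)[OF that(2)] order_trans[OF image_mono[OF s(2)] Wf(2)[OF that(2)]]])
    then show ?thesis by (simp add: D_def)
  qed
  have "\<exists>G \<epsilon>. \<epsilon> > 0 \<and> (\<forall>x\<in>S. \<forall>y\<in>S. dist x y < \<epsilon> \<longrightarrow> G y - G x = D x y)"
    by (rule local_cocycle_primitive[of S e D, OF S(1) compact_imp_bounded[OF S(2)] e(1)])
      (erule (5) coc, blast)
  then obtain G \<epsilon> where G: "\<epsilon> > 0" "\<And>x y. x \<in> S \<Longrightarrow> y \<in> S \<Longrightarrow> dist x y < \<epsilon> \<Longrightarrow> G y - G x = D x y"
    by blast
  \<comment> \<open>The primitive is tied to the pieces for nearby points only; on a long segment
    mapped into one piece its difference from the function of that piece is locally
    constant.\<close>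
  have "G y - G x = f0 (H y) - f0 (H x)"
    if W0: "(W0, f0) \<in> \<F>" and xy: "x \<in> S" "y \<in> S" and im: "H ` closed_segment x y \<subseteq> W0" for W0 f0 x y
  proof -
    let ?u = "\<lambda>z. G z - f0 (H z)"
    have sub: "closed_segment x y \<subseteq> S" using xy S(1) closed_segment_subset by blast
    have "\<forall>z\<in>closed_segment x y. eventually (\<lambda>w. ?u z = ?u w) (at z within closed_segment x y)"
    proof
      fix z assume z: "z \<in> closed_segment x y"
      show "eventually (\<lambda>w. ?u z = ?u w) (at z within closed_segment x y)"
        unfolding eventually_at_topological
      proof (intro exI[of _ "ball z (min e \<epsilon>)"] conjI ballI impI)
        fix w assume w: "w \<in> ball z (min e \<epsilon>)" "w \<in> closed_segment x y"
        have zS: "z \<in> S" "w \<in> S" using z w sub by auto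
        have zw: "closed_segment z w \<subseteq> closed_segment x y" using z w by (simp add: subset_closed_segment)
        have zw_ball: "closed_segment z w \<subseteq> S \<inter> ball z e" using zS w e by (intro seg) auto
        have "f z (H w) - f z (H z) = f0 (H w) - f0 (H z)"
          by (rule compatible_segment[OF H order_trans[OF zw_ball Int_lower1]
                Wf(1)[OF zS(1)] order_trans[OF image_mono[OF zw_ball] Wf(2)[OF zS(1)]]
                W0 order_trans[OF image_mono[OF zw] im]])
        moreover have "G w - G z = f z (H w) - f z (H z)"
          using G(2)[OF zS] w by (simp add: D_def)
        ultimately show "?u z = ?u w" by simp
      qed (use G e in auto)
    qed
    then have "?u x = ?u y"
      by (intro connected_local_const[of "closed_segment x y" x y ?u] connected_segment) auto
    then show ?thesis by simp
  qed
  then have "lifts S H G" by (auto simp: lifts_def)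
  then show ?thesis by blast
qed

lemma lift_unique:
  fixes S :: "'b::euclidean_space set"
  assumes S: "convex S" and H: "continuous_on S H" "H ` S \<subseteq> L"
    and G: "lifts S H G" "lifts S H G'" and xy: "x \<in> S" "y \<in> S"
  shows "G y - G x = G' y - G' x"
proof -
  let ?u = "\<lambda>z. G z - G' z"
  have "\<forall>z\<in>S. eventually (\<lambda>w. ?u z = ?u w) (at z within S)"
  proof
    fix z assume z: "z \<in> S"
    then obtain W f where W: "(W, f) \<in> \<F>" "H z \<in> W" using cover H by blast
    obtain A where A: "open A" "z \<in> A" "\<forall>w\<in>S \<inter> A. H w \<in> W"
      using eventually_in_openin[OF H open_piece[OF W(1)] z W(2)] by blast
    obtain e where e: "e > 0" "ball z e \<subseteq> A" using A openE by blast
    show "eventually (\<lambda>w. ?u z = ?u w) (at z within S)"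
      unfolding eventually_at_topological
    proof (intro exI[of _ "ball z e"] conjI ballI impI)
      fix w assume w: "w \<in> ball z e" "w \<in> S"
      have "closed_segment z w \<subseteq> S \<inter> ball z e"
        using w z S e by (intro closed_segment_subset) (auto intro: convex_Int)
      then have "H ` closed_segment z w \<subseteq> W" using A e by auto
      then show "?u z = ?u w" using liftsD[OF G(1) W(1) z w(2)] liftsD[OF G(2) W(1) z w(2)] by simp
    qed (use e in auto)
  qed
  then have "?u x = ?u y"
    using convex_connected[OF S] xy by (intro connected_local_const[of S x y ?u]) auto
  then show ?thesis by simp
qed

text \<open>Affine maps take segments to segments. This covers the halves of a joined path, a
  reversed path and the sides of a square.\<close>

lemma lifts_affine:
  assumes G: "lifts S H G" and A: "A ` T \<subseteq> S"
    and affine: "\<And>x y u. A ((1 - u) *\<^sub>R x + u *\<^sub>R y) = (1 - u) *\<^sub>R A x + u *\<^sub>R A y"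
    and T: "convex T" and H': "\<And>x. x \<in> T \<Longrightarrow> H' x = H (A x)"
  shows "lifts T H' (\<lambda>x. G (A x))"
  unfolding lifts_def
proof clarify
  fix W f x y assume W: "(W, f) \<in> \<F>" and xy: "x \<in> T" "y \<in> T" and im: "H' ` closed_segment x y \<subseteq> W"
  have "H ` closed_segment (A x) (A y) \<subseteq> W"
  proof clarify
    fix z assume "z \<in> closed_segment (A x) (A y)"
    then obtain u where u: "0 \<le> u" "u \<le> 1" "z = A ((1 - u) *\<^sub>R x + u *\<^sub>R y)"
      by (auto simp: in_segment affine)
    then have *: "(1 - u) *\<^sub>R x + u *\<^sub>R y \<in> closed_segment x y" by (auto simp: in_segment)
    moreover have "closed_segment x y \<subseteq> T" using xy T closed_segment_subset by blast
    ultimately have "H z = H' ((1 - u) *\<^sub>R x + u *\<^sub>R y)" using H' u by auto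
    then show "H z \<in> W" using im * by auto
  qed
  from liftsD[OF G W _ _ this] A xy show "G (A y) - G (A x) = f (H' y) - f (H' x)"
    by (auto simp: H')
qed

text \<open>For a path in \<open>L\<close> the number does not depend on the chosen lift, by
  \<open>lift_unique\<close>.\<close>

definition increment :: "(real \<Rightarrow> 'a) \<Rightarrow> real" where
  "increment \<gamma> = (let G = SOME G. lifts {0..1} \<gamma> G in G 1 - G 0)"

lemma increment_eq:
  assumes "path \<gamma>" "path_image \<gamma> \<subseteq> L" "lifts {0..1} \<gamma> G"
  shows "increment \<gamma> = G 1 - G 0"
proof -
  have "lifts {0..1} \<gamma> (SOME G. lifts {0..1} \<gamma> G)" using assms(3) by (rule someI[where P = "lifts {0..1} \<gamma>"])
  from lift_unique[OF _ _ _ this assms(3), of 0 1] assms show ?thesis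
    by (simp add: increment_def Let_def path_def path_image_def)
qed

lemma path_lift:
  assumes "path \<gamma>" "path_image \<gamma> \<subseteq> L"
  obtains G where "lifts {0..1} \<gamma> G" "increment \<gamma> = G 1 - G 0"
  using lift_exists[of "{0..1}" \<gamma>] assms increment_eq by (auto simp: path_def path_image_def)

lemma increment_local:
  assumes "path \<gamma>" "path_image \<gamma> \<subseteq> W" "(W, f) \<in> \<F>"
  shows "increment \<gamma> = f (pathfinish \<gamma>) - f (pathstart \<gamma>)"
proof -
  have "path_image \<gamma> \<subseteq> L" using assms open_piece openin_imp_subset by blast
  then obtain G where G: "lifts {0..1} \<gamma> G" "increment \<gamma> = G 1 - G 0" using path_lift assms by blast
  then show ?thesis
    using liftsD[OF G(1) assms(3), of 0 1] assms(2)
    by (simp add: path_image_def pathstart_def pathfinish_def closed_segment_eq_real_ivl)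
qed

lemma increment_join:
  assumes "path p" "path_image p \<subseteq> L" "path q" "path_image q \<subseteq> L" "pathfinish p = pathstart q"
  shows "increment (p +++ q) = increment p + increment q"
proof -
  have "path (p +++ q)" "path_image (p +++ q) \<subseteq> L"
    using assms by (auto simp: path_image_join)
  then obtain G where G: "lifts {0..1} (p +++ q) G" "increment (p +++ q) = G 1 - G 0"
    using path_lift by blast
  have "lifts {0..1} p (\<lambda>t. G (t / 2))"
    by (rule lifts_affine[OF G(1)]) (auto simp: joinpaths_def field_simps)
  moreover have "lifts {0..1} q (\<lambda>t. G ((t + 1) / 2))"
    using assms(5) by (intro lifts_affine[OF G(1)])
      (auto simp: joinpaths_def pathstart_def pathfinish_def field_simps)
  ultimately show ?thesis using assms increment_eq[of p] increment_eq[of q] G(2) by simp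
qed

lemma increment_reversepath:
  assumes "path p" "path_image p \<subseteq> L"
  shows "increment (reversepath p) = - increment p"
proof -
  obtain G where G: "lifts {0..1} p G" "increment p = G 1 - G 0"
    using path_lift assms by blast
  have "lifts {0..1} (reversepath p) (\<lambda>t. G (1 - t))"
    by (rule lifts_affine[OF G(1)]) (auto simp: reversepath_def field_simps)
  then show ?thesis using assms increment_eq[of "reversepath p"] G(2) by simp
qed

text \<open>Lift the homotopy over the square. Its sides \<open>h (t, 0)\<close> and
  \<open>h (t, 1)\<close> are the same path because all intermediate curves are loops, so
  \<open>G\<close> grows equally along them, and hence also along \<open>p\<close> and
  \<open>q\<close>.\<close>

lemma increment_homotopic_loops:
  assumes "homotopic_loops L p q"
  shows "increment p = increment q"
proof -
  obtain h :: "real \<times> real \<Rightarrow> 'a" where h: "continuous_on ({0..1} \<times> {0..1}) h" "h ` ({0..1} \<times> {0..1}) \<subseteq> L"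
    "\<And>x. x \<in> {0..1} \<Longrightarrow> h (0, x) = p x" "\<And>x. x \<in> {0..1} \<Longrightarrow> h (1, x) = q x"
    "\<And>t. t \<in> {0..1} \<Longrightarrow> h (t, 1) = h (t, 0)"
    using assms unfolding homotopic_loops by (auto simp: pathstart_def pathfinish_def image_subset_iff_funcset)
  obtain G where G: "lifts ({0..1} \<times> {0..1}) h G"
    using lift_exists[OF _ _ h(1,2)] by (auto intro: convex_Times compact_Times)
  have pq: "path p" "path_image p \<subseteq> L" "path q" "path_image q \<subseteq> L"
    using assms homotopic_loops_imp_path homotopic_loops_imp_subset by blast+
  have "lifts {0..1} p (\<lambda>t. G (0, t))" "lifts {0..1} q (\<lambda>t. G (1, t))"
    using h by (auto intro!: lifts_affine[OF G, of "\<lambda>t. (_, t)"] simp: algebra_simps)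
  then have inc: "increment p = G (0, 1) - G (0, 0)" "increment q = G (1, 1) - G (1, 0)"
    using pq increment_eq by auto
  have bottom: "lifts {0..1} (\<lambda>t. h (t, 0)) (\<lambda>t. G (t, 0))"
    by (auto intro!: lifts_affine[OF G, of "\<lambda>t. (t, _)"] simp: algebra_simps)
  have top: "lifts {0..1} (\<lambda>t. h (t, 0)) (\<lambda>t. G (t, 1))"
    using h(5) by (auto intro!: lifts_affine[OF G, of "\<lambda>t. (t, _)"] simp: algebra_simps)
  have "continuous_on {0..1} (\<lambda>t. h (t, 0))"
    by (rule continuous_on_compose2[OF h(1)]) (auto intro!: continuous_intros)
  moreover have "(\<lambda>t. h (t, 0)) ` {0..1} \<subseteq> L" using h(2) by auto
  ultimately have "G (1, 0) - G (0, 0) = G (1, 1) - G (0, 1)"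
    using lift_unique[OF _ _ _ bottom top, of 0 1] by simp
  then show ?thesis using inc by simp
qed

lemma increment_loop:
  assumes "simply_connected L" "path p" "path_image p \<subseteq> L" "pathfinish p = pathstart p"
  shows "increment p = 0"
proof -
  let ?c = "\<lambda>_. pathstart p"
  have c: "path ?c" "path_image ?c \<subseteq> L" "pathfinish ?c = pathstart ?c" "pathstart p \<in> L"
    using assms by (auto simp: path_def path_image_def pathfinish_def pathstart_def)
  then have "homotopic_loops L p ?c" using assms by (auto simp: simply_connected_def)
  then have "increment p = increment ?c" by (rule increment_homotopic_loops)
  moreover obtain W f where "(W, f) \<in> \<F>" "pathstart p \<in> W" using cover c(4) by blast
  then have "increment ?c = 0" using increment_local[OF c(1), of W f]
    by (auto simp: path_image_def pathfinish_def pathstart_def)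
  ultimately show ?thesis by simp
qed

text \<open>The value at \<open>q\<close> is the increment along a chosen path from a base point.
  Within a piece, two such paths and a path in the piece joining their ends form a loop, whose
  increment vanishes by simple connectedness.\<close>

theorem global_potential:
  assumes "simply_connected L" and pc: "\<And>W f. (W, f) \<in> \<F> \<Longrightarrow> path_connected W"
  obtains g where "\<And>W f p q. (W, f) \<in> \<F> \<Longrightarrow> p \<in> W \<Longrightarrow> q \<in> W \<Longrightarrow> g q - g p = f q - f p"
proof (cases "L = {}")
  case True
  then have "W = {}" if "(W, f) \<in> \<F>" for W f using open_piece[OF that] by simp
  then show ?thesis using that by blast
next
  case False
  then obtain p0 where p0: "p0 \<in> L" by blast
  have "\<exists>\<gamma>. path \<gamma> \<and> path_image \<gamma> \<subseteq> L \<and> pathstart \<gamma> = p0 \<and> pathfinish \<gamma> = q" if "q \<in> L" for q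
  proof -
    \<comment> \<open>\<open>simply_connected\<close> makes any two loops in \<open>L\<close>
      homotopic; for constant loops a side of the homotopy is a path from \<open>p0\<close> to
      \<open>q\<close>.\<close>
    have "homotopic_loops L (\<lambda>_. p0) (\<lambda>_. q)"
      using assms(1)[unfolded simply_connected_def, rule_format, of "\<lambda>_. p0" "\<lambda>_. q"] p0 that
      by (simp add: path_def path_image_def pathfinish_def pathstart_def)
    then obtain h :: "real \<times> real \<Rightarrow> 'a" where h: "continuous_on ({0..1} \<times> {0..1}) h" "h ` ({0..1} \<times> {0..1}) \<subseteq> L"
      "\<And>x. x \<in> {0..1} \<Longrightarrow> h (0, x) = p0" "\<And>x. x \<in> {0..1} \<Longrightarrow> h (1, x) = q"
      unfolding homotopic_loops by (auto simp: image_subset_iff_funcset)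
    have "continuous_on {0..1} (\<lambda>t. h (t, 0))"
      by (rule continuous_on_compose2[OF h(1)]) (auto intro!: continuous_intros)
    then show ?thesis using h
      by (intro exI[of _ "\<lambda>t. h (t, 0)"]) (auto simp: path_def path_image_def pathfinish_def pathstart_def)
  qed
  then obtain \<gamma> where \<gamma>: "path (\<gamma> q)" "path_image (\<gamma> q) \<subseteq> L" "pathstart (\<gamma> q) = p0" "pathfinish (\<gamma> q) = q"
    if "q \<in> L" for q by metis
  have potential: "increment (\<gamma> q) - increment (\<gamma> p) = f q - f p" if W: "(W, f) \<in> \<F>" and pq: "p \<in> W" "q \<in> W" for W f p q
  proof -
    have WL: "W \<subseteq> L" using open_piece[OF W] openin_imp_subset by blast
    then have L: "p \<in> L" "q \<in> L" using pq by auto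
    obtain \<sigma> where \<sigma>: "path \<sigma>" "path_image \<sigma> \<subseteq> W" "pathstart \<sigma> = p" "pathfinish \<sigma> = q"
      using pc[OF W] pq unfolding path_connected_def by blast
    have \<sigma>L: "path_image \<sigma> \<subseteq> L" using \<sigma> WL by auto
    let ?l = "\<gamma> p +++ (\<sigma> +++ reversepath (\<gamma> q))"
    have inner: "path (\<sigma> +++ reversepath (\<gamma> q))" "path_image (\<sigma> +++ reversepath (\<gamma> q)) \<subseteq> L"
      "pathstart (\<sigma> +++ reversepath (\<gamma> q)) = p"
      using \<sigma> \<sigma>L \<gamma>[OF L(2)] by (auto simp: path_image_join)
    have "increment ?l = 0"
      using inner \<gamma>[OF L(1)] \<gamma>[OF L(2)]
      by (intro increment_loop assms) (auto simp: path_image_join)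
    moreover have "increment ?l = increment (\<gamma> p) + increment (\<sigma> +++ reversepath (\<gamma> q))"
      using inner \<gamma>[OF L(1)] by (intro increment_join) auto
    moreover have "increment (\<sigma> +++ reversepath (\<gamma> q)) = increment \<sigma> + increment (reversepath (\<gamma> q))"
      using \<sigma> \<sigma>L \<gamma>[OF L(2)] by (intro increment_join) auto
    ultimately show ?thesis
      using increment_local[OF \<sigma>(1,2) W] increment_reversepath[OF \<gamma>(1,2)[OF L(2)]] \<sigma> by simp
  qed
  show ?thesis by (rule that[of "\<lambda>q. increment (\<gamma> q)"]) (rule potential)
qed

end

section \<open>Smooth partitions of unity\<close>

text \<open>The polynomial factor makes the class closed under differentiation: with
  \<open>t = 1 / s\<close>, the derivative of \<open>p(t) exp(-t)\<close> in \<open>s\<close> has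
  the polynomial \<open>t^2 (p - p')\<close>.\<close>

definition flat :: "real poly \<Rightarrow> real \<Rightarrow> real" where
  "flat p s = (if s > 0 then poly p (1 / s) * exp (- (1 / s)) else 0)"

lemma flat_tendsto_0: "(flat p \<longlongrightarrow> 0) (at 0)"
proof (rule filterlim_split_at)
  show "(flat p \<longlongrightarrow> 0) (at_left 0)"
  proof (rule Lim_transform_eventually[OF tendsto_const])
    show "eventually (\<lambda>s. 0 = flat p s) (at_left 0)"
      unfolding eventually_at_filter by (simp add: flat_def)
  qed
  have "((\<lambda>x. poly p x * exp (- x)) \<longlongrightarrow> 0) at_top"
  proof -
    have "((\<lambda>x. \<Sum>i\<le>degree p. coeff p i * (x ^ i / exp x)) \<longlongrightarrow> 0) at_top"
      by (intro tendsto_null_sum tendsto_mult_right_zero tendsto_power_div_exp_0)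
    then show ?thesis by (simp add: poly_altdef exp_minus divide_inverse sum_distrib_right mult.assoc)
  qed
  from filterlim_compose[OF this filterlim_inverse_at_top_right]
  have "((\<lambda>s. poly p (inverse s) * exp (- inverse s)) \<longlongrightarrow> 0) (at_right 0)" .
  then show "(flat p \<longlongrightarrow> 0) (at_right 0)"
  proof (rule Lim_transform_eventually)
    show "eventually (\<lambda>s. poly p (inverse s) * exp (- inverse s) = flat p s) (at_right 0)"
      unfolding eventually_at_filter by (simp add: flat_def divide_inverse)
  qed
qed

lemma flat_has_derivative:
  "(flat p has_real_derivative flat ([:0, 0, 1:] * (p - pderiv p)) s) (at s)"
proof -
  consider "s > 0" | "s < 0" | "s = 0" by linarith
  then show ?thesis
  proof cases
    case 1
    have "((\<lambda>s. poly p (1 / s) * exp (- (1 / s))) has_real_derivative flat ([:0, 0, 1:] * (p - pderiv p)) s) (at s)"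
      using 1 unfolding flat_def
      by (auto intro!: derivative_eq_intros DERIV_chain2[OF poly_DERIV] simp: field_simps power2_eq_square)
    then show ?thesis
      by (rule has_field_derivative_transform_within_open[where S = "{0<..}"]) (use 1 in \<open>auto simp: flat_def\<close>)
  next
    case 2
    have "((\<lambda>s. 0) has_real_derivative flat ([:0, 0, 1:] * (p - pderiv p)) s) (at s)"
      using 2 by (simp add: flat_def)
    then show ?thesis
      by (rule has_field_derivative_transform_within_open[where S = "{..<0}"]) (use 2 in \<open>auto simp: flat_def\<close>)
  next
    case 3
    \<comment> \<open>At 0 the difference quotient of \<open>flat p\<close> is of the same form,
      with \<open>p\<close> multiplied by the variable.\<close>
    have "(flat ([:0, 1:] * p) \<longlongrightarrow> 0) (at 0)" by (rule flat_tendsto_0)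
    moreover have "(\<lambda>h. (flat p (0 + h) - flat p 0) / h) = flat ([:0, 1:] * p)"
      by (simp add: flat_def fun_eq_iff)
    ultimately have "((\<lambda>h. (flat p (0 + h) - flat p 0) / h) \<longlongrightarrow> 0) (at 0)" by (simp only:)
    then show ?thesis using 3 by (simp add: DERIV_def flat_def)
  qed
qed

lemma smooth_on_flat: "smooth_on UNIV (flat p)"
proof -
  have "Ck_on k UNIV (flat p)" for k
  proof (induction k arbitrary: p)
    case 0
    show ?case using DERIV_isCont[OF flat_has_derivative] by (simp add: continuous_on_eq_continuous_at)
  next
    case (Suc k)
    let ?q = "[:0, 0, 1:] * (p - pderiv p)"
    have der: "(flat p has_derivative (\<lambda>v. flat ?q x * v)) (at x)" for x
      using flat_has_derivative[of p x] by (simp only: has_field_derivative_def)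
    have "Ck_on k UNIV (\<lambda>x. flat ?q x * v)" for v
      by (rule Ck_on_bilinear[OF bounded_bilinear_mult open_UNIV Suc Ck_on_const])
    moreover have "(\<lambda>x. dd (flat p) x v) = (\<lambda>x. flat ?q x * v)" for v
      using dd_eqI[OF der] by simp
    ultimately show ?case using der by (auto intro: differentiableI)
  qed
  then show ?thesis by (simp add: smooth_on_def)
qed

definition plateau :: "real \<Rightarrow> real" where
  "plateau = flat 1"

lemma plateau_nonneg: "plateau s \<ge> 0" and plateau_pos_iff: "plateau s > 0 \<longleftrightarrow> s > 0"
  by (simp_all add: plateau_def flat_def)

text \<open>
  The factor \<open>plateau (1 / (n + 1) - \<phi> k z)\<close> switches off the \<open>n\<close>-th function wherever an earlier
  \<open>\<phi> k\<close> is at least \<open>1 / (n + 1)\<close>; this makes the family locally finite.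
\<close>

lemma smooth_locally_finite_family:
  fixes y :: "nat \<Rightarrow> 'a::euclidean_space" and r :: "nat \<Rightarrow> real"
  assumes r: "\<And>n. r n > 0"
  obtains \<psi> :: "nat \<Rightarrow> 'a \<Rightarrow> real" where
    "\<And>n. smooth_on UNIV (\<psi> n)" "\<And>n z. \<psi> n z \<ge> 0" "\<And>n z. \<psi> n z \<noteq> 0 \<Longrightarrow> z \<in> ball (y n) (r n)"
    "\<And>z. z \<in> (\<Union>n. ball (y n) (r n)) \<Longrightarrow> \<exists>n. \<psi> n z > 0"
    "\<And>z. z \<in> (\<Union>n. ball (y n) (r n)) \<Longrightarrow> \<exists>N n0. open N \<and> z \<in> N \<and> (\<forall>n\<ge>n0. \<forall>w\<in>N. \<psi> n w = 0)"
proof -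
  \<comment> \<open>Squared distances keep the argument polynomial, hence smooth at the centre too;
    \<open>\<phi> n\<close> is positive exactly on the ball.\<close>
  define \<phi> where "\<phi> n z = plateau ((r n)\<^sup>2 - (z - y n) \<bullet> (z - y n))" for n z
  define \<psi> where "\<psi> n z = \<phi> n z * (\<Prod>k<n. plateau (1 / (real n + 1) - \<phi> k z))" for n z
  have \<phi>_pos: "\<phi> n z > 0 \<longleftrightarrow> z \<in> ball (y n) (r n)" for n z
  proof -
    have "(z - y n) \<bullet> (z - y n) < (r n)\<^sup>2 \<longleftrightarrow> dist (y n) z < r n"
      using r[of n] norm_lt_square[of "z - y n" "r n"] by (simp add: dist_norm norm_minus_commute)
    then show ?thesis by (simp add: \<phi>_def plateau_pos_iff)
  qed
  have \<phi>_nonneg: "\<phi> n z \<ge> 0" for n z by (simp add: \<phi>_def plateau_nonneg)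
  have pl: "smooth_on UNIV (\<lambda>z. plateau (f z))" if "smooth_on UNIV f" for f :: "'a \<Rightarrow> real"
    unfolding plateau_def by (rule smooth_on_compose[OF open_UNIV open_UNIV that smooth_on_flat]) simp
  have \<phi>_smooth: "smooth_on UNIV (\<phi> n)" for n
    unfolding \<phi>_def
    by (intro pl smooth_on_diff smooth_on_inner smooth_on_const open_UNIV smooth_on_bounded_linear bounded_linear_ident)
  have 1: "smooth_on UNIV (\<psi> n)" for n
    unfolding \<psi>_def
    by (intro smooth_on_mult smooth_on_prod pl smooth_on_diff smooth_on_const open_UNIV \<phi>_smooth)
  have 2: "\<psi> n z \<ge> 0" for n z
    by (simp add: \<psi>_def \<phi>_nonneg plateau_nonneg prod_nonneg)
  have 3: "z \<in> ball (y n) (r n)" if "\<psi> n z \<noteq> 0" for n z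
    using that \<phi>_pos[of n z] \<phi>_nonneg[of n z] by (simp add: \<psi>_def)
  have 4: "\<exists>n. \<psi> n z > 0" if "z \<in> (\<Union>n. ball (y n) (r n))" for z
  proof -
    \<comment> \<open>At the least such index the earlier \<open>\<phi> k z\<close> vanish, so no
      factor of the product is switched off.\<close>
    define n where "n = (LEAST n. \<phi> n z > 0)"
    have ex: "\<exists>n. \<phi> n z > 0" unfolding \<phi>_pos using that by blast
    have n: "\<phi> n z > 0" unfolding n_def using LeastI_ex[OF ex] .
    have "\<phi> k z = 0" if "k < n" for k
      using not_less_Least[of k "\<lambda>n. \<phi> n z > 0"] that \<phi>_nonneg[of k z] by (auto simp: n_def)
    then have "\<psi> n z > 0"
      unfolding \<psi>_def using n by (intro mult_pos_pos prod_pos) (auto simp: plateau_pos_iff)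
    then show ?thesis ..
  qed
  have 5: "\<exists>N n0. open N \<and> z \<in> N \<and> (\<forall>n\<ge>n0. \<forall>w\<in>N. \<psi> n w = 0)" if "z \<in> (\<Union>n. ball (y n) (r n))" for z
  proof -
    from that obtain k where "z \<in> ball (y k) (r k)" by blast
    then have k: "\<phi> k z > 0" by (simp only: \<phi>_pos)
    obtain n0 where n0: "1 / (real n0 + 1) < \<phi> k z"
      using k reals_Archimedean[of "\<phi> k z"] by (auto simp: inverse_eq_divide add.commute)
    define N where "N = \<phi> k -` {1 / (real n0 + 1)<..}"
    have "open N" unfolding N_def
      using smooth_on_imp_continuous_on[OF \<phi>_smooth] by (intro open_vimage) auto
    moreover have "z \<in> N" using n0 by (simp add: N_def)
    \<comment> \<open>The bound \<open>Suc k\<close> puts \<open>k\<close> among the indices below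
      \<open>n\<close>, so its factor occurs in \<open>\<psi> n\<close>; the bound \<open>n0\<close>
      makes this factor vanish on \<open>N\<close>.\<close>
    moreover have "\<psi> n w = 0" if n: "n \<ge> max n0 (Suc k)" and w: "w \<in> N" for n w
    proof -
      have "1 / (real n + 1) \<le> 1 / (real n0 + 1)" using n by (intro divide_left_mono) auto
      then have "plateau (1 / (real n + 1) - \<phi> k w) = 0"
        using w plateau_pos_iff[of "1 / (real n + 1) - \<phi> k w"] plateau_nonneg[of "1 / (real n + 1) - \<phi> k w"]
        by (auto simp: N_def)
      then show ?thesis using n by (auto simp: \<psi>_def intro!: prod_zero bexI[of _ k])
    qed
    ultimately show ?thesis by (intro exI[of _ N] exI[of _ "max n0 (Suc k)"]) auto
  qed
  show ?thesis by (rule that[OF 1 2 3 4 5])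
qed

section \<open>Charts and smooth functions on a manifold\<close>

locale atlas =
  fixes A :: "('a::topological_space, 'm::finite) chart set"
  assumes smooth_atlas: "smooth_atlas A"
begin

text \<open>\<open>is_chart\<close> only asserts that some continuous inverse exists; on the image
  of the chart it must agree with \<open>chart_inv\<close>.\<close>

lemma chart_homeomorphism:
  assumes "\<kappa> \<in> A"
  shows "open (fst \<kappa>)" "open (snd \<kappa> ` fst \<kappa>)" "homeomorphism (fst \<kappa>) (snd \<kappa> ` fst \<kappa>) (snd \<kappa>) (chart_inv \<kappa>)"
proof -
  obtain \<psi> where \<psi>: "open (fst \<kappa>)" "open (snd \<kappa> ` fst \<kappa>)" "homeomorphism (fst \<kappa>) (snd \<kappa> ` fst \<kappa>) (snd \<kappa>) \<psi>"
    using smooth_atlas assms by (auto simp: smooth_atlas_def is_chart_def)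
  then have inj: "inj_on (snd \<kappa>) (fst \<kappa>)"
    by (intro inj_on_inverseI[of _ \<psi>]) (simp add: homeomorphism_apply1[OF \<psi>(3)])
  have "\<psi> x = chart_inv \<kappa> x" if "x \<in> snd \<kappa> ` fst \<kappa>" for x
    using that inj homeomorphism_apply1[OF \<psi>(3)] by (auto simp: chart_inv_def)
  then have "homeomorphism (fst \<kappa>) (snd \<kappa> ` fst \<kappa>) (snd \<kappa>) (chart_inv \<kappa>)"
    by (intro homeomorphism_cong[OF \<psi>(3)]) auto
  then show "open (fst \<kappa>)" "open (snd \<kappa> ` fst \<kappa>)" "homeomorphism (fst \<kappa>) (snd \<kappa> ` fst \<kappa>) (snd \<kappa>) (chart_inv \<kappa>)"
    using \<psi> by auto
qed

lemma chart_inv_left [simp]: "\<kappa> \<in> A \<Longrightarrow> p \<in> fst \<kappa> \<Longrightarrow> chart_inv \<kappa> (snd \<kappa> p) = p"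
  using chart_homeomorphism(3) by (metis homeomorphism_apply1)

lemma chart_inv_right [simp]: "\<kappa> \<in> A \<Longrightarrow> x \<in> snd \<kappa> ` fst \<kappa> \<Longrightarrow> snd \<kappa> (chart_inv \<kappa> x) = x"
  using chart_homeomorphism(3) by (metis homeomorphism_apply2)

lemma chart_inv_in: "\<kappa> \<in> A \<Longrightarrow> x \<in> snd \<kappa> ` fst \<kappa> \<Longrightarrow> chart_inv \<kappa> x \<in> fst \<kappa>"
  by auto

lemma continuous_on_chart: "\<kappa> \<in> A \<Longrightarrow> continuous_on (fst \<kappa>) (snd \<kappa>)"
  and continuous_on_chart_inv: "\<kappa> \<in> A \<Longrightarrow> continuous_on (snd \<kappa> ` fst \<kappa>) (chart_inv \<kappa>)"
  using chart_homeomorphism(3) by (auto simp: homeomorphism_def)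

lemma chart_image_eq:
  "\<kappa> \<in> A \<Longrightarrow> snd \<kappa> ` (fst \<kappa> \<inter> S) = snd \<kappa> ` fst \<kappa> \<inter> chart_inv \<kappa> -` S"
  by (auto simp: image_iff intro!: bexI[of _ "chart_inv \<kappa> _"])

lemma open_chart_image: "\<kappa> \<in> A \<Longrightarrow> open S \<Longrightarrow> open (snd \<kappa> ` (fst \<kappa> \<inter> S))"
  unfolding chart_image_eq
  using chart_homeomorphism(2) continuous_on_chart_inv by (intro continuous_open_preimage) auto

lemma open_chart_preimage: "\<kappa> \<in> A \<Longrightarrow> open T \<Longrightarrow> open (fst \<kappa> \<inter> snd \<kappa> -` T)"
  using chart_homeomorphism(1) continuous_on_chart by (intro continuous_open_preimage) auto

lemma chart_at: obtains \<kappa> where "\<kappa> \<in> A" "p \<in> fst \<kappa>"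
proof -
  have "p \<in> (\<Union>\<kappa>\<in>A. fst \<kappa>)" using smooth_atlas by (simp add: smooth_atlas_def)
  then show ?thesis using that by blast
qed

lemma smooth_on_transition:
  "\<kappa> \<in> A \<Longrightarrow> \<mu> \<in> A \<Longrightarrow> smooth_on (snd \<kappa> ` (fst \<kappa> \<inter> fst \<mu>)) (transition \<kappa> \<mu>)"
  using smooth_atlas by (auto simp: smooth_atlas_def)

lemma transition_apply: "\<kappa> \<in> A \<Longrightarrow> p \<in> fst \<kappa> \<Longrightarrow> transition \<kappa> \<mu> (snd \<kappa> p) = snd \<mu> p"
  by (simp add: transition_def)

lemma open_overlap: "\<kappa> \<in> A \<Longrightarrow> \<mu> \<in> A \<Longrightarrow> open (snd \<kappa> ` (fst \<kappa> \<inter> fst \<mu>))"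
  by (rule open_chart_image[OF _ chart_homeomorphism(1)])

lemma transition_derivative:
  assumes "\<kappa> \<in> A" "\<mu> \<in> A" "p \<in> fst \<kappa> \<inter> fst \<mu>"
  shows "(transition \<kappa> \<mu> has_derivative (*v) (jacobian \<kappa> \<mu> p)) (at (snd \<kappa> p))"
proof -
  have 1: "transition \<kappa> \<mu> differentiable (at (snd \<kappa> p))"
    using smooth_on_imp_differentiable[OF smooth_on_transition[OF assms(1,2)]] assms(3) by blast
  then have "(*v) (jacobian \<kappa> \<mu> p) = dd (transition \<kappa> \<mu>) (snd \<kappa> p)"
    unfolding jacobian_def using linear_dd[OF 1] by (intro ext) (simp add: matrix_works)
  then show ?thesis using has_derivative_dd[OF 1] by simp
qed

lemma chain_transition:
  fixes f :: "'a \<Rightarrow> 'b::euclidean_space"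
  assumes "\<kappa> \<in> A" "\<mu> \<in> A" "p \<in> fst \<kappa> \<inter> fst \<mu>" "(f \<circ> chart_inv \<mu>) differentiable (at (snd \<mu> p))"
  shows "dd (f \<circ> chart_inv \<kappa>) (snd \<kappa> p) v = dd (f \<circ> chart_inv \<mu>) (snd \<mu> p) (jacobian \<kappa> \<mu> p *v v)"
proof -
  have p: "p \<in> fst \<kappa>" using assms(3) by simp
  have "((f \<circ> chart_inv \<mu>) has_derivative dd (f \<circ> chart_inv \<mu>) (snd \<mu> p)) (at (transition \<kappa> \<mu> (snd \<kappa> p)))"
    using has_derivative_dd[OF assms(4)] transition_apply[OF assms(1) p] by simp
  from dd_eqI[OF has_derivative_compose[OF transition_derivative[OF assms(1-3)] this]]
  have "dd (\<lambda>x. (f \<circ> chart_inv \<mu>) (transition \<kappa> \<mu> x)) (snd \<kappa> p) v = dd (f \<circ> chart_inv \<mu>) (snd \<mu> p) (jacobian \<kappa> \<mu> p *v v)"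
    by simp
  moreover have "dd (\<lambda>x. (f \<circ> chart_inv \<mu>) (transition \<kappa> \<mu> x)) (snd \<kappa> p) = dd (f \<circ> chart_inv \<kappa>) (snd \<kappa> p)"
    using assms by (intro dd_cong_open[OF open_overlap[OF assms(1,2)]]) (auto simp: transition_apply)
  ultimately show ?thesis by simp
qed

lemma jacobian_inverse:
  assumes "\<kappa> \<in> A" "\<mu> \<in> A" "p \<in> fst \<kappa> \<inter> fst \<mu>"
  shows "jacobian \<mu> \<kappa> p ** jacobian \<kappa> \<mu> p = mat 1"
proof -
  have p: "p \<in> fst \<kappa>" "p \<in> fst \<mu>" using assms(3) by auto
  have d: "(snd \<kappa> \<circ> chart_inv \<mu>) differentiable (at (snd \<mu> p))"
    using smooth_on_imp_differentiable[OF smooth_on_transition[OF assms(2,1)], of "snd \<mu> p"] p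
    by (auto simp: transition_def)
  have "dd (snd \<kappa> \<circ> chart_inv \<kappa>) (snd \<kappa> p) = dd (\<lambda>x. x) (snd \<kappa> p)"
    using assms(1) p chart_homeomorphism(2)[OF assms(1)]
    by (intro dd_cong_open[of "snd \<kappa> ` fst \<kappa>"]) auto
  moreover have "dd (snd \<kappa> \<circ> chart_inv \<mu>) (snd \<mu> p) = (*v) (jacobian \<mu> \<kappa> p)"
    using dd_eqI[OF transition_derivative[OF assms(2,1)]] p by (simp add: transition_def)
  ultimately have "(jacobian \<mu> \<kappa> p ** jacobian \<kappa> \<mu> p) *v v = mat 1 *v v" for v
    using chain_transition[OF assms d, of v] by (simp add: matrix_vector_mul_assoc)
  then show ?thesis by (simp add: matrix_eq)
qed

lemma det_jacobian_nonzero: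
  assumes "\<kappa> \<in> A" "\<mu> \<in> A" "p \<in> fst \<kappa> \<inter> fst \<mu>"
  shows "det (jacobian \<kappa> \<mu> p) \<noteq> 0"
  using jacobian_inverse[OF assms] invertible_det_nz invertible_left_inverse by blast

section \<open>Smooth functions on the manifold and their differentials\<close>

lemma smooth_fun_onD:
  "smooth_fun_on A S f \<Longrightarrow> \<kappa> \<in> A \<Longrightarrow> smooth_on (snd \<kappa> ` (fst \<kappa> \<inter> S)) (f \<circ> chart_inv \<kappa>)"
  by (simp add: smooth_fun_on_def)

lemma smooth_fun_on_subset: "smooth_fun_on A S f \<Longrightarrow> T \<subseteq> S \<Longrightarrow> smooth_fun_on A T f"
  unfolding smooth_fun_on_def by (meson Int_mono image_mono order_refl smooth_on_subset)

lemma smooth_fun_on_local: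
  assumes "\<And>p. p \<in> S \<Longrightarrow> \<exists>N. open N \<and> p \<in> N \<and> smooth_fun_on A N f"
  shows "smooth_fun_on A S f"
  unfolding smooth_fun_on_def
proof
  fix \<kappa> assume \<kappa>: "\<kappa> \<in> A"
  show "smooth_on (snd \<kappa> ` (fst \<kappa> \<inter> S)) (f \<circ> chart_inv \<kappa>)"
  proof (rule smooth_on_local)
    fix x assume "x \<in> snd \<kappa> ` (fst \<kappa> \<inter> S)"
    then obtain p where p: "p \<in> fst \<kappa>" "p \<in> S" "x = snd \<kappa> p" by auto
    obtain N where N: "open N" "p \<in> N" "smooth_fun_on A N f" using assms[OF p(2)] by blast
    have "x \<in> snd \<kappa> ` (fst \<kappa> \<inter> N)" using p N by auto
    then show "\<exists>N. open N \<and> x \<in> N \<and> smooth_on N (f \<circ> chart_inv \<kappa>)"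
      using open_chart_image[OF \<kappa> N(1)] smooth_fun_onD[OF N(3) \<kappa>] by blast
  qed
qed

lemma smooth_fun_on_cong:
  assumes "open S" "\<And>p. p \<in> S \<Longrightarrow> f p = g p"
  shows "smooth_fun_on A S f \<longleftrightarrow> smooth_fun_on A S g"
proof -
  have "smooth_on (snd \<kappa> ` (fst \<kappa> \<inter> S)) (f \<circ> chart_inv \<kappa>) \<longleftrightarrow> smooth_on (snd \<kappa> ` (fst \<kappa> \<inter> S)) (g \<circ> chart_inv \<kappa>)"
    if "\<kappa> \<in> A" for \<kappa>
    using that assms open_chart_image[OF that assms(1)] by (intro smooth_on_cong) auto
  then show ?thesis by (auto simp: smooth_fun_on_def)
qed

text \<open>Smooth transition maps carry smoothness from one chart around \<open>S\<close> to all
  charts.\<close>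

lemma smooth_fun_on_chartI:
  assumes "\<kappa> \<in> A" "open S" "S \<subseteq> fst \<kappa>" "smooth_on (snd \<kappa> ` S) (f \<circ> chart_inv \<kappa>)"
  shows "smooth_fun_on A S f"
  unfolding smooth_fun_on_def
proof
  fix \<mu> assume \<mu>: "\<mu> \<in> A"
  have sm: "smooth_on (snd \<mu> ` (fst \<mu> \<inter> S)) (\<lambda>x. (f \<circ> chart_inv \<kappa>) (transition \<mu> \<kappa> x))"
  proof (rule smooth_on_compose[where f = "transition \<mu> \<kappa>" and T = "snd \<kappa> ` S"])
    show "open (snd \<mu> ` (fst \<mu> \<inter> S))" by (rule open_chart_image[OF \<mu> assms(2)])
    show "open (snd \<kappa> ` S)" using open_chart_image[OF assms(1,2)] assms(3) by (simp add: Int_absorb1)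
    show "smooth_on (snd \<mu> ` (fst \<mu> \<inter> S)) (transition \<mu> \<kappa>)"
      by (rule smooth_on_subset[OF smooth_on_transition[OF \<mu> assms(1)]]) (use assms(3) in auto)
    show "transition \<mu> \<kappa> ` (snd \<mu> ` (fst \<mu> \<inter> S)) \<subseteq> snd \<kappa> ` S"
      using \<mu> assms(3) by (auto simp: transition_apply)
  qed (rule assms(4))
  have eq: "(f \<circ> chart_inv \<kappa>) (transition \<mu> \<kappa> x) = (f \<circ> chart_inv \<mu>) x" if "x \<in> snd \<mu> ` (fst \<mu> \<inter> S)" for x
    using that \<mu> assms(1,3) by (auto simp: transition_apply)
  show "smooth_on (snd \<mu> ` (fst \<mu> \<inter> S)) (f \<circ> chart_inv \<mu>)"
    using smooth_on_cong[OF open_chart_image[OF \<mu> assms(2)] eq] sm by (rule iffD1)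
qed

lemma smooth_fun_on_const: "smooth_fun_on A S (\<lambda>p. c)"
  by (simp add: smooth_fun_on_def o_def smooth_on_const)

lemma smooth_fun_on_add:
  "open S \<Longrightarrow> smooth_fun_on A S f \<Longrightarrow> smooth_fun_on A S g \<Longrightarrow> smooth_fun_on A S (\<lambda>p. f p + g p)"
  by (simp add: smooth_fun_on_def o_def smooth_on_add open_chart_image)

lemma smooth_fun_on_diff:
  "open S \<Longrightarrow> smooth_fun_on A S f \<Longrightarrow> smooth_fun_on A S g \<Longrightarrow> smooth_fun_on A S (\<lambda>p. f p - g p)"
  by (simp add: smooth_fun_on_def o_def smooth_on_diff open_chart_image)

lemma smooth_fun_on_mult:
  "open S \<Longrightarrow> smooth_fun_on A S f \<Longrightarrow> smooth_fun_on A S g \<Longrightarrow> smooth_fun_on A S (\<lambda>p. f p * g p)"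
  by (simp add: smooth_fun_on_def o_def smooth_on_mult open_chart_image)

lemma smooth_fun_on_divide:
  "open S \<Longrightarrow> smooth_fun_on A S f \<Longrightarrow> smooth_fun_on A S g \<Longrightarrow> (\<And>p. p \<in> S \<Longrightarrow> g p \<noteq> 0) \<Longrightarrow>
    smooth_fun_on A S (\<lambda>p. f p / g p)"
  unfolding smooth_fun_on_def o_def
proof
  fix \<kappa> assume \<kappa>: "\<kappa> \<in> A" and S: "open S" and fg: "\<forall>\<kappa>\<in>A. smooth_on (snd \<kappa> ` (fst \<kappa> \<inter> S)) (\<lambda>x. f (chart_inv \<kappa> x))"
    "\<forall>\<kappa>\<in>A. smooth_on (snd \<kappa> ` (fst \<kappa> \<inter> S)) (\<lambda>x. g (chart_inv \<kappa> x))" and nz: "\<And>p. p \<in> S \<Longrightarrow> g p \<noteq> 0"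
  have "g (chart_inv \<kappa> x) \<noteq> 0" if "x \<in> snd \<kappa> ` (fst \<kappa> \<inter> S)" for x
    using that \<kappa> nz by fastforce
  then show "smooth_on (snd \<kappa> ` (fst \<kappa> \<inter> S)) (\<lambda>x. f (chart_inv \<kappa> x) / g (chart_inv \<kappa> x))"
    using fg \<kappa> by (intro smooth_on_divide open_chart_image[OF \<kappa> S]) auto
qed

lemma smooth_fun_on_sum:
  "open S \<Longrightarrow> (\<And>i. i \<in> I \<Longrightarrow> smooth_fun_on A S (f i)) \<Longrightarrow> smooth_fun_on A S (\<lambda>p. \<Sum>i\<in>I. f i p)"
  by (simp add: smooth_fun_on_def o_def smooth_on_sum open_chart_image)

lemma smooth_fun_on_compose_vec:
  fixes C :: "'k::finite \<Rightarrow> 'a \<Rightarrow> real"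
  assumes "open S" "\<And>k. smooth_fun_on A S (C k)" "open T" "smooth_on T g" "\<And>p. p \<in> S \<Longrightarrow> (\<chi> k. C k p) \<in> T"
  shows "smooth_fun_on A S (\<lambda>p. g (\<chi> k. C k p))"
  unfolding smooth_fun_on_def o_def
proof
  fix \<kappa> assume \<kappa>: "\<kappa> \<in> A"
  note op = open_chart_image[OF \<kappa> assms(1)]
  show "smooth_on (snd \<kappa> ` (fst \<kappa> \<inter> S)) (\<lambda>x. g (\<chi> k. C k (chart_inv \<kappa> x)))"
  proof (rule smooth_on_compose[OF op assms(3) _ assms(4)])
    show "smooth_on (snd \<kappa> ` (fst \<kappa> \<inter> S)) (\<lambda>x. \<chi> k. C k (chart_inv \<kappa> x))"
      using smooth_fun_onD[OF assms(2) \<kappa>] by (intro smooth_on_vec[OF op]) (simp add: o_def)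
    show "(\<lambda>x. \<chi> k. C k (chart_inv \<kappa> x)) ` snd \<kappa> ` (fst \<kappa> \<inter> S) \<subseteq> T"
      using assms(5) \<kappa> by auto
  qed
qed

lemma differential_eq_grad: "differential \<kappa> f p = grad (f \<circ> chart_inv \<kappa>) (snd \<kappa> p)"
  by (simp add: differential_def grad_def)

lemma smooth_fun_on_differentiable:
  assumes "smooth_fun_on A S f" "\<kappa> \<in> A" "p \<in> fst \<kappa> \<inter> S"
  shows "(f \<circ> chart_inv \<kappa>) differentiable (at (snd \<kappa> p))"
  using smooth_on_imp_differentiable[OF smooth_fun_onD[OF assms(1,2)]] assms(3) by blast

lemma differential_inner:
  assumes "smooth_fun_on A S f" "\<kappa> \<in> A" "p \<in> fst \<kappa> \<inter> S"
  shows "differential \<kappa> f p \<bullet> v = dd (f \<circ> chart_inv \<kappa>) (snd \<kappa> p) v"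
  unfolding differential_eq_grad by (rule grad_inner[OF smooth_fun_on_differentiable[OF assms]])

lemma differential_transform:
  assumes "smooth_fun_on A S f" "\<kappa> \<in> A" "\<mu> \<in> A" "p \<in> fst \<kappa> \<inter> fst \<mu> \<inter> S"
  shows "differential \<kappa> f p = transpose (jacobian \<kappa> \<mu> p) *v differential \<mu> f p"
proof (rule vector_eq_rdot[THEN iffD1], rule allI)
  fix v
  have "differential \<kappa> f p \<bullet> v = dd (f \<circ> chart_inv \<mu>) (snd \<mu> p) (jacobian \<kappa> \<mu> p *v v)"
    using differential_inner[OF assms(1,2), of p v] chain_transition[OF assms(2,3), of p f v]
      smooth_fun_on_differentiable[OF assms(1,3), of p] assms(4) by auto
  also have "\<dots> = differential \<mu> f p \<bullet> (jacobian \<kappa> \<mu> p *v v)"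
    using differential_inner[OF assms(1,3), of p] assms(4) by auto
  also have "\<dots> = (transpose (jacobian \<kappa> \<mu> p) *v differential \<mu> f p) \<bullet> v"
    by (metis dot_lmul_matrix transpose_matrix_vector)
  finally show "differential \<kappa> f p \<bullet> v = (transpose (jacobian \<kappa> \<mu> p) *v differential \<mu> f p) \<bullet> v" .
qed

section \<open>Volume forms, divergence and flows\<close>

text \<open>The function \<rho> with \<open>\<Omega> = \<rho> dx\<close>, taken as a function of the
  coordinates so that it can be differentiated directly.\<close>

definition vdens :: "('a, 'm) topform \<Rightarrow> ('a, 'm) chart \<Rightarrow> real ^ 'm \<Rightarrow> real" where
  "vdens \<Omega> \<kappa> x = \<Omega> \<kappa> (chart_inv \<kappa> x) (\<lambda>i. axis i 1)"

lemma top_form_eq_vdens: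
  assumes "top_form A \<Omega>" "\<kappa> \<in> A" "p \<in> fst \<kappa>"
  shows "\<Omega> \<kappa> p V = vdens \<Omega> \<kappa> (snd \<kappa> p) * detv V"
proof -
  have "alternating_multilinear (\<Omega> \<kappa> p)" using assms by (simp add: top_form_def)
  from am_unique[OF this, of V] show ?thesis using assms by (simp add: vdens_def)
qed

lemma vdens_nonzero:
  assumes "volume_form A \<Omega>" "\<kappa> \<in> A" "p \<in> fst \<kappa>"
  shows "vdens \<Omega> \<kappa> (snd \<kappa> p) \<noteq> 0"
  using assms top_form_eq_vdens[of \<Omega> \<kappa> p] unfolding volume_form_def by fastforce

lemma smooth_on_vdens: "top_form A \<Omega> \<Longrightarrow> \<kappa> \<in> A \<Longrightarrow> smooth_on (snd \<kappa> ` fst \<kappa>) (vdens \<Omega> \<kappa>)"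
  unfolding top_form_def vdens_def by blast

lemma vdens_transform:
  assumes "top_form A \<Omega>" "\<kappa> \<in> A" "\<mu> \<in> A" "p \<in> fst \<kappa> \<inter> fst \<mu>"
  shows "vdens \<Omega> \<kappa> (snd \<kappa> p) = vdens \<Omega> \<mu> (snd \<mu> p) * det (jacobian \<kappa> \<mu> p)"
proof -
  have "\<Omega> \<kappa> p (\<lambda>i. axis i 1) = \<Omega> \<mu> p (\<lambda>i. jacobian \<kappa> \<mu> p *v axis i 1)"
    using assms unfolding top_form_def by blast
  then show ?thesis
    using assms top_form_eq_vdens[OF assms(1,3), of p] top_form_eq_vdens[OF assms(1,2), of p "\<lambda>i. axis i 1"]
    by (simp add: detv_matrix_vector_mult detv_axis)
qed

lemma lie_derivative_eq:
  assumes \<Omega>: "top_form A \<Omega>" and \<kappa>: "\<kappa> \<in> A" "p \<in> fst \<kappa>"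
  shows "lie_derivative Z \<Omega> \<kappa> p V = dd (vdens \<Omega> \<kappa>) (snd \<kappa> p) (Z \<kappa> p) * detv V +
     vdens \<Omega> \<kappa> (snd \<kappa> p) * (\<Sum>i\<in>UNIV. detv (V(i := dd (Z \<kappa> \<circ> chart_inv \<kappa>) (snd \<kappa> p) (V i))))"
proof -
  have x: "snd \<kappa> p \<in> snd \<kappa> ` fst \<kappa>" using \<kappa> by simp
  have "dd (\<lambda>x. \<Omega> \<kappa> (chart_inv \<kappa> x) V) (snd \<kappa> p) = dd (\<lambda>x. vdens \<Omega> \<kappa> x * detv V) (snd \<kappa> p)"
    using top_form_eq_vdens[OF \<Omega> \<kappa>(1)] \<kappa>
    by (intro dd_cong_open[OF chart_homeomorphism(2)[OF \<kappa>(1)] x]) auto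
  also have "\<dots> = (\<lambda>v. dd (vdens \<Omega> \<kappa>) (snd \<kappa> p) v * detv V)"
    by (rule dd_eqI) (rule has_derivative_mult_left[OF smooth_on_imp_has_derivative[OF smooth_on_vdens[OF \<Omega> \<kappa>(1)] x]])
  finally show ?thesis
    unfolding lie_derivative_def by (simp add: top_form_eq_vdens[OF \<Omega> \<kappa>] sum_distrib_left)
qed

text \<open>The Lie derivative consists of the derivative of the density along \<open>Z\<close> and,
  by \<open>detv_trace\<close>, the density times the trace of the derivative of \<open>Z\<close>;
  together these are the Euclidean divergence of \<open>\<rho> Z\<close>.\<close>

lemma lie_derivative_divergence:
  assumes \<Omega>: "top_form A \<Omega>" and \<kappa>: "\<kappa> \<in> A" "p \<in> fst \<kappa>"
    and Z: "smooth_on (snd \<kappa> ` fst \<kappa>) (Z \<kappa> \<circ> chart_inv \<kappa>)"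
  shows "lie_derivative Z \<Omega> \<kappa> p V =
     (\<Sum>j\<in>UNIV. dd (\<lambda>x. vdens \<Omega> \<kappa> x * Z \<kappa> (chart_inv \<kappa> x) $ j) (snd \<kappa> p) (axis j 1)) * detv V"
proof -
  let ?x = "snd \<kappa> p" and ?Z = "Z \<kappa> \<circ> chart_inv \<kappa>"
  have x: "?x \<in> snd \<kappa> ` fst \<kappa>" using \<kappa> by simp
  have Zd: "?Z differentiable (at ?x)" using smooth_on_imp_differentiable[OF Z x] .
  have \<rho>d: "(vdens \<Omega> \<kappa> has_derivative dd (vdens \<Omega> \<kappa>) ?x) (at ?x)"
    using smooth_on_imp_has_derivative[OF smooth_on_vdens[OF \<Omega> \<kappa>(1)] x] .
  have "dd (\<lambda>x. vdens \<Omega> \<kappa> x * ?Z x $ j) ?x v = vdens \<Omega> \<kappa> ?x * dd ?Z ?x v $ j + dd (vdens \<Omega> \<kappa>) ?x v * ?Z ?x $ j" for j v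
    using dd_eqI[OF has_derivative_mult[OF \<rho>d bounded_linear.has_derivative[OF bounded_linear_vec_nth has_derivative_dd[OF Zd], of j]]]
    by simp
  then have "(\<Sum>j\<in>UNIV. dd (\<lambda>x. vdens \<Omega> \<kappa> x * ?Z x $ j) ?x (axis j 1)) =
     vdens \<Omega> \<kappa> ?x * (\<Sum>j\<in>UNIV. dd ?Z ?x (axis j 1) $ j) + grad (vdens \<Omega> \<kappa>) ?x \<bullet> ?Z ?x"
    by (simp add: sum.distrib sum_distrib_left inner_vec_def grad_def)
  moreover have "grad (vdens \<Omega> \<kappa>) ?x \<bullet> ?Z ?x = dd (vdens \<Omega> \<kappa>) ?x (Z \<kappa> p)"
    using \<kappa> by (simp add: grad_inner[OF differentiableI[OF \<rho>d]])
  ultimately show ?thesis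
    unfolding lie_derivative_eq[OF \<Omega> \<kappa>] detv_trace[OF linear_dd[OF Zd]] by (simp add: algebra_simps)
qed

text \<open>With \<open>f\<close> a flow in coordinates, the differentiated expression is the
  pull-back of \<open>\<Omega>\<close> evaluated on \<open>V\<close>. Its time derivative is the Lie
  derivative evaluated on the transported vectors \<open>dd f (s, x0) (0, V i)\<close>, because
  these satisfy the linearised equation.\<close>

lemma flow_pullback_derivative_zero:
  fixes f :: "real \<times> (real ^ 'm) \<Rightarrow> real ^ 'm"
  assumes \<Omega>: "top_form A \<Omega>" and \<mu>: "\<mu> \<in> A"
    and Z: "smooth_on (snd \<mu> ` fst \<mu>) (Z \<mu> \<circ> chart_inv \<mu>)"
    and lie: "\<And>p V. p \<in> fst \<mu> \<Longrightarrow> lie_derivative Z \<Omega> \<mu> p V = 0"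
    and W: "open W" "smooth_on W f" "\<And>z. z \<in> W \<Longrightarrow> f z \<in> snd \<mu> ` fst \<mu>"
    and ode: "\<And>z. z \<in> W \<Longrightarrow> dd f z (1, 0) = Z \<mu> (chart_inv \<mu> (f z))"
    and z: "(s, x0) \<in> W"
  shows "((\<lambda>s. vdens \<Omega> \<mu> (f (s, x0)) * detv (\<lambda>i. dd f (s, x0) (0, V i))) has_derivative (\<lambda>h. 0)) (at s)"
proof -
  let ?z = "(s, x0)" and ?Z = "Z \<mu> \<circ> chart_inv \<mu>"
  let ?y = "f ?z"
  let ?a = "\<lambda>i. dd f ?z (0, V i)"
  have y: "?y \<in> snd \<mu> ` fst \<mu>" using W(3)[OF z] .
  have lin: "((\<lambda>s. (s, x0)) has_derivative (\<lambda>h. (h, 0))) (at s)"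
    by (auto intro!: derivative_eq_intros)
  have pull: "((\<lambda>s. g (s, x0)) has_derivative (\<lambda>h. h *\<^sub>R dd g ?z (1, 0))) (at s)"
    if "smooth_on W g" for g :: "real \<times> (real ^ 'm) \<Rightarrow> real ^ 'm"
  proof -
    have "dd g ?z (h, 0) = h *\<^sub>R dd g ?z (1, 0)" for h
      using linear_cmul[OF smooth_on_linear_dd[OF that z], of h "(1, 0)"] by simp
    then have "(\<lambda>h. dd g ?z (h, 0)) = (\<lambda>h. h *\<^sub>R dd g ?z (1, 0))" by (rule ext)
    then show ?thesis
      using has_derivative_compose[OF lin smooth_on_imp_has_derivative[OF that z]] by (simp only:)
  qed
  \<comment> \<open>The linearised equation: exchange the time derivative with the derivative in
    direction \<open>V i\<close> and differentiate the ODE in space.\<close>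
  have a_der: "((\<lambda>s. dd f (s, x0) (0, V i)) has_derivative (\<lambda>h. h *\<^sub>R dd ?Z ?y (?a i))) (at s)" for i
  proof -
    have "dd (\<lambda>z. dd f z (0, V i)) ?z (1, 0) = dd (\<lambda>z. dd f z (1, 0)) ?z (0, V i)"
      by (rule dd_dd_commute[OF W(1) z W(2)])
    also have "dd (\<lambda>z. dd f z (1, 0)) ?z = dd (\<lambda>z. ?Z (f z)) ?z"
      using ode by (intro dd_cong_open[OF W(1) z]) simp
    also have "\<dots> = (\<lambda>v. dd ?Z ?y (dd f ?z v))"
      by (rule dd_eqI) (rule has_derivative_compose[OF smooth_on_imp_has_derivative[OF W(2) z] smooth_on_imp_has_derivative[OF Z y]])
    finally have "dd (\<lambda>z. dd f z (0, V i)) ?z (1, 0) = dd ?Z ?y (?a i)" .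
    then show ?thesis using pull[OF smooth_on_dd[OF W(2)], of "(0, V i)"] by simp
  qed
  have \<rho>_der: "((\<lambda>s. vdens \<Omega> \<mu> (f (s, x0))) has_derivative (\<lambda>h. h * dd (vdens \<Omega> \<mu>) ?y (?Z ?y))) (at s)"
  proof -
    have "dd (vdens \<Omega> \<mu>) ?y (h *\<^sub>R ?Z ?y) = h * dd (vdens \<Omega> \<mu>) ?y (?Z ?y)" for h
      using linear_cmul[OF smooth_on_linear_dd[OF smooth_on_vdens[OF \<Omega> \<mu>] y]] by simp
    then show ?thesis
      using has_derivative_compose[OF pull[OF W(2)] smooth_on_imp_has_derivative[OF smooth_on_vdens[OF \<Omega> \<mu>] y]]
        ode[OF z] by simp
  qed
  have det_der: "((\<lambda>s. detv (\<lambda>i. dd f (s, x0) (0, V i))) has_derivative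
      (\<lambda>h. h * (\<Sum>i\<in>UNIV. detv (?a(i := dd ?Z ?y (?a i)))))) (at s)"
  proof -
    have "detv (?a(i := h *\<^sub>R u)) = h * detv (?a(i := u))" for i h u
      using linear_cmul[OF am_linear[OF am_detv, of ?a i]] by simp
    then show ?thesis
      using has_derivative_detv[of "\<lambda>i s. dd f (s, x0) (0, V i)", OF a_der] by (simp add: sum_distrib_left)
  qed
  have "lie_derivative Z \<Omega> \<mu> (chart_inv \<mu> ?y) ?a = 0"
    using lie chart_inv_in[OF \<mu> y] by blast
  then have zero: "dd (vdens \<Omega> \<mu>) ?y (?Z ?y) * detv ?a + vdens \<Omega> \<mu> ?y * (\<Sum>i\<in>UNIV. detv (?a(i := dd ?Z ?y (?a i)))) = 0"
    using lie_derivative_eq[OF \<Omega> \<mu> chart_inv_in[OF \<mu> y], of Z ?a] \<mu> y by simp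
  have "vdens \<Omega> \<mu> ?y * (h * (\<Sum>i\<in>UNIV. detv (?a(i := dd ?Z ?y (?a i))))) + h * dd (vdens \<Omega> \<mu>) ?y (?Z ?y) * detv ?a =
     h * (dd (vdens \<Omega> \<mu>) ?y (?Z ?y) * detv ?a + vdens \<Omega> \<mu> ?y * (\<Sum>i\<in>UNIV. detv (?a(i := dd ?Z ?y (?a i)))))" for h
    by (simp add: algebra_simps)
  then show ?thesis using has_derivative_mult[OF \<rho>_der det_der] unfolding zero by simp
qed

text \<open>A flow line may leave every given chart, so the pull-back is evaluated in whichever
  chart contains \<open>\<Phi> s p\<close>. The value does not depend on that chart and is locally
  constant in \<open>s\<close>, hence constant on the interval of times \<open>s\<close> with
  \<open>(s, p)\<close> in \<open>D\<close>.\<close>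

theorem flow_invariant_if_lie_derivative_zero:
  assumes \<Omega>: "top_form A \<Omega>"
    and Z: "\<And>\<mu>. \<mu> \<in> A \<Longrightarrow> smooth_on (snd \<mu> ` fst \<mu>) (Z \<mu> \<circ> chart_inv \<mu>)"
    and lie: "\<And>\<mu> p V. \<mu> \<in> A \<Longrightarrow> p \<in> fst \<mu> \<Longrightarrow> lie_derivative Z \<Omega> \<mu> p V = 0"
  shows "flow_invariant A Z \<Omega>"
  unfolding flow_invariant_def
proof (intro allI impI, clarify)
  fix D \<Phi> t p \<kappa> \<mu>0 V
  assume fl: "is_flow A Z D \<Phi>" and tp: "(t, p) \<in> D" and \<kappa>: "\<kappa> \<in> A" "p \<in> fst \<kappa>"
    and \<mu>0: "\<mu>0 \<in> A" "\<Phi> t p \<in> fst \<mu>0"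
  define x0 where "x0 = snd \<kappa> p"
  define f where "f \<mu> z = snd \<mu> (\<Phi> (fst z) (chart_inv \<kappa> (snd z)))"
    for \<mu> :: "('a, 'm) chart" and z :: "real \<times> (real ^ 'm)"
  define W where "W \<mu> = {z. snd z \<in> snd \<kappa> ` fst \<kappa> \<and> (fst z, chart_inv \<kappa> (snd z)) \<in> D \<and>
     \<Phi> (fst z) (chart_inv \<kappa> (snd z)) \<in> fst \<mu>}" for \<mu> :: "('a, 'm) chart"
  have D: "open D" "\<And>p. (0, p) \<in> D" "\<And>p. is_interval {t. (t, p) \<in> D}"
    and \<Phi>_cont: "continuous_on D (\<lambda>(t, p). \<Phi> t p)" and \<Phi>0: "\<And>p. \<Phi> 0 p = p"
    using fl by (auto simp: is_flow_def flow_domain_def)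
  have f_smooth: "smooth_on (W \<mu>) (f \<mu>)" if "\<mu> \<in> A" for \<mu>
    using fl \<kappa>(1) that unfolding is_flow_def W_def f_def by (simp add: case_prod_unfold)
  have W_open: "open (W \<mu>)" if \<mu>: "\<mu> \<in> A" for \<mu>
  proof -
    have 1: "open (D \<inter> (\<lambda>(t, p). \<Phi> t p) -` fst \<mu>)"
      using D(1) \<Phi>_cont chart_homeomorphism(1)[OF \<mu>] by (intro continuous_open_preimage) auto
    have 2: "open (UNIV \<times> snd \<kappa> ` fst \<kappa> :: (real \<times> _) set)"
      using chart_homeomorphism(2)[OF \<kappa>(1)] by (intro open_Times) auto
    have "continuous_on (UNIV \<times> snd \<kappa> ` fst \<kappa>) (\<lambda>z :: real \<times> _. (fst z, chart_inv \<kappa> (snd z)))"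
      by (intro continuous_on_Pair continuous_on_fst continuous_on_id
          continuous_on_compose2[OF continuous_on_chart_inv[OF \<kappa>(1)]] continuous_on_snd) auto
    from continuous_open_preimage[OF this 2 1]
    have "open ((UNIV \<times> snd \<kappa> ` fst \<kappa>) \<inter> (\<lambda>z. (fst z, chart_inv \<kappa> (snd z))) -` (D \<inter> (\<lambda>(t, p). \<Phi> t p) -` fst \<mu>))" .
    also have "(UNIV \<times> snd \<kappa> ` fst \<kappa>) \<inter> (\<lambda>z. (fst z, chart_inv \<kappa> (snd z))) -` (D \<inter> (\<lambda>(t, p). \<Phi> t p) -` fst \<mu>) = W \<mu>"
      by (auto simp: W_def)
    finally show ?thesis .
  qed
  have W_x0: "(s, x0) \<in> W \<mu> \<longleftrightarrow> (s, p) \<in> D \<and> \<Phi> s p \<in> fst \<mu>" for s \<mu>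
    using \<kappa> by (simp add: W_def x0_def)
  have ode: "dd (f \<mu>) z (1, 0) = Z \<mu> (chart_inv \<mu> (f \<mu> z))" if \<mu>: "\<mu> \<in> A" and z: "z \<in> W \<mu>" for \<mu> z
  proof -
    obtain s x where sx: "z = (s, x)" by (cases z)
    let ?q = "chart_inv \<kappa> x"
    have q: "(s, ?q) \<in> D" "\<Phi> s ?q \<in> fst \<mu>" using z by (auto simp: W_def sx)
    then have "((\<lambda>s. snd \<mu> (\<Phi> s ?q)) has_vector_derivative Z \<mu> (\<Phi> s ?q)) (at s)"
      using fl \<mu> unfolding is_flow_def by blast
    then have 1: "((\<lambda>s. f \<mu> (s, x)) has_derivative (\<lambda>h. h *\<^sub>R Z \<mu> (\<Phi> s ?q))) (at s)"
      by (simp add: f_def has_vector_derivative_def)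
    have "((\<lambda>s. (s, x)) has_derivative (\<lambda>h. (h, 0))) (at s)"
      by (auto intro!: derivative_eq_intros)
    from has_derivative_compose[OF this smooth_on_imp_has_derivative[OF f_smooth[OF \<mu>] z[unfolded sx]]]
    have "((\<lambda>s. f \<mu> (s, x)) has_derivative (\<lambda>h. dd (f \<mu>) (s, x) (h, 0))) (at s)" .
    from has_derivative_unique[OF this 1] have "dd (f \<mu>) (s, x) (1, 0) = Z \<mu> (\<Phi> s ?q)"
      by (metis scaleR_one)
    then show ?thesis using \<mu> q by (simp add: sx f_def)
  qed
  define E where "E \<mu> s = vdens \<Omega> \<mu> (f \<mu> (s, x0)) * detv (\<lambda>i. dd (f \<mu>) (s, x0) (0, V i))" for \<mu> s
  have slice: "dd (snd \<mu> \<circ> \<Phi> s \<circ> chart_inv \<kappa>) x0 v = dd (f \<mu>) (s, x0) (0, v)"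
    if "\<mu> \<in> A" "(s, x0) \<in> W \<mu>" for \<mu> s v
  proof -
    have "((\<lambda>x. (s, x)) has_derivative (\<lambda>h. (0, h))) (at x0)"
      by (auto intro!: derivative_eq_intros)
    from dd_eqI[OF has_derivative_compose[OF this smooth_on_imp_has_derivative[OF f_smooth[OF that(1)] that(2)]]]
    show ?thesis by (simp add: f_def o_def)
  qed
  have slice_diff: "(snd \<mu> \<circ> \<Phi> s \<circ> chart_inv \<kappa>) differentiable (at x0)"
    if "\<mu> \<in> A" "(s, x0) \<in> W \<mu>" for \<mu> s
  proof -
    have "((\<lambda>x. (s, x)) has_derivative (\<lambda>h. (0, h))) (at x0)"
      by (auto intro!: derivative_eq_intros)
    from has_derivative_compose[OF this smooth_on_imp_has_derivative[OF f_smooth[OF that(1)] that(2)]]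
    show ?thesis by (auto simp: f_def o_def intro: differentiableI)
  qed
  have E_eq: "E \<mu> s = \<Omega> \<mu> (\<Phi> s p) (\<lambda>i. dd (snd \<mu> \<circ> \<Phi> s \<circ> chart_inv \<kappa>) x0 (V i))"
    if "\<mu> \<in> A" "(s, x0) \<in> W \<mu>" for \<mu> s
    using that top_form_eq_vdens[OF \<Omega> that(1), of "\<Phi> s p"] slice[OF that] W_x0[of s \<mu>] \<kappa>
    by (simp add: E_def f_def x0_def)
  have E_chart: "E \<mu> s = E \<nu> s" if \<mu>: "\<mu> \<in> A" "(s, x0) \<in> W \<mu>" and \<nu>: "\<nu> \<in> A" "(s, x0) \<in> W \<nu>" for \<mu> \<nu> s
  proof -
    let ?q = "\<Phi> s p"
    have q: "?q \<in> fst \<mu> \<inter> fst \<nu>" using W_x0 \<mu> \<nu> by auto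
    have y: "(snd \<mu> \<circ> \<Phi> s \<circ> chart_inv \<kappa>) x0 = snd \<mu> ?q" using \<kappa> by (simp add: x0_def)
    have "((snd \<mu> \<circ> \<Phi> s \<circ> chart_inv \<kappa>) has_derivative dd (snd \<mu> \<circ> \<Phi> s \<circ> chart_inv \<kappa>) x0) (at x0)"
      using has_derivative_dd[OF slice_diff[OF \<mu>]] .
    moreover have "(transition \<mu> \<nu> has_derivative (*v) (jacobian \<mu> \<nu> ?q)) (at ((snd \<mu> \<circ> \<Phi> s \<circ> chart_inv \<kappa>) x0))"
      unfolding y using transition_derivative[OF \<mu>(1) \<nu>(1) q] .
    ultimately have "dd (\<lambda>x. transition \<mu> \<nu> ((snd \<mu> \<circ> \<Phi> s \<circ> chart_inv \<kappa>) x)) x0 =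
        (\<lambda>v. jacobian \<mu> \<nu> ?q *v dd (snd \<mu> \<circ> \<Phi> s \<circ> chart_inv \<kappa>) x0 v)"
      by (rule dd_eqI[OF has_derivative_compose])
    moreover have "dd (\<lambda>x. transition \<mu> \<nu> ((snd \<mu> \<circ> \<Phi> s \<circ> chart_inv \<kappa>) x)) x0 = dd (snd \<nu> \<circ> \<Phi> s \<circ> chart_inv \<kappa>) x0"
    proof (rule dd_cong_open)
      show "open ((\<lambda>x. (s, x)) -` (W \<mu> \<inter> W \<nu>))"
        using W_open[OF \<mu>(1)] W_open[OF \<nu>(1)] by (intro open_vimage) (auto intro!: continuous_intros)
      show "x0 \<in> (\<lambda>x. (s, x)) -` (W \<mu> \<inter> W \<nu>)" using \<mu> \<nu> by simp
      fix x assume "x \<in> (\<lambda>x. (s, x)) -` (W \<mu> \<inter> W \<nu>)"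
      then show "transition \<mu> \<nu> ((snd \<mu> \<circ> \<Phi> s \<circ> chart_inv \<kappa>) x) = (snd \<nu> \<circ> \<Phi> s \<circ> chart_inv \<kappa>) x"
        using transition_apply[OF \<mu>(1)] by (simp add: W_def)
    qed
    ultimately have d\<nu>: "dd (snd \<nu> \<circ> \<Phi> s \<circ> chart_inv \<kappa>) x0 =
        (\<lambda>v. jacobian \<mu> \<nu> ?q *v dd (snd \<mu> \<circ> \<Phi> s \<circ> chart_inv \<kappa>) x0 v)"
      by (simp only:)
    have "\<Omega> \<mu> ?q Y = \<Omega> \<nu> ?q (\<lambda>i. jacobian \<mu> \<nu> ?q *v Y i)" for Y
      using \<Omega> \<mu>(1) \<nu>(1) q unfolding top_form_def by fast
    then show ?thesis
      unfolding E_eq[OF \<mu>] E_eq[OF \<nu>] d\<nu> by (simp only:)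
  qed
  define I where "I = {s. (s, p) \<in> D}"
  define \<mu>s where "\<mu>s s = (SOME \<mu>. \<mu> \<in> A \<and> \<Phi> s p \<in> fst \<mu>)" for s
  have \<mu>s: "\<mu>s s \<in> A" "(s, x0) \<in> W (\<mu>s s)" if "s \<in> I" for s
  proof -
    have "\<exists>\<mu>. \<mu> \<in> A \<and> \<Phi> s p \<in> fst \<mu>" using chart_at[of "\<Phi> s p"] by metis
    then have "\<mu>s s \<in> A \<and> \<Phi> s p \<in> fst (\<mu>s s)" unfolding \<mu>s_def by (rule someI_ex)
    then show "\<mu>s s \<in> A" "(s, x0) \<in> W (\<mu>s s)" using that W_x0 by (auto simp: I_def)
  qed
  \<comment> \<open>Near the time \<open>a\<close> the chart chosen at \<open>a\<close> still works:
    there \<open>E\<close> has zero derivative, and \<open>E_chart\<close> compares it with the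
    charts chosen at nearby times.\<close>
  have loc: "\<forall>a\<in>I. eventually (\<lambda>b. E (\<mu>s a) a = E (\<mu>s b) b) (at a within I)"
  proof
    fix a assume a: "a \<in> I"
    let ?\<mu> = "\<mu>s a"
    have "open ((\<lambda>s. (s, x0)) -` W ?\<mu>)"
      using W_open[OF \<mu>s(1)[OF a]] by (intro open_vimage) (auto intro!: continuous_intros)
    then obtain e where e: "e > 0" "ball a e \<subseteq> (\<lambda>s. (s, x0)) -` W ?\<mu>"
      using \<mu>s(2)[OF a] openE by blast
    have der: "(E ?\<mu> has_derivative (\<lambda>h. 0)) (at s within ball a e)" if "s \<in> ball a e" for s
    proof -
      have s: "(s, x0) \<in> W ?\<mu>" using that e by auto
      have "f ?\<mu> z \<in> snd ?\<mu> ` fst ?\<mu>" if "z \<in> W ?\<mu>" for z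
        using that by (auto simp: f_def W_def)
      from flow_pullback_derivative_zero[OF \<Omega> \<mu>s(1)[OF a] Z[OF \<mu>s(1)[OF a]] lie[OF \<mu>s(1)[OF a]]
          W_open[OF \<mu>s(1)[OF a]] f_smooth[OF \<mu>s(1)[OF a]] this ode[OF \<mu>s(1)[OF a]] s, of V]
      show ?thesis unfolding E_def[abs_def] by (rule has_derivative_at_withinI)
    qed
    have const: "E ?\<mu> a = E ?\<mu> b" if "b \<in> ball a e" for b
      by (rule has_derivative_zero_unique[OF convex_ball der _ that]) (use e in auto)
    show "eventually (\<lambda>b. E ?\<mu> a = E (\<mu>s b) b) (at a within I)"
      unfolding eventually_at_topological
    proof (intro exI[of _ "ball a e"] conjI ballI impI)
      fix b assume b: "b \<in> ball a e" "b \<in> I"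
      then have "(b, x0) \<in> W ?\<mu>" using e by auto
      then show "E ?\<mu> a = E (\<mu>s b) b"
        using const[OF b(1)] E_chart[OF \<mu>s(1)[OF a] _ \<mu>s[OF b(2)]] by simp
    qed (use e in auto)
  qed
  have "connected I" using D(3) is_interval_connected by (auto simp: I_def)
  from connected_local_const[OF this, of 0 t "\<lambda>s. E (\<mu>s s) s", OF _ _ loc]
  have "E (\<mu>s 0) 0 = E (\<mu>s t) t" using D(2) tp by (simp add: I_def)
  moreover have W0: "(t, x0) \<in> W \<mu>0" "(0, x0) \<in> W \<kappa>" using W_x0 tp \<mu>0 \<kappa> D(2) \<Phi>0 by auto
  moreover have "0 \<in> I" "t \<in> I" using D(2) tp by (auto simp: I_def)
  ultimately have "E \<kappa> 0 = E \<mu>0 t"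
    using E_chart[OF \<mu>s[OF \<open>t \<in> I\<close>] \<mu>0(1) W0(1)] E_chart[OF \<mu>s[OF \<open>0 \<in> I\<close>] \<kappa>(1) W0(2)] by simp
  moreover have "E \<kappa> 0 = \<Omega> \<kappa> p V"
  proof -
    have "dd (snd \<kappa> \<circ> \<Phi> 0 \<circ> chart_inv \<kappa>) x0 = dd (\<lambda>x. x) x0"
      using \<kappa> chart_homeomorphism(2)[OF \<kappa>(1)] \<Phi>0
      by (intro dd_cong_open[of "snd \<kappa> ` fst \<kappa>"]) (auto simp: x0_def)
    then show ?thesis using E_eq[OF \<kappa>(1) W0(2)] \<Phi>0 by simp
  qed
  ultimately show "\<Omega> \<mu>0 (\<Phi> t p) (\<lambda>i. dd (snd \<mu>0 \<circ> \<Phi> t \<circ> chart_inv \<kappa>) (snd \<kappa> p) (V i)) = \<Omega> \<kappa> p V"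
    using E_eq[OF \<mu>0(1) W0(1)] by (simp add: x0_def)
qed

end

section \<open>The Poisson structure\<close>

text \<open>Contracting with \<open>dF\<close> kills the term whose undifferentiated factor carries
  the contracted index. In the other two, differentiating the identity \<open>dF P = 0\<close> moves
  the derivative from \<open>P\<close> to \<open>dF\<close>; they become a Hessian of
  \<open>F\<close> contracted with two factors \<open>P\<close> and cancel by its symmetry.\<close>

lemma casimir_contracts_jacobiator:
  fixes P :: "'m::finite \<Rightarrow> 'm \<Rightarrow> real ^ 'm \<Rightarrow> real" and F :: "real ^ 'm \<Rightarrow> real"
  assumes S: "open S" "x \<in> S" and P: "\<And>i j. smooth_on S (P i j)"
    and skew: "\<And>i j y. y \<in> S \<Longrightarrow> P i j y = - P j i y" and F: "smooth_on S F"
    and casimir: "\<And>y l. y \<in> S \<Longrightarrow> (\<Sum>i\<in>UNIV. dd F y (axis i 1) * P i l y) = 0"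
  defines "T i j k \<equiv> \<Sum>l\<in>UNIV. P i l x * dd (P j k) x (axis l 1)"
  shows "(\<Sum>i\<in>UNIV. dd F x (axis i 1) * (T i j k + T j k i + T k i j)) = 0"
proof -
  define f where "f i = dd F x (axis i 1)" for i
  define H where "H l i = dd (\<lambda>y. dd F y (axis i 1)) x (axis l 1)" for l i
  define dP where "dP l i j = dd (P i j) x (axis l 1)" for l i j
  have H_sym: "H l i = H i l" for l i
    unfolding H_def by (rule dd_dd_commute[OF S F])
  have diffP: "(P i j has_derivative dd (P i j) x) (at x)" for i j
    using smooth_on_imp_has_derivative[OF P S(2)] .
  have difff: "((\<lambda>y. dd F y (axis i 1)) has_derivative dd (\<lambda>y. dd F y (axis i 1)) x) (at x)" for i
    using smooth_on_imp_has_derivative[OF smooth_on_dd[OF F] S(2)] .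
  have diff_cas: "(\<Sum>i\<in>UNIV. f i * dP l i j) = - (\<Sum>i\<in>UNIV. H l i * P i j x)" for l j
  proof -
    have "((\<lambda>y. \<Sum>i\<in>UNIV. dd F y (axis i 1) * P i j y) has_derivative
        (\<lambda>v. \<Sum>i\<in>UNIV. dd F x (axis i 1) * dd (P i j) x v + dd (\<lambda>y. dd F y (axis i 1)) x v * P i j x)) (at x)"
      by (intro has_derivative_sum has_derivative_mult diffP difff)
    from dd_eqI[OF this]
    have "dd (\<lambda>y. \<Sum>i\<in>UNIV. dd F y (axis i 1) * P i j y) x (axis l 1) = (\<Sum>i\<in>UNIV. f i * dP l i j + H l i * P i j x)"
      by (simp add: f_def dP_def H_def)
    moreover have "dd (\<lambda>y. \<Sum>i\<in>UNIV. dd F y (axis i 1) * P i j y) x = dd (\<lambda>y. 0) x"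
      by (rule dd_cong_open[OF S]) (rule casimir)
    ultimately show ?thesis by (simp add: sum.distrib)
  qed
  have skew_dP: "dP l i j = - dP l j i" for l i j
  proof -
    have "dd (P i j) x = dd (\<lambda>y. - P j i y) x" by (rule dd_cong_open[OF S]) (rule skew)
    also have "\<dots> = (\<lambda>v. - dd (P j i) x v)" by (rule dd_eqI) (rule has_derivative_minus[OF diffP])
    finally show ?thesis by (simp add: dP_def)
  qed
  have 1: "(\<Sum>i\<in>UNIV. f i * T i j k) = 0"
  proof -
    have "(\<Sum>i\<in>UNIV. f i * T i j k) = (\<Sum>i\<in>UNIV. \<Sum>l\<in>UNIV. f i * P i l x * dP l j k)"
      by (simp add: T_def dP_def sum_distrib_left mult.assoc)
    also have "\<dots> = (\<Sum>l\<in>UNIV. \<Sum>i\<in>UNIV. f i * P i l x * dP l j k)" by (rule sum.swap)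
    also have "\<dots> = (\<Sum>l\<in>UNIV. (\<Sum>i\<in>UNIV. f i * P i l x) * dP l j k)" by (simp only: sum_distrib_right)
    finally have "(\<Sum>i\<in>UNIV. f i * T i j k) = (\<Sum>l\<in>UNIV. (\<Sum>i\<in>UNIV. f i * P i l x) * dP l j k)" .
    then show ?thesis using casimir[OF S(2)] by (simp add: f_def)
  qed
  have pull: "(\<Sum>i\<in>UNIV. f i * (\<Sum>l\<in>UNIV. P a l x * dP l i b)) = - (\<Sum>l\<in>UNIV. \<Sum>i\<in>UNIV. H l i * (P a l x * P i b x))" for a b
  proof -
    have "(\<Sum>i\<in>UNIV. f i * (\<Sum>l\<in>UNIV. P a l x * dP l i b)) = (\<Sum>i\<in>UNIV. \<Sum>l\<in>UNIV. P a l x * (f i * dP l i b))"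
      by (simp add: sum_distrib_left mult_ac)
    also have "\<dots> = (\<Sum>l\<in>UNIV. \<Sum>i\<in>UNIV. P a l x * (f i * dP l i b))" by (rule sum.swap)
    also have "\<dots> = (\<Sum>l\<in>UNIV. P a l x * - (\<Sum>i\<in>UNIV. H l i * P i b x))"
      by (simp only: sum_distrib_left[symmetric] diff_cas)
    finally show ?thesis by (simp add: sum_distrib_left sum_negf mult_ac)
  qed
  have 3: "(\<Sum>i\<in>UNIV. f i * T k i j) = - (\<Sum>l\<in>UNIV. \<Sum>i\<in>UNIV. H l i * (P k l x * P i j x))"
    using pull[of k j] by (simp add: T_def dP_def)
  have 2: "(\<Sum>i\<in>UNIV. f i * T j k i) = (\<Sum>l\<in>UNIV. \<Sum>i\<in>UNIV. H l i * (P j l x * P i k x))"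
  proof -
    have "T j k i = - (\<Sum>l\<in>UNIV. P j l x * dP l i k)" for i
    proof -
      have "T j k i = (\<Sum>l\<in>UNIV. P j l x * dP l k i)" by (simp add: T_def dP_def)
      also have "\<dots> = (\<Sum>l\<in>UNIV. - (P j l x * dP l i k))"
        by (rule sum.cong[OF refl]) (simp add: skew_dP[of _ k])
      finally show ?thesis by (simp add: sum_negf)
    qed
    then show ?thesis using pull[of j k] by (simp add: sum_negf)
  qed
  have "(\<Sum>l\<in>UNIV. \<Sum>i\<in>UNIV. H l i * (P j l x * P i k x)) = (\<Sum>l\<in>UNIV. \<Sum>i\<in>UNIV. H l i * (P k l x * P i j x))"
  proof -
    have "(\<Sum>l\<in>UNIV. \<Sum>i\<in>UNIV. H l i * (P j l x * P i k x)) = (\<Sum>i\<in>UNIV. \<Sum>l\<in>UNIV. H l i * (P j l x * P i k x))"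
      by (rule sum.swap)
    also have "\<dots> = (\<Sum>i\<in>UNIV. \<Sum>l\<in>UNIV. H i l * (P k i x * P l j x))"
    proof (intro sum.cong refl)
      fix i l show "H l i * (P j l x * P i k x) = H i l * (P k i x * P l j x)"
        using H_sym[of l i] skew[OF S(2), of j l] skew[OF S(2), of i k] by simp
    qed
    finally show ?thesis .
  qed
  then show ?thesis using 1 2 3 by (simp add: distrib_left sum.distrib f_def)
qed

context two_slots
begin

text \<open>A trivector annihilated by \<open>m - 2\<close> independent covectors comes from a space
  of dimension two, where every trivector is zero.\<close>

lemma trivector_zero:
  fixes J :: "'m \<Rightarrow> 'm \<Rightarrow> 'm \<Rightarrow> real"
  assumes cyclic: "\<And>i j k. J i j k = J j k i" and alt: "\<And>i j. J i j j = 0"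
    and rows: "\<And>k j l. k \<noteq> r0 \<Longrightarrow> k \<noteq> r1 \<Longrightarrow> (\<Sum>i\<in>UNIV. K k $ i * J i j l) = 0"
    and nz: "bv K \<noteq> 0"
  shows "J i j l = 0"
proof -
  obtain a b where ab: "detv (rows2 K (axis a 1) (axis b 1)) \<noteq> 0" using nz by (auto simp: vec_eq_iff bv_def)
  \<comment> \<open>In the basis made of \<open>axis a 1\<close>, \<open>axis b 1\<close> and the
    rows, the rows contribute nothing, so an index may be replaced by \<open>a\<close> or
    \<open>b\<close>; among three indices with two values, two coincide.\<close>
  have reduce: "J i j l = 0" if "J a j l = 0" "J b j l = 0" for i j l
  proof -
    have "(\<chi> i. J i j l) = 0"
    proof (rule detv_nonzero_orthogonal_zero[OF ab])
      fix k show "rows2 K (axis a 1) (axis b 1) k \<bullet> (\<chi> i. J i j l) = 0"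
        using rows[of k j l] that by (cases k rule: slot_cases) (auto simp: inner_axis', simp add: inner_vec_def)
    qed
    then show ?thesis by (simp add: vec_eq_iff)
  qed
  have ba: "J i b a = 0" for i by (rule reduce) (metis cyclic alt)+
  have ab': "J i a b = 0" for i by (rule reduce) (metis cyclic alt)+
  have lb: "J i l b = 0" for i l by (rule reduce) (metis cyclic alt ba)+
  have la: "J i l a = 0" for i l by (rule reduce) (metis cyclic alt ab')+
  show ?thesis by (rule reduce) (metis cyclic la lb)+
qed

end

text \<open>The first integrals are indexed by the coordinate indices other than \<open>r0\<close>
  and \<open>r1\<close>, ready to be rows of a square array; \<open>C r0\<close> and
  \<open>C r1\<close> are placeholders about which nothing is assumed.\<close>

locale integrable_field = atlas A + two_slots r0 r1
  for A :: "('a::topological_space, 'm::finite) chart set" and r0 r1 :: 'm +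
  fixes X :: "('a, 'm) vfield" and C :: "'m \<Rightarrow> 'a \<Rightarrow> real" and \<Omega> :: "('a, 'm) topform"
  assumes X_field: "vector_field A X"
    and C_smooth: "k \<noteq> r0 \<Longrightarrow> k \<noteq> r1 \<Longrightarrow> smooth_fun_on A UNIV (C k)"
    and C_integral: "k \<noteq> r0 \<Longrightarrow> k \<noteq> r1 \<Longrightarrow> first_integral A X (C k)"
    and volume: "volume_form A \<Omega>"
    and invariant: "invariant_form A X \<Omega>"
begin

definition covectors :: "('a, 'm) chart \<Rightarrow> 'a \<Rightarrow> 'm \<Rightarrow> real ^ 'm" where
  "covectors \<kappa> p k = differential \<kappa> (C k) p"

definition bivector :: "('a, 'm) bivfield" where
  "bivector \<kappa> p = (1 / vdens \<Omega> \<kappa> (snd \<kappa> p)) *\<^sub>R bv (covectors \<kappa> p)"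

definition regular :: "'a set" where
  "regular = {p. \<forall>\<kappa>\<in>A. p \<in> fst \<kappa> \<longrightarrow> independent_rows (covectors \<kappa> p)}"

lemma volume_top_form: "top_form A \<Omega>" using volume by (simp add: volume_form_def)

lemma covectors_grad: "covectors \<kappa> p = (\<lambda>k. grad (C k \<circ> chart_inv \<kappa>) (snd \<kappa> p))"
  by (simp add: covectors_def fun_eq_iff differential_eq_grad)

lemma smooth_on_C_chart:
  "\<kappa> \<in> A \<Longrightarrow> k \<noteq> r0 \<Longrightarrow> k \<noteq> r1 \<Longrightarrow> smooth_on (snd \<kappa> ` fst \<kappa>) (C k \<circ> chart_inv \<kappa>)"
  using smooth_fun_onD[OF C_smooth] by simp

lemma smooth_on_chart_fun:
  "\<kappa> \<in> A \<Longrightarrow> smooth_fun_on A UNIV h \<Longrightarrow> smooth_on (snd \<kappa> ` fst \<kappa>) (h \<circ> chart_inv \<kappa>)"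
  using smooth_fun_onD[of UNIV h \<kappa>] by simp

lemma vdens_chart_nonzero: "\<kappa> \<in> A \<Longrightarrow> x \<in> snd \<kappa> ` fst \<kappa> \<Longrightarrow> vdens \<Omega> \<kappa> x \<noteq> 0"
  using vdens_nonzero[OF volume, of \<kappa> "chart_inv \<kappa> x"] chart_inv_in[of \<kappa> x] by simp

lemma bivector_chart:
  "\<kappa> \<in> A \<Longrightarrow> x \<in> snd \<kappa> ` fst \<kappa> \<Longrightarrow>
    bivector \<kappa> (chart_inv \<kappa> x) = (1 / vdens \<Omega> \<kappa> x) *\<^sub>R bv (\<lambda>k. grad (C k \<circ> chart_inv \<kappa>) x)"
  by (simp add: bivector_def covectors_grad)

lemma smooth_on_bivector_nth:
  assumes \<kappa>: "\<kappa> \<in> A"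
  shows "smooth_on (snd \<kappa> ` fst \<kappa>) (\<lambda>x. bivector \<kappa> (chart_inv \<kappa> x) $ i $ j)"
proof -
  note op = chart_homeomorphism(2)[OF \<kappa>]
  have "smooth_on (snd \<kappa> ` fst \<kappa>) (\<lambda>x. bv (\<lambda>k. grad (C k \<circ> chart_inv \<kappa>) x) $ i $ j / vdens \<Omega> \<kappa> x)"
    by (intro smooth_on_divide op smooth_on_bv_nth[OF op smooth_on_C_chart[OF \<kappa>]]
        smooth_on_vdens[OF volume_top_form \<kappa>] vdens_chart_nonzero[OF \<kappa>])
  then show ?thesis
    by (rule smooth_on_cong[OF op, THEN iffD1, rotated]) (simp add: bivector_chart[OF \<kappa>])
qed

lemma bivector_transform:
  assumes "\<kappa> \<in> A" "\<mu> \<in> A" "p \<in> fst \<kappa> \<inter> fst \<mu>"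
  shows "bivector \<mu> p = jacobian \<kappa> \<mu> p ** bivector \<kappa> p ** transpose (jacobian \<kappa> \<mu> p)"
proof -
  let ?J = "jacobian \<kappa> \<mu> p"
  have "covectors \<kappa> p k = transpose ?J *v covectors \<mu> p k" if "k \<noteq> r0" "k \<noteq> r1" for k
    unfolding covectors_def using differential_transform[OF C_smooth[OF that] assms(1,2)] assms(3) by simp
  then have "?J ** bv (covectors \<kappa> p) ** transpose ?J = det ?J *\<^sub>R bv (covectors \<mu> p)"
    by (rule bv_transform)
  then have "?J ** bivector \<kappa> p ** transpose ?J = (1 / vdens \<Omega> \<kappa> (snd \<kappa> p)) *\<^sub>R (det ?J *\<^sub>R bv (covectors \<mu> p))"
    by (simp add: bivector_def matrix_scalar_ac flip: scalar_matrix_assoc)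
  also have "\<dots> = bivector \<mu> p"
    using det_jacobian_nonzero[OF assms] vdens_nonzero[OF volume, of \<mu> p] assms
    by (simp add: bivector_def vdens_transform[OF volume_top_form assms])
  finally show ?thesis by simp
qed

lemma bivector_skew_nth: "bivector \<kappa> p $ i $ j = - bivector \<kappa> p $ j $ i"
  unfolding bivector_def using bv_skew[of "covectors \<kappa> p" i j] by simp

lemma bivector_skew: "transpose (bivector \<kappa> p) = - bivector \<kappa> p"
  by (simp add: vec_eq_iff transpose_def) (intro allI bivector_skew_nth)

lemma bivector_field: "bivector_field A bivector"
  unfolding bivector_field_def
proof (intro conjI ballI)
  fix \<kappa> assume \<kappa>: "\<kappa> \<in> A"
  show "smooth_on (snd \<kappa> ` fst \<kappa>) (bivector \<kappa> \<circ> chart_inv \<kappa>)"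
    using smooth_on_bivector_nth[OF \<kappa>]
    by (intro smooth_on_vec chart_homeomorphism(2)[OF \<kappa>]) (simp add: o_def)
qed (simp_all add: bivector_skew bivector_transform[symmetric])

lemma bivector_zero_iff:
  assumes "\<kappa> \<in> A" "p \<in> fst \<kappa>"
  shows "bivector \<kappa> p = 0 \<longleftrightarrow> bv (covectors \<kappa> p) = 0"
  using vdens_nonzero[OF volume assms] by (simp add: bivector_def)

text \<open>Vanishing of the bivector does not depend on the chart, so a single chart decides
  although \<open>regular\<close> quantifies over all of them.\<close>

lemma regular_iff:
  assumes \<kappa>: "\<kappa> \<in> A" "p \<in> fst \<kappa>"
  shows "p \<in> regular \<longleftrightarrow> bv (covectors \<kappa> p) \<noteq> 0"
proof
  assume "p \<in> regular"
  then show "bv (covectors \<kappa> p) \<noteq> 0" using \<kappa> independent_rows_bv_nonzero by (auto simp: regular_def)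
next
  assume nz: "bv (covectors \<kappa> p) \<noteq> 0"
  show "p \<in> regular"
    unfolding regular_def
  proof (intro CollectI ballI impI)
    fix \<mu> assume \<mu>: "\<mu> \<in> A" "p \<in> fst \<mu>"
    have "bivector \<mu> p \<noteq> 0"
    proof
      assume "bivector \<mu> p = 0"
      then have "bivector \<kappa> p = 0"
        using bivector_transform[OF \<mu>(1) \<kappa>(1), of p] \<kappa> \<mu>
        by (simp add: matrix_matrix_mult_def vec_eq_iff)
      then show False using nz bivector_zero_iff[OF \<kappa>] by simp
    qed
    then show "independent_rows (covectors \<mu> p)"
      using bivector_zero_iff[OF \<mu>] dependent_rows_bv_zero by auto
  qed
qed

lemma open_regular: "open regular"
proof (subst open_subopen, intro ballI)
  fix p assume p: "p \<in> regular"
  obtain \<kappa> where \<kappa>: "\<kappa> \<in> A" "p \<in> fst \<kappa>" using chart_at by blast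
  obtain i j where ij: "bivector \<kappa> p $ i $ j \<noteq> 0"
    using p regular_iff[OF \<kappa>] bivector_zero_iff[OF \<kappa>] by (auto simp: vec_eq_iff)
  define T where "T = snd \<kappa> ` fst \<kappa> \<inter> (\<lambda>x. bivector \<kappa> (chart_inv \<kappa> x) $ i $ j) -` (-{0})"
  have "open T" unfolding T_def
    using smooth_on_imp_continuous_on[OF smooth_on_bivector_nth[OF \<kappa>(1)]] chart_homeomorphism(2)[OF \<kappa>(1)]
    by (intro continuous_open_preimage) auto
  then have "open (fst \<kappa> \<inter> snd \<kappa> -` T)" by (rule open_chart_preimage[OF \<kappa>(1)])
  moreover have "p \<in> fst \<kappa> \<inter> snd \<kappa> -` T" using \<kappa> ij by (auto simp: T_def)
  moreover have "fst \<kappa> \<inter> snd \<kappa> -` T \<subseteq> regular"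
  proof
    fix q assume "q \<in> fst \<kappa> \<inter> snd \<kappa> -` T"
    then have q: "q \<in> fst \<kappa>" and "snd \<kappa> q \<in> T" by auto
    then have "bivector \<kappa> (chart_inv \<kappa> (snd \<kappa> q)) $ i $ j \<noteq> 0" unfolding T_def by blast
    then have "bivector \<kappa> q $ i $ j \<noteq> 0" using \<kappa>(1) q by simp
    then have "bivector \<kappa> q \<noteq> 0" by auto
    then show "q \<in> regular" using regular_iff[OF \<kappa>(1) q] bivector_zero_iff[OF \<kappa>(1) q] by simp
  qed
  ultimately show "\<exists>T. open T \<and> p \<in> T \<and> T \<subseteq> regular" by blast
qed

lemma sharp_bivector: "sharp (bivector \<kappa> p) \<alpha> = (1 / vdens \<Omega> \<kappa> (snd \<kappa> p)) *\<^sub>R sharp (bv (covectors \<kappa> p)) \<alpha>"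
  by (simp add: bivector_def sharp_def vec_eq_iff vector_matrix_mult_def sum_distrib_left mult_ac sum_divide_distrib)

lemma rank_regular: "p \<in> regular \<Longrightarrow> has_rank_at A bivector p 2"
  unfolding has_rank_at_def
proof (intro ballI impI)
  fix \<kappa> assume p: "p \<in> regular" and \<kappa>: "\<kappa> \<in> A" "p \<in> fst \<kappa>"
  show "dim (range (sharp (bivector \<kappa> p))) = 2"
    unfolding bivector_def using p regular_iff[OF \<kappa>] vdens_nonzero[OF volume \<kappa>]
    by (intro dim_range_sharp_bv) auto
qed

lemma rank_singular: "p \<in> - regular \<Longrightarrow> has_rank_at A bivector p 0"
  unfolding has_rank_at_def
proof (intro ballI impI)
  fix \<kappa> assume p: "p \<in> - regular" and \<kappa>: "\<kappa> \<in> A" "p \<in> fst \<kappa>"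
  then have "bivector \<kappa> p = 0" using regular_iff[OF \<kappa>] bivector_zero_iff[OF \<kappa>] by simp
  then have "range (sharp (bivector \<kappa> p)) = {0}" by (auto simp: sharp_def vector_matrix_mult_def vec_eq_iff)
  then show "dim (range (sharp (bivector \<kappa> p))) = 0" by simp
qed

lemma casimir_C:
  assumes "k \<noteq> r0" "k \<noteq> r1"
  shows "casimir A bivector (C k)"
  unfolding casimir_def hamiltonian_vf_def sharp_bivector
  using C_smooth[OF assms] sharp_bv_row[OF assms, of "covectors _ _"] by (simp add: covectors_def)

text \<open>Non-vanishing of \<open>G\<close> is an open condition in the chart, so it would already
  occur at a point of the dense set.\<close>

lemma zero_by_density:
  assumes \<kappa>: "\<kappa> \<in> A" and dense: "closure regular = UNIV"
    and G: "continuous_on (snd \<kappa> ` fst \<kappa>) G" and zero: "\<And>p. p \<in> fst \<kappa> \<inter> regular \<Longrightarrow> G (snd \<kappa> p) = (0::real)"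
    and p: "p \<in> fst \<kappa>"
  shows "G (snd \<kappa> p) = 0"
proof (rule ccontr)
  assume nz: "G (snd \<kappa> p) \<noteq> 0"
  let ?T = "snd \<kappa> ` fst \<kappa> \<inter> G -` (-{0})"
  have "open ?T" using G chart_homeomorphism(2)[OF \<kappa>] by (intro continuous_open_preimage) auto
  then have "open (fst \<kappa> \<inter> snd \<kappa> -` ?T)" by (rule open_chart_preimage[OF \<kappa>])
  moreover have "p \<in> fst \<kappa> \<inter> snd \<kappa> -` ?T" using p nz by auto
  ultimately have "regular \<inter> (fst \<kappa> \<inter> snd \<kappa> -` ?T) \<noteq> {}"
    using dense open_Int_closure_eq_empty[of "fst \<kappa> \<inter> snd \<kappa> -` ?T" regular] by blast
  then show False using zero by auto
qed

theorem poisson_structure_bivector: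
  assumes dense: "closure regular = UNIV"
  shows "poisson_structure A bivector"
  unfolding poisson_structure_def
proof (intro conjI ballI allI bivector_field)
  fix \<kappa> p i j k assume \<kappa>: "\<kappa> \<in> A" "p \<in> fst \<kappa>"
  let ?S = "snd \<kappa> ` fst \<kappa>"
  note op = chart_homeomorphism(2)[OF \<kappa>(1)]
  define P where "P i j x = bivector \<kappa> (chart_inv \<kappa> x) $ i $ j" for i j x
  have P: "smooth_on ?S (P i j)" for i j
    unfolding P_def by (rule smooth_on_bivector_nth[OF \<kappa>(1)])
  \<comment> \<open>Half of \<open>schouten_term\<close> for equal arguments, whose two summands
    coincide.\<close>
  define T where "T x i j k = (\<Sum>l\<in>UNIV. P i l x * dd (P j k) x (axis l 1))" for x i j k
  define J where "J x i j k = T x i j k + T x j k i + T x k i j" for x i j k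
  have J_cont: "continuous_on ?S (\<lambda>x. J x i j k)" for i j k
    unfolding J_def T_def
    by (intro continuous_on_add continuous_on_sum continuous_on_mult smooth_on_imp_continuous_on P smooth_on_dd)
  have skew: "P i j x = - P j i x" for i j x
    unfolding P_def by (rule bivector_skew_nth)
  have J_zero: "J (snd \<kappa> q) i j k = 0" if q: "q \<in> fst \<kappa> \<inter> regular" for q i j k
  proof (rule trivector_zero[of "J (snd \<kappa> q)" "covectors \<kappa> q"])
    fix i j k show "J (snd \<kappa> q) i j k = J (snd \<kappa> q) j k i" by (simp add: J_def)
  next
    fix i j
    have sk: "dd (P a b) (snd \<kappa> q) v = - dd (P b a) (snd \<kappa> q) v" for a b v
    proof -
      have "dd (P a b) (snd \<kappa> q) = dd (\<lambda>y. - P b a y) (snd \<kappa> q)"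
        by (rule dd_cong_open[OF open_UNIV]) (rule UNIV_I, rule skew)
      also have "\<dots> = (\<lambda>v. - dd (P b a) (snd \<kappa> q) v)"
        using q by (intro dd_eqI has_derivative_minus smooth_on_imp_has_derivative[OF P]) auto
      finally show ?thesis by simp
    qed
    \<comment> \<open>With the last two indices equal, one cyclic term vanishes and the other two
      cancel, all by skewness of \<open>P\<close>.\<close>
    have "T (snd \<kappa> q) i j j = 0" unfolding T_def
      using sk[of j j] by (intro sum.neutral) auto
    moreover have "T (snd \<kappa> q) j i j = - T (snd \<kappa> q) j j i"
      unfolding T_def sum_negf[symmetric] by (rule sum.cong[OF refl]) (simp add: sk[of i j])
    ultimately show "J (snd \<kappa> q) i j j = 0" by (simp add: J_def)
  next
    fix k j l assume k: "k \<noteq> r0" "k \<noteq> r1"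
    have "(\<Sum>i\<in>UNIV. dd (C k \<circ> chart_inv \<kappa>) (snd \<kappa> q) (axis i 1) *
        (T (snd \<kappa> q) i j l + T (snd \<kappa> q) j l i + T (snd \<kappa> q) l i j)) = 0"
      unfolding T_def
    proof (rule casimir_contracts_jacobiator[OF op _ P skew smooth_on_C_chart[OF \<kappa>(1) k]])
      fix y l assume y: "y \<in> ?S"
      have "sharp (bivector \<kappa> (chart_inv \<kappa> y)) (covectors \<kappa> (chart_inv \<kappa> y) k) = 0"
        unfolding sharp_bivector by (simp add: sharp_bv_row[OF k])
      then have "(\<Sum>i\<in>UNIV. P i l y * covectors \<kappa> (chart_inv \<kappa> y) k $ i) = 0"
        by (simp add: sharp_def vector_matrix_mult_def vec_eq_iff P_def mult.commute)
      then show "(\<Sum>i\<in>UNIV. dd (C k \<circ> chart_inv \<kappa>) y (axis i 1) * P i l y) = 0"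
        using y \<kappa>(1) by (simp add: covectors_grad grad_def mult.commute)
    qed (use q in auto)
    then show "(\<Sum>i\<in>UNIV. covectors \<kappa> q k $ i * J (snd \<kappa> q) i j l) = 0"
      by (simp add: covectors_grad grad_def J_def)
  next
    show "bv (covectors \<kappa> q) \<noteq> 0" using q regular_iff[OF \<kappa>(1)] by blast
  qed
  have J0: "J (snd \<kappa> p) i j k = 0" for i j k
    by (rule zero_by_density[OF \<kappa>(1) dense J_cont J_zero \<kappa>(2)])
  have "schouten_term bivector bivector \<kappa> p i j k = 2 * T (snd \<kappa> p) i j k" for i j k
  proof -
    have "partial_component bivector \<kappa> p l j k = dd (P j k) (snd \<kappa> p) (axis l 1)" for l j k
      by (simp add: partial_component_def differential_def P_def[abs_def] o_def)
    then show ?thesis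
      using \<kappa> by (simp add: schouten_term_def T_def P_def sum_distrib_left)
  qed
  then show "schouten_bracket bivector bivector \<kappa> p i j k = 0"
    using J0[of i j k] by (simp add: schouten_bracket_def J_def)
qed

text \<open>The density cancels the denominator in \<open>bivector\<close>, which leaves the field
  treated by \<open>divergence_sharp_bv\<close>.\<close>

lemma divergence_hamiltonian:
  assumes h: "smooth_on S (h \<circ> chart_inv \<kappa>)" and \<kappa>: "\<kappa> \<in> A" and S: "open S" "S \<subseteq> snd \<kappa> ` fst \<kappa>" "x \<in> S"
  shows "(\<Sum>j\<in>UNIV. dd (\<lambda>x. vdens \<Omega> \<kappa> x * hamiltonian_vf bivector h \<kappa> (chart_inv \<kappa> x) $ j) x (axis j 1)) = 0"
proof -
  have "dd (\<lambda>x. vdens \<Omega> \<kappa> x * hamiltonian_vf bivector h \<kappa> (chart_inv \<kappa> x) $ j) x =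
      dd (\<lambda>x. sharp (bv (\<lambda>k. grad (C k \<circ> chart_inv \<kappa>) x)) (grad (h \<circ> chart_inv \<kappa>) x) $ j) x" for j
  proof (rule dd_cong_open[OF S(1,3)])
    fix y assume "y \<in> S"
    then have y: "y \<in> snd \<kappa> ` fst \<kappa>" using S by blast
    then show "vdens \<Omega> \<kappa> y * hamiltonian_vf bivector h \<kappa> (chart_inv \<kappa> y) $ j =
        sharp (bv (\<lambda>k. grad (C k \<circ> chart_inv \<kappa>) y)) (grad (h \<circ> chart_inv \<kappa>) y) $ j"
      using \<kappa> vdens_chart_nonzero[OF \<kappa> y]
      by (simp add: hamiltonian_vf_def sharp_bivector covectors_grad differential_eq_grad)
  qed
  then show ?thesis
    using divergence_sharp_bv[OF S(1,3) smooth_on_subset[OF smooth_on_C_chart[OF \<kappa>] S(2)] h] by simp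
qed

text \<open>The form preserved by all Hamiltonian flows is the same \<open>\<Omega>\<close> whose
  density enters \<open>bivector\<close>.\<close>

theorem unimodular_bivector: "unimodular A bivector"
  unfolding unimodular_def
proof (intro exI[of _ \<Omega>] conjI volume allI impI)
  fix h assume h: "smooth_fun_on A UNIV h"
  have Z: "smooth_on (snd \<mu> ` fst \<mu>) (hamiltonian_vf bivector h \<mu> \<circ> chart_inv \<mu>)" if \<mu>: "\<mu> \<in> A" for \<mu>
  proof (rule smooth_on_vec[OF chart_homeomorphism(2)[OF \<mu>]])
    fix j
    have "smooth_on (snd \<mu> ` fst \<mu>) (\<lambda>x. \<Sum>i\<in>UNIV. bivector \<mu> (chart_inv \<mu> x) $ i $ j * grad (h \<circ> chart_inv \<mu>) x $ i)"
      by (intro smooth_on_sum smooth_on_mult smooth_on_bivector_nth smooth_on_vec_nth smooth_on_grad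
          smooth_on_chart_fun chart_homeomorphism(2) \<mu> h)
    then show "smooth_on (snd \<mu> ` fst \<mu>) (\<lambda>x. (hamiltonian_vf bivector h \<mu> \<circ> chart_inv \<mu>) x $ j)"
      by (rule smooth_on_cong[OF chart_homeomorphism(2)[OF \<mu>], THEN iffD1, rotated])
        (use \<mu> in \<open>auto simp: hamiltonian_vf_def sharp_def vector_matrix_mult_def differential_eq_grad mult.commute\<close>)
  qed
  show "flow_invariant A (hamiltonian_vf bivector h) \<Omega>"
  proof (rule flow_invariant_if_lie_derivative_zero[OF volume_top_form Z])
    fix \<mu> p V assume \<mu>: "\<mu> \<in> A" "p \<in> fst \<mu>"
    show "lie_derivative (hamiltonian_vf bivector h) \<Omega> \<mu> p V = 0"
      using lie_derivative_divergence[where Z = "hamiltonian_vf bivector h", OF volume_top_form \<mu> Z[OF \<mu>(1)], of V]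
        divergence_hamiltonian[OF smooth_on_chart_fun[OF \<mu>(1) h] \<mu>(1) chart_homeomorphism(2)[OF \<mu>(1)]] \<mu>
      by simp
  qed
qed

end

section \<open>Functions constant on the leaves of a foliation box\<close>

context two_slots
begin

definition same_leaf :: "real ^ 'm \<Rightarrow> real ^ 'm \<Rightarrow> bool" where
  "same_leaf y z \<longleftrightarrow> (\<forall>k. k \<noteq> r0 \<longrightarrow> k \<noteq> r1 \<longrightarrow> y $ k = z $ k)"

text \<open>On the segment from \<open>y\<close> to \<open>z\<close>, which stays in the convex
  ball, only the slots \<open>r0\<close> and \<open>r1\<close> vary, so the derivative of
  \<open>\<theta>\<close> maps its direction into the common kernel of the
  \<open>grad (F k)\<close>; there \<open>grad u\<close> vanishes by
  \<open>inner_tangent_zero\<close>.\<close>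

lemma casimir_constant_on_plaques:
  fixes F :: "'m \<Rightarrow> real ^ 'm \<Rightarrow> real"
  assumes V: "open V" "homeomorphism V (ball c r) \<psi> \<theta>" and \<theta>: "smooth_on (ball c r) \<theta>"
    and F: "\<And>k. k \<noteq> r0 \<Longrightarrow> k \<noteq> r1 \<Longrightarrow> smooth_on V (F k)"
    and \<psi>F: "\<And>x k. x \<in> V \<Longrightarrow> k \<noteq> r0 \<Longrightarrow> k \<noteq> r1 \<Longrightarrow> \<psi> x $ k = F k x"
    and u: "smooth_on V u" and nz: "\<And>x. x \<in> V \<Longrightarrow> bv (\<lambda>k. grad (F k) x) \<noteq> 0"
    and cas: "\<And>x. x \<in> V \<Longrightarrow> sharp (bv (\<lambda>k. grad (F k) x)) (grad u x) = 0"
    and yz: "y \<in> ball c r" "z \<in> ball c r" "same_leaf y z"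
  shows "u (\<theta> y) = u (\<theta> z)"
proof -
  have \<theta>V: "\<theta> w \<in> V" "\<psi> (\<theta> w) = w" if "w \<in> ball c r" for w
    using V(2) that by (auto simp: homeomorphism_def)
  define e where "e = z - y"
  have e: "e $ k = 0" if "k \<noteq> r0" "k \<noteq> r1" for k using yz(3) that by (simp add: e_def same_leaf_def)
  have line: "y + s *\<^sub>R e \<in> ball c r" if "s \<in> {0..1}" for s
  proof -
    have "y + s *\<^sub>R e = (1 - s) *\<^sub>R y + s *\<^sub>R z" by (simp add: e_def algebra_simps)
    then show ?thesis using convexD_alt[OF convex_ball yz(1,2), of s] that by simp
  qed
  have zero: "dd (\<lambda>y. u (\<theta> y)) w e = 0" if w: "w \<in> ball c r" for w
  proof -
    let ?E = "dd \<theta> w e"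
    have chain: "dd (\<lambda>y. f (\<theta> y)) w v = dd f (\<theta> w) (dd \<theta> w v)" if "smooth_on V f" for f :: "real ^ 'm \<Rightarrow> real" and v
      using dd_eqI[OF has_derivative_compose[OF smooth_on_imp_has_derivative[OF \<theta> w]
            smooth_on_imp_has_derivative[OF that \<theta>V(1)[OF w]]]] by simp
    have "grad (F k) (\<theta> w) \<bullet> ?E = 0" if k: "k \<noteq> r0" "k \<noteq> r1" for k
    proof -
      have "grad (F k) (\<theta> w) \<bullet> ?E = dd (\<lambda>y. F k (\<theta> y)) w e"
        using chain[OF F[OF k]] grad_inner[OF smooth_on_imp_differentiable[OF F[OF k] \<theta>V(1)[OF w]]] by simp
      also have "dd (\<lambda>y. F k (\<theta> y)) w = dd (\<lambda>y. y $ k) w"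
        using \<theta>V \<psi>F k by (intro dd_cong_open[OF open_ball w]) metis
      also have "dd (\<lambda>y. y $ k) w = (\<lambda>v. v $ k)"
        by (rule dd_eqI) (rule bounded_linear_imp_has_derivative[OF bounded_linear_vec_nth])
      finally show ?thesis using e[OF k] by simp
    qed
    then have "grad u (\<theta> w) \<bullet> ?E = 0"
      by (rule inner_tangent_zero[OF _ nz[OF \<theta>V(1)[OF w]] cas[OF \<theta>V(1)[OF w]]])
    then show ?thesis
      using chain[OF u] grad_inner[OF smooth_on_imp_differentiable[OF u \<theta>V(1)[OF w]]] by simp
  qed
  have comp: "smooth_on (ball c r) (\<lambda>y. u (\<theta> y))"
    using \<theta>V by (intro smooth_on_compose[OF open_ball V(1) \<theta> u]) auto
  have "((\<lambda>s. u (\<theta> (y + s *\<^sub>R e))) has_derivative (\<lambda>h. 0)) (at s within {0..1})" if s: "s \<in> {0..1}" for s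
  proof -
    have "((\<lambda>s. y + s *\<^sub>R e) has_derivative (\<lambda>h. h *\<^sub>R e)) (at s)"
      by (auto intro!: derivative_eq_intros)
    from has_derivative_compose[OF this smooth_on_imp_has_derivative[OF comp line[OF s]]]
    have "((\<lambda>s. u (\<theta> (y + s *\<^sub>R e))) has_derivative (\<lambda>h. dd (\<lambda>y. u (\<theta> y)) (y + s *\<^sub>R e) (h *\<^sub>R e))) (at s)" .
    moreover have "dd (\<lambda>y. u (\<theta> y)) (y + s *\<^sub>R e) (h *\<^sub>R e) = 0" for h
      using zero[OF line[OF s]] linear_cmul[OF smooth_on_linear_dd[OF comp line[OF s]]] by simp
    ultimately show ?thesis by (simp add: has_derivative_at_withinI)
  qed
  from has_derivative_zero_unique[OF _ this, of 0 1] show ?thesis by (simp add: e_def)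
qed

text \<open>The converse: the derivative of \<open>\<psi>\<close> maps a vector in the common kernel
  of the \<open>grad (F k)\<close> to a direction with entries in the slots \<open>r0\<close> and
  \<open>r1\<close> only, and along it \<open>u\<close> is constant as long as the line stays in the
  ball.\<close>

lemma plaque_constant_casimir:
  fixes F :: "'m \<Rightarrow> real ^ 'm \<Rightarrow> real"
  assumes V: "open V" "homeomorphism V (ball c r) \<psi> \<theta>"
    and \<psi>: "smooth_on V \<psi>" and \<theta>: "smooth_on (ball c r) \<theta>"
    and \<psi>F: "\<And>x k. x \<in> V \<Longrightarrow> k \<noteq> r0 \<Longrightarrow> k \<noteq> r1 \<Longrightarrow> \<psi> x $ k = F k x"
    and u: "smooth_on V u"
    and const: "\<And>y z. y \<in> ball c r \<Longrightarrow> z \<in> ball c r \<Longrightarrow> same_leaf y z \<Longrightarrow> u (\<theta> y) = u (\<theta> z)"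
    and x: "x \<in> V"
  shows "sharp (bv (\<lambda>k. grad (F k) x)) (grad u x) = 0"
proof (rule sharp_zeroI)
  fix E assume E: "\<And>k. k \<noteq> r0 \<Longrightarrow> k \<noteq> r1 \<Longrightarrow> grad (F k) x \<bullet> E = 0"
  have \<psi>B: "\<psi> w \<in> ball c r" "\<theta> (\<psi> w) = w" if "w \<in> V" for w
    using V(2) that by (auto simp: homeomorphism_def)
  have \<theta>V: "\<theta> w \<in> V" if "w \<in> ball c r" for w
    using V(2) that by (auto simp: homeomorphism_def)
  have comp: "smooth_on (ball c r) (\<lambda>y. u (\<theta> y))"
    using \<theta>V by (intro smooth_on_compose[OF open_ball V(1) \<theta> u]) auto
  define e where "e = dd \<psi> x E"
  have \<psi>d: "\<psi> differentiable (at x)" using smooth_on_imp_differentiable[OF \<psi> x] .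
  have e: "e $ k = 0" if k: "k \<noteq> r0" "k \<noteq> r1" for k
  proof -
    have eq: "dd (\<lambda>w. \<psi> w $ k) x = dd (F k) x"
      by (rule dd_cong_open[OF V(1) x]) (rule \<psi>F[OF _ k])
    have "(\<lambda>w. \<psi> w $ k) differentiable (at x)"
      using bounded_linear.has_derivative[OF bounded_linear_vec_nth has_derivative_dd[OF \<psi>d]] differentiableI by blast
    then have "F k differentiable (at x)"
      using differentiable_cong_open[OF V(1) x, of "\<lambda>w. \<psi> w $ k" "F k"] \<psi>F[OF _ k] by simp
    then have "dd (F k) x E = 0" using E[OF k] by (simp add: grad_inner)
    then show ?thesis using eq dd_vec_nth[OF \<psi>d, of k E] by (simp add: e_def)
  qed
  let ?y = "\<psi> x"
  have y: "?y \<in> ball c r" using \<psi>B x by blast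
  have "dd (\<lambda>y. u (\<theta> y)) ?y e = 0"
  proof -
    have lin: "((\<lambda>s. ?y + s *\<^sub>R e) has_derivative (\<lambda>h. h *\<^sub>R e)) (at 0)"
      by (auto intro!: derivative_eq_intros)
    have "((\<lambda>y. u (\<theta> y)) has_derivative dd (\<lambda>y. u (\<theta> y)) ?y) (at (?y + 0 *\<^sub>R e))"
      using smooth_on_imp_has_derivative[OF comp y] by simp
    from has_derivative_compose[OF lin this]
    have 1: "((\<lambda>s. u (\<theta> (?y + s *\<^sub>R e))) has_derivative (\<lambda>h. dd (\<lambda>y. u (\<theta> y)) ?y (h *\<^sub>R e))) (at 0)" .
    let ?T = "(\<lambda>s. ?y + s *\<^sub>R e) -` ball c r"
    have T: "open ?T" "0 \<in> ?T" using y by (auto intro!: open_vimage continuous_intros)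
    have "u (\<theta> (?y + s *\<^sub>R e)) = u (\<theta> ?y)" if "s \<in> ?T" for s
      using that y e by (intro const) (auto simp: same_leaf_def)
    then have "((\<lambda>s. u (\<theta> (?y + s *\<^sub>R e))) has_derivative (\<lambda>h. 0)) (at 0)"
      using has_derivative_cong_open[OF T, of "\<lambda>s. u (\<theta> (?y + s *\<^sub>R e))" "\<lambda>s. u (\<theta> ?y)"] by simp
    from has_derivative_unique[OF 1 this] show ?thesis by (metis scaleR_one)
  qed
  moreover have "dd u x = dd (\<lambda>w. u (\<theta> (\<psi> w))) x"
    using \<psi>B by (intro dd_cong_open[OF V(1) x]) simp
  moreover have "dd (\<lambda>w. u (\<theta> (\<psi> w))) x = (\<lambda>v. dd (\<lambda>y. u (\<theta> y)) ?y (dd \<psi> x v))"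
    by (rule dd_eqI) (rule has_derivative_compose[OF has_derivative_dd[OF \<psi>d] smooth_on_imp_has_derivative[OF comp y]])
  ultimately have "dd u x E = 0" by (simp add: e_def)
  then show "grad u x \<bullet> E = 0" by (simp add: grad_inner[OF smooth_on_imp_differentiable[OF u x]])
qed

end

section \<open>Foliation boxes\<close>

context integrable_field
begin

text \<open>Zeros in the slots \<open>r0\<close> and \<open>r1\<close> let the \<open>m - 2\<close>
  integrals take values in the space \<open>real ^ 'm\<close> at hand; a space of dimension
  \<open>m - 2\<close> would need an index type of its own.\<close>

definition Cmap :: "'a \<Rightarrow> real ^ 'm" where
  "Cmap p = (\<chi> k. if k = r0 \<or> k = r1 then 0 else C k p)"

definition generates :: "'a set \<Rightarrow> ('a \<Rightarrow> real) \<Rightarrow> bool" where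
  "generates S f \<longleftrightarrow> smooth_fun_on A S f \<and>
     (\<forall>\<kappa>\<in>A. \<forall>p\<in>fst \<kappa> \<inter> S. X \<kappa> p = hamiltonian_vf bivector f \<kappa> p)"

lemma Cmap_eq_iff: "Cmap p = Cmap q \<longleftrightarrow> (\<forall>k. k \<noteq> r0 \<longrightarrow> k \<noteq> r1 \<longrightarrow> C k p = C k q)"
  by (auto simp: Cmap_def vec_eq_iff)

lemma smooth_Cmap_nth: "smooth_fun_on A UNIV (\<lambda>p. if k = r0 \<or> k = r1 then 0 else C k p)"
  using C_smooth[of k] by (cases k rule: slot_cases) (auto simp: smooth_fun_on_const)

lemma smooth_compose_Cmap:
  assumes "open S" "open T" "smooth_on T g" "\<And>p. p \<in> S \<Longrightarrow> Cmap p \<in> T"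
  shows "smooth_fun_on A S (\<lambda>p. g (Cmap p))"
  unfolding Cmap_def
  using assms smooth_fun_on_subset[OF smooth_Cmap_nth]
  by (intro smooth_fun_on_compose_vec[where C = "\<lambda>k p. if k = r0 \<or> k = r1 then 0 else C k p"]) (auto simp: Cmap_def)

lemma continuous_on_Cmap:
  assumes \<kappa>: "\<kappa> \<in> A"
  shows "continuous_on (fst \<kappa>) Cmap"
  unfolding Cmap_def[abs_def]
proof (rule continuous_on_vec_lambda)
  fix k
  let ?f = "\<lambda>p. if k = r0 \<or> k = r1 then 0 else C k p"
  have "continuous_on (fst \<kappa>) (\<lambda>q. (?f \<circ> chart_inv \<kappa>) (snd \<kappa> q))"
    by (rule continuous_on_compose2[OF smooth_on_imp_continuous_on[OF smooth_on_chart_fun[OF \<kappa> smooth_Cmap_nth]]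
          continuous_on_chart[OF \<kappa>]]) auto
  then show "continuous_on (fst \<kappa>) ?f"
    by (rule continuous_on_eq) (use \<kappa> in auto)
qed

lemma open_Cmap_preimage:
  assumes "open T" shows "open (Cmap -` T)"
proof (subst open_subopen, intro ballI)
  fix p assume p: "p \<in> Cmap -` T"
  obtain \<kappa> where \<kappa>: "\<kappa> \<in> A" "p \<in> fst \<kappa>" using chart_at by blast
  have "open (fst \<kappa> \<inter> Cmap -` T)"
    using continuous_on_Cmap[OF \<kappa>(1)] chart_homeomorphism(1)[OF \<kappa>(1)] assms
    by (rule continuous_open_preimage)
  then show "\<exists>S. open S \<and> p \<in> S \<and> S \<subseteq> Cmap -` T" using p \<kappa>(2) by blast
qed

text \<open>This makes the equation for a Hamiltonian of \<open>X\<close> independent of the chart,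
  so that it can be checked in a single one.\<close>

lemma hamiltonian_vf_transform:
  assumes "smooth_fun_on A S f" "\<kappa> \<in> A" "\<mu> \<in> A" "p \<in> fst \<kappa> \<inter> fst \<mu> \<inter> S"
  shows "hamiltonian_vf bivector f \<mu> p = jacobian \<kappa> \<mu> p *v hamiltonian_vf bivector f \<kappa> p"
proof -
  let ?J = "jacobian \<kappa> \<mu> p"
  have "differential \<kappa> f p = differential \<mu> f p v* ?J"
    using differential_transform[OF assms] by simp
  then have "?J *v (differential \<kappa> f p v* bivector \<kappa> p) = ((differential \<mu> f p v* ?J) v* bivector \<kappa> p) v* transpose ?J"
    by simp
  also have "\<dots> = differential \<mu> f p v* bivector \<mu> p"
    using bivector_transform[OF assms(2,3), of p] assms(4)
    by (simp only: vector_matrix_mul_assoc) (simp add: matrix_mul_assoc)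
  finally show ?thesis by (simp add: hamiltonian_vf_def sharp_def)
qed

text \<open>
  The clauses on smooth functions and the last two conditions, which say that Hamiltonians are unique
  exactly up to functions constant on the plaques, hold for any box by computation in a chart; having
  them in the definition spares the gluing argument all coordinates.
\<close>

definition foliation_box ::
    "'a set \<Rightarrow> (real ^ 'm) set \<Rightarrow> ('a \<Rightarrow> real ^ 'm) \<Rightarrow> (real ^ 'm \<Rightarrow> 'a) \<Rightarrow> ('a \<Rightarrow> real) \<Rightarrow> bool" where
  "foliation_box W B \<psi> \<theta> h \<longleftrightarrow>
     open W \<and> W \<subseteq> regular \<and> open B \<and> convex B \<and> homeomorphism W B \<psi> \<theta> \<and>
     (\<forall>p\<in>W. \<forall>k. k \<noteq> r0 \<longrightarrow> k \<noteq> r1 \<longrightarrow> \<psi> p $ k = C k p) \<and>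
     (\<forall>N f. open N \<longrightarrow> N \<subseteq> W \<longrightarrow> smooth_fun_on A N f \<longrightarrow> smooth_on (\<psi> ` N) (f \<circ> \<theta>)) \<and>
     (\<forall>T g. open T \<longrightarrow> T \<subseteq> B \<longrightarrow> smooth_on T g \<longrightarrow> smooth_fun_on A (\<theta> ` T) (g \<circ> \<psi>)) \<and>
     generates W h \<and>
     (\<forall>f f'. generates W f \<longrightarrow> generates W f' \<longrightarrow>
        (\<forall>p\<in>W. \<forall>q\<in>W. Cmap p = Cmap q \<longrightarrow> f p - f' p = f q - f' q)) \<and>
     (\<forall>f. smooth_fun_on A W f \<longrightarrow> (\<forall>p\<in>W. \<forall>q\<in>W. Cmap p = Cmap q \<longrightarrow> f p - h p = f q - h q) \<longrightarrow>
        generates W f)"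

text \<open>The box of \<open>local_hamiltonian\<close> in a chart, carried to the manifold. The
  uniqueness clauses come from the two plaque lemmas, since \<open>X\<close> determines the gradient
  of a Hamiltonian up to the kernel of \<open>sharp\<close>.\<close>

lemma foliation_box_exists:
  assumes p: "p \<in> regular" and N: "open N" "p \<in> N"
  obtains W B \<psi> \<theta> h where "foliation_box W B \<psi> \<theta> h" "p \<in> W" "W \<subseteq> N"
proof -
  obtain \<kappa> where \<kappa>: "\<kappa> \<in> A" "p \<in> fst \<kappa>" using chart_at by blast
  \<comment> \<open>Cutting down to \<open>N\<close> and \<open>regular\<close> beforehand places
    the box inside \<open>N\<close> and makes all its points regular.\<close>
  define S where "S = snd \<kappa> ` (fst \<kappa> \<inter> (N \<inter> regular))"
  have S: "open S" "snd \<kappa> p \<in> S" "S \<subseteq> snd \<kappa> ` fst \<kappa>"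
    using open_chart_image[OF \<kappa>(1), of "N \<inter> regular"] N p \<kappa> open_regular by (auto simp: S_def)
  define F where "F k = C k \<circ> chart_inv \<kappa>" for k
  have cov: "covectors \<kappa> q = (\<lambda>k. grad (F k) (snd \<kappa> q))" for q
    by (simp add: covectors_grad F_def)
  have F: "smooth_on S (F k)" if "k \<noteq> r0" "k \<noteq> r1" for k
    unfolding F_def using smooth_on_subset[OF smooth_on_C_chart[OF \<kappa>(1) that] S(3)] .
  have \<rho>: "smooth_on S (vdens \<Omega> \<kappa>)" using smooth_on_subset[OF smooth_on_vdens[OF volume_top_form \<kappa>(1)] S(3)] .
  have Xs: "smooth_on (snd \<kappa> ` fst \<kappa>) (X \<kappa> \<circ> chart_inv \<kappa>)"
    using X_field \<kappa>(1) by (simp add: vector_field_def)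
  have tangent: "grad (F k) x \<bullet> (X \<kappa> \<circ> chart_inv \<kappa>) x = 0" if "x \<in> S" "k \<noteq> r0" "k \<noteq> r1" for x k
  proof -
    obtain q where q: "q \<in> fst \<kappa>" "x = snd \<kappa> q" using \<open>x \<in> S\<close> by (auto simp: S_def)
    have "differential \<kappa> (C k) q \<bullet> X \<kappa> q = 0"
      using C_integral[OF that(2,3)] \<kappa>(1) q(1) unfolding first_integral_def by blast
    then show ?thesis using q \<kappa>(1) by (simp add: differential_eq_grad F_def)
  qed
  have div: "(\<Sum>j\<in>UNIV. dd (\<lambda>x. vdens \<Omega> \<kappa> x * (X \<kappa> \<circ> chart_inv \<kappa>) x $ j) x (axis j 1)) = 0" if "x \<in> S" for x
  proof -
    obtain q where q: "q \<in> fst \<kappa>" "x = snd \<kappa> q" using \<open>x \<in> S\<close> by (auto simp: S_def)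
    have "lie_derivative X \<Omega> \<kappa> q (\<lambda>i. axis i 1) = 0"
      using invariant \<kappa>(1) q(1) unfolding invariant_form_def by blast
    then show ?thesis
      using lie_derivative_divergence[where Z = X, OF volume_top_form \<kappa>(1) q(1) Xs, of "\<lambda>i. axis i 1"] q by (simp add: detv_axis)
  qed
  have nz: "bv (\<lambda>k. grad (F k) x) \<noteq> 0" if "x \<in> S" for x
  proof -
    obtain q where q: "q \<in> fst \<kappa>" "q \<in> regular" "x = snd \<kappa> q" using \<open>x \<in> S\<close> by (auto simp: S_def)
    then show ?thesis using regular_iff[OF \<kappa>(1) q(1)] by (simp add: cov)
  qed
  obtain N' r \<Psi> \<Theta> H where N': "open N'" "snd \<kappa> p \<in> N'" "N' \<subseteq> S"
    and hom: "homeomorphism N' (ball (\<Psi> (snd \<kappa> p)) r) \<Psi> \<Theta>"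
    and \<Psi>: "smooth_on N' \<Psi>" and \<Theta>: "smooth_on (ball (\<Psi> (snd \<kappa> p)) r) \<Theta>"
    and \<Psi>F: "\<And>x k. k \<noteq> r0 \<Longrightarrow> k \<noteq> r1 \<Longrightarrow> \<Psi> x $ k = F k x"
    and H: "smooth_on N' H"
    and XH: "\<And>x. x \<in> N' \<Longrightarrow> vdens \<Omega> \<kappa> x *\<^sub>R (X \<kappa> \<circ> chart_inv \<kappa>) x = sharp (bv (\<lambda>k. grad (F k) x)) (grad H x)"
    by (rule local_hamiltonian[OF S(1,2) F \<rho> vdens_chart_nonzero[OF \<kappa>(1) subsetD[OF S(3)]]
          smooth_on_subset[OF Xs S(3)] tangent div nz[OF S(2)]])
      (assumption | (rule that; (assumption | blast)))+
  let ?B = "ball (\<Psi> (snd \<kappa> p)) r"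
  define W where "W = fst \<kappa> \<inter> snd \<kappa> -` N'"
  define \<psi> where "\<psi> q = \<Psi> (snd \<kappa> q)" for q
  define \<theta> where "\<theta> z = chart_inv \<kappa> (\<Theta> z)" for z
  define h where "h q = H (snd \<kappa> q)" for q
  have N'im: "N' \<subseteq> snd \<kappa> ` fst \<kappa>" using N' S by blast
  have W_im: "snd \<kappa> ` W = N'" using N'im by (auto simp: W_def)
  have W: "open W" "W \<subseteq> fst \<kappa>" "p \<in> W" unfolding W_def using open_chart_preimage[OF \<kappa>(1) N'(1)] N' \<kappa> by auto
  have W_inv: "chart_inv \<kappa> (snd \<kappa> q) = q" if "q \<in> W" for q
    using that W(2) chart_inv_left[OF \<kappa>(1)] by blast
  have W_reg: "q \<in> N \<inter> regular" if "q \<in> W" for q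
  proof -
    have "q \<in> fst \<kappa>" "snd \<kappa> q \<in> S" using that N' by (auto simp: W_def)
    then obtain q' where "q' \<in> fst \<kappa> \<inter> (N \<inter> regular)" "snd \<kappa> q = snd \<kappa> q'" by (auto simp: S_def)
    then show ?thesis using \<open>q \<in> fst \<kappa>\<close> chart_inv_left[OF \<kappa>(1)] by (metis IntD1 IntD2)
  qed
  have \<Psi>in: "\<Psi> x \<in> ?B" "\<Theta> (\<Psi> x) = x" if "x \<in> N'" for x
    using hom that by (auto simp: homeomorphism_def)
  have \<Theta>in: "\<Theta> z \<in> N'" "\<Psi> (\<Theta> z) = z" if "z \<in> ?B" for z
    using hom that by (auto simp: homeomorphism_def)
  have \<theta>in: "\<theta> z \<in> W" "snd \<kappa> (\<theta> z) = \<Theta> z" if "z \<in> ?B" for z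
    using \<Theta>in[OF that] N'im \<kappa>(1) by (auto simp: \<theta>_def W_def)
  have W_N': "snd \<kappa> q \<in> N'" if "q \<in> W" for q using that by (simp add: W_def)
  have hom': "homeomorphism W ?B \<psi> \<theta>"
  proof (rule homeomorphismI)
    show "continuous_on W \<psi>" unfolding \<psi>_def
      by (rule continuous_on_compose2[OF smooth_on_imp_continuous_on[OF \<Psi>] continuous_on_subset[OF continuous_on_chart[OF \<kappa>(1)] W(2)]])
        (use W_im in auto)
    show "continuous_on ?B \<theta>" unfolding \<theta>_def
      by (rule continuous_on_compose2[OF continuous_on_chart_inv[OF \<kappa>(1)] smooth_on_imp_continuous_on[OF \<Theta>]])
        (use \<Theta>in N'im in auto)
    show "\<psi> ` W \<subseteq> ?B" using \<Psi>in W_N' by (auto simp: \<psi>_def simp del: mem_ball)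
    show "\<theta> ` ?B \<subseteq> W" using \<theta>in by blast
    show "\<theta> (\<psi> q) = q" if "q \<in> W" for q
      using \<Psi>in(2)[OF W_N'[OF that]] W(2) that \<kappa>(1) by (auto simp: \<theta>_def \<psi>_def)
    show "\<psi> (\<theta> z) = z" if "z \<in> ?B" for z
      using \<theta>in(2)[OF that] \<Theta>in(2)[OF that] by (simp add: \<psi>_def)
  qed
  have chart_smooth: "smooth_on N' (f \<circ> chart_inv \<kappa>)" if "smooth_fun_on A W f" for f
    using smooth_fun_onD[OF that \<kappa>(1)] W_im W(2) by (simp add: Int_absorb1)
  have ham_chart: "X \<kappa> q = hamiltonian_vf bivector f \<kappa> q \<longleftrightarrow>
      vdens \<Omega> \<kappa> (snd \<kappa> q) *\<^sub>R X \<kappa> q = sharp (bv (\<lambda>k. grad (F k) (snd \<kappa> q))) (grad (f \<circ> chart_inv \<kappa>) (snd \<kappa> q))"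
    if "q \<in> W" for f q
  proof -
    have "vdens \<Omega> \<kappa> (snd \<kappa> q) \<noteq> 0" using vdens_nonzero[OF volume \<kappa>(1)] W(2) that by auto
    then have "X \<kappa> q = (1 / vdens \<Omega> \<kappa> (snd \<kappa> q)) *\<^sub>R Y \<longleftrightarrow> vdens \<Omega> \<kappa> (snd \<kappa> q) *\<^sub>R X \<kappa> q = Y" for Y
      by (auto simp: field_simps)
    then show ?thesis by (simp add: hamiltonian_vf_def sharp_bivector cov differential_eq_grad)
  qed
  have generates_iff: "generates W f \<longleftrightarrow> smooth_fun_on A W f \<and>
      (\<forall>q\<in>W. vdens \<Omega> \<kappa> (snd \<kappa> q) *\<^sub>R X \<kappa> q = sharp (bv (\<lambda>k. grad (F k) (snd \<kappa> q))) (grad (f \<circ> chart_inv \<kappa>) (snd \<kappa> q)))"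
    (is "_ \<longleftrightarrow> _ \<and> ?R") for f
  proof (intro iffI conjI)
    assume g: "generates W f"
    then show "smooth_fun_on A W f" by (simp add: generates_def)
    show ?R using g \<kappa>(1) W(2) ham_chart unfolding generates_def by blast
  next
    assume R: "smooth_fun_on A W f \<and> ?R"
    show "generates W f" unfolding generates_def
    proof (intro conjI ballI)
      fix \<mu> q assume \<mu>: "\<mu> \<in> A" and q: "q \<in> fst \<mu> \<inter> W"
      have q': "q \<in> fst \<kappa> \<inter> fst \<mu>" using q W(2) by auto
      have "X \<mu> q = jacobian \<kappa> \<mu> q *v X \<kappa> q"
        using X_field \<kappa>(1) \<mu> q' unfolding vector_field_def by blast
      also have "X \<kappa> q = hamiltonian_vf bivector f \<kappa> q" using R ham_chart q by blast
      also have "jacobian \<kappa> \<mu> q *v hamiltonian_vf bivector f \<kappa> q = hamiltonian_vf bivector f \<mu> q"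
        using hamiltonian_vf_transform[OF conjunct1[OF R] \<kappa>(1) \<mu>, of q] q q' by auto
      finally show "X \<mu> q = hamiltonian_vf bivector f \<mu> q" .
    qed (use R in blast)
  qed
  have h_chart: "(h \<circ> chart_inv \<kappa>) x = H x" if "x \<in> N'" for x
    using that N'im \<kappa>(1) by (auto simp: h_def)
  have "smooth_on N' (h \<circ> chart_inv \<kappa>)"
    using smooth_on_cong[OF N'(1) h_chart] H by (rule iffD2)
  then have h_smooth: "smooth_fun_on A W h"
    using smooth_fun_on_chartI[OF \<kappa>(1) W(1,2)] W_im by simp
  have grad_h: "grad (h \<circ> chart_inv \<kappa>) x = grad H x" if "x \<in> N'" for x
    using dd_cong_open[of N' x "h \<circ> chart_inv \<kappa>" H, OF N'(1) that h_chart] by (simp add: grad_def)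
  have gen_h: "generates W h"
    unfolding generates_iff
  proof (intro conjI ballI h_smooth)
    fix q assume q: "q \<in> W"
    then show "vdens \<Omega> \<kappa> (snd \<kappa> q) *\<^sub>R X \<kappa> q =
        sharp (bv (\<lambda>k. grad (F k) (snd \<kappa> q))) (grad (h \<circ> chart_inv \<kappa>) (snd \<kappa> q))"
      using XH[OF W_N'[OF q]] grad_h[OF W_N'[OF q]] W_inv[OF q] by simp
  qed
  have Cmap_leaf: "same_leaf (\<psi> q) (\<psi> q') \<longleftrightarrow> Cmap q = Cmap q'" if "q \<in> W" "q' \<in> W" for q q'
    using that W(2) \<kappa>(1) unfolding same_leaf_def Cmap_eq_iff by (auto simp: \<psi>_def \<Psi>F F_def subset_iff)
  have diff_smooth: "smooth_on N' (\<lambda>x. (f \<circ> chart_inv \<kappa>) x - (f' \<circ> chart_inv \<kappa>) x)"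
    if "smooth_fun_on A W f" "smooth_fun_on A W f'" for f f'
    using smooth_on_diff[OF N'(1) chart_smooth[OF that(1)] chart_smooth[OF that(2)]] .
  have grad_diff: "grad (\<lambda>x. (f \<circ> chart_inv \<kappa>) x - (f' \<circ> chart_inv \<kappa>) x) x =
      grad (f \<circ> chart_inv \<kappa>) x - grad (f' \<circ> chart_inv \<kappa>) x"
    if "smooth_fun_on A W f" "smooth_fun_on A W f'" "x \<in> N'" for f f' x
    using dd_eqI[OF has_derivative_diff[OF smooth_on_imp_has_derivative[OF chart_smooth[OF that(1)] that(3)]
          smooth_on_imp_has_derivative[OF chart_smooth[OF that(2)] that(3)]]]
    by (simp add: grad_def vec_eq_iff)
  have nz': "bv (\<lambda>k. grad (F k) x) \<noteq> 0" if "x \<in> N'" for x using nz N' that by blast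
  have F': "smooth_on N' (F k)" if "k \<noteq> r0" "k \<noteq> r1" for k using smooth_on_subset[OF F[OF that] N'(3)] .
  have gen_chart: "vdens \<Omega> \<kappa> x *\<^sub>R X \<kappa> (chart_inv \<kappa> x) = sharp (bv (\<lambda>k. grad (F k) x)) (grad (f \<circ> chart_inv \<kappa>) x)"
    if f: "generates W f" and x: "x \<in> N'" for f x
  proof -
    obtain q where q: "q \<in> W" "x = snd \<kappa> q" using x W_im by blast
    then show ?thesis using f W_inv[OF q(1)] unfolding generates_iff by simp
  qed
  have unique: "f q - f' q = f q' - f' q'"
    if f: "generates W f" "generates W f'" and q: "q \<in> W" "q' \<in> W" "Cmap q = Cmap q'" for f f' q q'
  proof -
    let ?u = "\<lambda>x. (f \<circ> chart_inv \<kappa>) x - (f' \<circ> chart_inv \<kappa>) x"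
    have sm: "smooth_fun_on A W f" "smooth_fun_on A W f'" using f by (auto simp: generates_def)
    have "sharp (bv (\<lambda>k. grad (F k) x)) (grad ?u x) = 0" if "x \<in> N'" for x
      unfolding grad_diff[OF sm that] linear_diff[OF linear_sharp]
      using gen_chart[OF f(1) that] gen_chart[OF f(2) that] by simp
    from casimir_constant_on_plaques[OF N'(1) hom \<Theta> F' \<Psi>F diff_smooth[OF sm] nz' this, of "\<psi> q" "\<psi> q'"]
    have "?u (\<Theta> (\<psi> q)) = ?u (\<Theta> (\<psi> q'))"
      using q Cmap_leaf \<Psi>in(1) W_N' by (simp add: \<psi>_def)
    then show ?thesis using q \<Psi>in(2) W_N' W(2) \<kappa>(1) by (simp add: \<psi>_def subset_iff)
  qed
  have converse: "generates W f"
    if f: "smooth_fun_on A W f" and c: "\<And>q q'. q \<in> W \<Longrightarrow> q' \<in> W \<Longrightarrow> Cmap q = Cmap q' \<Longrightarrow> f q - h q = f q' - h q'" for f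
    unfolding generates_iff
  proof (intro conjI ballI f)
    fix q assume q: "q \<in> W"
    let ?u = "\<lambda>x. (f \<circ> chart_inv \<kappa>) x - (h \<circ> chart_inv \<kappa>) x"
    have "?u (\<Theta> y) = ?u (\<Theta> z)" if yz: "y \<in> ?B" "z \<in> ?B" "same_leaf y z" for y z
    proof -
      have "same_leaf (\<psi> (\<theta> y)) (\<psi> (\<theta> z))"
        using yz homeomorphism_apply2[OF hom'] by simp
      then have "Cmap (\<theta> y) = Cmap (\<theta> z)" using Cmap_leaf \<theta>in(1) yz by blast
      from c[OF \<theta>in(1)[OF yz(1)] \<theta>in(1)[OF yz(2)] this] show ?thesis by (simp add: \<theta>_def)
    qed
    from plaque_constant_casimir[OF N'(1) hom \<Psi> \<Theta> \<Psi>F diff_smooth[OF f h_smooth] this W_N'[OF q]]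
    have "sharp (bv (\<lambda>k. grad (F k) (snd \<kappa> q))) (grad (f \<circ> chart_inv \<kappa>) (snd \<kappa> q)) =
        sharp (bv (\<lambda>k. grad (F k) (snd \<kappa> q))) (grad (h \<circ> chart_inv \<kappa>) (snd \<kappa> q))"
      unfolding grad_diff[OF f h_smooth W_N'[OF q]] linear_diff[OF linear_sharp] by simp
    then show "vdens \<Omega> \<kappa> (snd \<kappa> q) *\<^sub>R X \<kappa> q = sharp (bv (\<lambda>k. grad (F k) (snd \<kappa> q))) (grad (f \<circ> chart_inv \<kappa>) (snd \<kappa> q))"
      using gen_h q unfolding generates_iff by simp
  qed
  have tr1: "smooth_on (\<psi> ` N0) (f \<circ> \<theta>)" if N0: "open N0" "N0 \<subseteq> W" "smooth_fun_on A N0 f" for N0 f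
  proof -
    have im: "\<psi> ` N0 = \<Psi> ` (snd \<kappa> ` N0)" by (auto simp: \<psi>_def)
    have op1: "open (snd \<kappa> ` N0)" using open_chart_image[OF \<kappa>(1) N0(1)] N0(2) W(2) by (simp add: Int_absorb1)
    have sub: "snd \<kappa> ` N0 \<subseteq> N'" using N0(2) W_im by blast
    have im2: "\<Psi> ` (snd \<kappa> ` N0) = ?B \<inter> \<Theta> -` (snd \<kappa> ` N0)"
    proof (intro equalityI subsetI)
      fix z assume "z \<in> ?B \<inter> \<Theta> -` (snd \<kappa> ` N0)"
      then have "\<Theta> z \<in> snd \<kappa> ` N0" "z = \<Psi> (\<Theta> z)" using \<Theta>in by auto
      then show "z \<in> \<Psi> ` (snd \<kappa> ` N0)" by (rule rev_image_eqI)
    next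
      fix z assume "z \<in> \<Psi> ` (snd \<kappa> ` N0)"
      then obtain x where "x \<in> snd \<kappa> ` N0" "z = \<Psi> x" by blast
      then show "z \<in> ?B \<inter> \<Theta> -` (snd \<kappa> ` N0)" using \<Psi>in[of x] sub by auto
    qed
    have op2: "open (\<psi> ` N0)" unfolding im im2
      using smooth_on_imp_continuous_on[OF \<Theta>] op1 by (intro continuous_open_preimage) auto
    have "smooth_on (snd \<kappa> ` N0) (f \<circ> chart_inv \<kappa>)"
      using smooth_fun_onD[OF N0(3) \<kappa>(1)] N0(2) W(2) by (simp add: Int_absorb1)
    from smooth_on_compose[OF op2 op1 smooth_on_subset[OF \<Theta>] this] im im2
    show ?thesis by (simp add: o_def \<theta>_def image_subset_iff)
  qed
  have tr2: "smooth_fun_on A (\<theta> ` T) (g \<circ> \<psi>)" if T: "open T" "T \<subseteq> ?B" "smooth_on T g" for T g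
  proof -
    have eq: "\<theta> ` T = W \<inter> \<psi> -` T"
    proof (intro equalityI subsetI)
      fix q assume "q \<in> W \<inter> \<psi> -` T"
      then have "\<psi> q \<in> T" "q = \<theta> (\<psi> q)" using homeomorphism_apply1[OF hom'] by auto
      then show "q \<in> \<theta> ` T" by (rule rev_image_eqI)
    next
      fix q assume "q \<in> \<theta> ` T"
      then obtain z where "z \<in> T" "q = \<theta> z" by blast
      then show "q \<in> W \<inter> \<psi> -` T" using \<theta>in[of z] T(2) homeomorphism_apply2[OF hom', of z] by auto
    qed
    have op: "open (\<theta> ` T)" unfolding eq
      using hom' T(1) W(1) by (intro continuous_open_preimage) (auto simp: homeomorphism_def)
    have sub: "\<theta> ` T \<subseteq> fst \<kappa>" using eq W(2) by blast
    have op': "open (snd \<kappa> ` \<theta> ` T)" using open_chart_image[OF \<kappa>(1) op] sub by (simp add: Int_absorb1)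
    have "snd \<kappa> ` \<theta> ` T \<subseteq> N'" using eq W_N' by auto
    then have "smooth_on (snd \<kappa> ` \<theta> ` T) (\<lambda>x. g (\<Psi> x))"
      using T eq by (intro smooth_on_compose[OF op' T(1) smooth_on_subset[OF \<Psi>] T(3)]) (auto simp: \<psi>_def)
    then have "smooth_on (snd \<kappa> ` \<theta> ` T) (g \<circ> \<psi> \<circ> chart_inv \<kappa>)"
      by (rule smooth_on_cong[OF op', THEN iffD1, rotated]) (use sub \<kappa>(1) in \<open>auto simp: \<psi>_def\<close>)
    then show ?thesis by (rule smooth_fun_on_chartI[OF \<kappa>(1) op sub])
  qed
  have \<psi>C: "\<psi> q $ k = C k q" if "q \<in> W" "k \<noteq> r0" "k \<noteq> r1" for q k
    using that W(2) \<kappa>(1) by (auto simp: \<psi>_def \<Psi>F F_def)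
  have "W \<subseteq> regular" "W \<subseteq> N" using W_reg by auto
  have "foliation_box W ?B \<psi> \<theta> h"
    unfolding foliation_box_def
  proof (intro conjI)
    show "\<forall>p\<in>W. \<forall>k. k \<noteq> r0 \<longrightarrow> k \<noteq> r1 \<longrightarrow> \<psi> p $ k = C k p"
      by (intro ballI allI impI) (rule \<psi>C)
    show "\<forall>N f. open N \<longrightarrow> N \<subseteq> W \<longrightarrow> smooth_fun_on A N f \<longrightarrow> smooth_on (\<psi> ` N) (f \<circ> \<theta>)"
      by (intro allI impI) (rule tr1)
    show "\<forall>T g. open T \<longrightarrow> T \<subseteq> ?B \<longrightarrow> smooth_on T g \<longrightarrow> smooth_fun_on A (\<theta> ` T) (g \<circ> \<psi>)"
      by (intro allI impI) (rule tr2)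
    show "\<forall>f f'. generates W f \<longrightarrow> generates W f' \<longrightarrow>
        (\<forall>p\<in>W. \<forall>q\<in>W. Cmap p = Cmap q \<longrightarrow> f p - f' p = f q - f' q)"
      by (intro allI impI ballI) (rule unique)
    show "\<forall>f. smooth_fun_on A W f \<longrightarrow> (\<forall>p\<in>W. \<forall>q\<in>W. Cmap p = Cmap q \<longrightarrow> f p - h p = f q - h q) \<longrightarrow>
        generates W f"
    proof (intro allI impI)
      fix f assume f: "smooth_fun_on A W f" and c: "\<forall>p\<in>W. \<forall>q\<in>W. Cmap p = Cmap q \<longrightarrow> f p - h p = f q - h q"
      show "generates W f" by (rule converse[OF f]) (rule c[rule_format])
    qed
  qed (fact W(1) \<open>W \<subseteq> regular\<close> open_ball convex_ball hom' gen_h)+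
  then show ?thesis using that W(3) \<open>W \<subseteq> N\<close> by blast
qed

end

section \<open>The global Hamiltonian\<close>

context integrable_field
begin

lemma foliation_boxD:
  assumes "foliation_box W B \<psi> \<theta> h"
  shows "open W" "W \<subseteq> regular" "open B" "convex B" "homeomorphism W B \<psi> \<theta>" "generates W h"
  using assms by (simp_all only: foliation_box_def)

lemma foliation_box_coordinate:
  assumes "foliation_box W B \<psi> \<theta> h" "p \<in> W" "k \<noteq> r0" "k \<noteq> r1"
  shows "\<psi> p $ k = C k p"
  using assms unfolding foliation_box_def by fast

lemma foliation_box_smooth_pullback:
  assumes "foliation_box W B \<psi> \<theta> h" "open N" "N \<subseteq> W" "smooth_fun_on A N f"
  shows "smooth_on (\<psi> ` N) (f \<circ> \<theta>)"
proof -
  have "\<forall>N f. open N \<longrightarrow> N \<subseteq> W \<longrightarrow> smooth_fun_on A N f \<longrightarrow> smooth_on (\<psi> ` N) (f \<circ> \<theta>)"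
    using assms(1) unfolding foliation_box_def by (elim conjE)
  then show ?thesis using assms(2-4) by (elim allE impE)
qed

lemma foliation_box_smooth_pushforward:
  assumes "foliation_box W B \<psi> \<theta> h" "open T" "T \<subseteq> B" "smooth_on T g"
  shows "smooth_fun_on A (\<theta> ` T) (g \<circ> \<psi>)"
proof -
  have "\<forall>T g. open T \<longrightarrow> T \<subseteq> B \<longrightarrow> smooth_on T g \<longrightarrow> smooth_fun_on A (\<theta> ` T) (g \<circ> \<psi>)"
    using assms(1) unfolding foliation_box_def by (elim conjE)
  then show ?thesis using assms(2-4) by (elim allE impE)
qed

lemma foliation_box_unique:
  assumes "foliation_box W B \<psi> \<theta> h" "generates W f" "generates W f'" "p \<in> W" "q \<in> W" "Cmap p = Cmap q"
  shows "f p - f' p = f q - f' q"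
proof -
  have "\<forall>f f'. generates W f \<longrightarrow> generates W f' \<longrightarrow>
        (\<forall>p\<in>W. \<forall>q\<in>W. Cmap p = Cmap q \<longrightarrow> f p - f' p = f q - f' q)"
    using assms(1) unfolding foliation_box_def by (elim conjE)
  from this[rule_format, OF assms(2-6)] show ?thesis .
qed

lemma foliation_box_generates:
  assumes "foliation_box W B \<psi> \<theta> h" "smooth_fun_on A W f"
    "\<And>p q. p \<in> W \<Longrightarrow> q \<in> W \<Longrightarrow> Cmap p = Cmap q \<Longrightarrow> f p - h p = f q - h q"
  shows "generates W f"
proof -
  have "\<forall>f. smooth_fun_on A W f \<longrightarrow> (\<forall>p\<in>W. \<forall>q\<in>W. Cmap p = Cmap q \<longrightarrow> f p - h p = f q - h q) \<longrightarrow>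
        generates W f"
    using assms(1) unfolding foliation_box_def by (elim conjE)
  from this[rule_format, OF assms(2,3)] show ?thesis .
qed

lemma generates_subset: "generates S f \<Longrightarrow> T \<subseteq> S \<Longrightarrow> generates T f"
  unfolding generates_def
proof (elim conjE, intro conjI ballI)
  fix \<kappa> p assume "T \<subseteq> S" "\<forall>\<kappa>\<in>A. \<forall>p\<in>fst \<kappa> \<inter> S. X \<kappa> p = hamiltonian_vf bivector f \<kappa> p"
    and "\<kappa> \<in> A" "p \<in> fst \<kappa> \<inter> T"
  then show "X \<kappa> p = hamiltonian_vf bivector f \<kappa> p" by blast
qed (rule smooth_fun_on_subset)

text \<open>The full level set within \<open>regular\<close>; that it is a single leaf of the
  foliation rests on its connectedness.\<close>

definition leaf :: "'a \<Rightarrow> 'a set" where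
  "leaf p = {q \<in> regular. Cmap q = Cmap p}"

lemma openin_plaque:
  assumes "foliation_box W B \<psi> \<theta> h"
  shows "openin (top_of_set (leaf p)) (W \<inter> leaf p)"
  using openin_open_Int[OF foliation_boxD(1)[OF assms], of "leaf p"] by (simp add: Int_commute)

text \<open>The plaque is the image under \<open>\<theta>\<close> of a convex set, namely
  \<open>B\<close> cut by the plane on which the integrals are fixed.\<close>

lemma path_connected_plaque:
  assumes box: "foliation_box W B \<psi> \<theta> h"
  shows "path_connected (W \<inter> leaf p)"
proof -
  let ?Y = "{y. same_leaf y (Cmap p)}"
  note D = foliation_boxD[OF box]
  have Cmap_same: "Cmap q = Cmap p \<longleftrightarrow> same_leaf (\<psi> q) (Cmap p)" if "q \<in> W" for q
    using foliation_box_coordinate[OF box that]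
    by (simp add: Cmap_eq_iff same_leaf_def) (simp add: Cmap_def)
  have "convex ?Y"
  proof (rule convexI)
    fix x y and u v :: real assume "x \<in> ?Y" "y \<in> ?Y" "0 \<le> u" "0 \<le> v" and uv: "u + v = 1"
    then have "(u *\<^sub>R x + v *\<^sub>R y) $ k = u * Cmap p $ k + v * Cmap p $ k" if "k \<noteq> r0" "k \<noteq> r1" for k
      using that by (simp add: same_leaf_def)
    then have "(u *\<^sub>R x + v *\<^sub>R y) $ k = (u + v) * Cmap p $ k" if "k \<noteq> r0" "k \<noteq> r1" for k
      using that by (simp only: distrib_right)
    then show "u *\<^sub>R x + v *\<^sub>R y \<in> ?Y" using uv by (simp add: same_leaf_def)
  qed
  then have "path_connected (B \<inter> ?Y)" using D(4) by (intro convex_imp_path_connected convex_Int)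
  moreover have "continuous_on (B \<inter> ?Y) \<theta>"
    using D(5) continuous_on_subset[of B \<theta> "B \<inter> ?Y"] by (simp add: homeomorphism_def)
  ultimately have "path_connected (\<theta> ` (B \<inter> ?Y))" by (intro path_connected_continuous_image)
  also have "\<theta> ` (B \<inter> ?Y) = W \<inter> leaf p"
  proof (intro equalityI subsetI)
    fix q assume "q \<in> \<theta> ` (B \<inter> ?Y)"
    then obtain y where y: "y \<in> B" "same_leaf y (Cmap p)" "q = \<theta> y" by blast
    then have "q \<in> W" "\<psi> q = y" using D(5) by (auto simp: homeomorphism_def)
    then show "q \<in> W \<inter> leaf p" using Cmap_same y D(2) by (auto simp: leaf_def)
  next
    fix q assume q: "q \<in> W \<inter> leaf p"
    then have "\<psi> q \<in> B" "q = \<theta> (\<psi> q)" "same_leaf (\<psi> q) (Cmap p)"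
      using D(5) Cmap_same by (auto simp: homeomorphism_def leaf_def)
    then show "q \<in> \<theta> ` (B \<inter> ?Y)" by blast
  qed
  finally show ?thesis .
qed

text \<open>Only increments within a plaque are prescribed. Nothing is required across different
  leaves, not even continuity, so the values can be chosen on each leaf separately.\<close>

definition leafwise_potential :: "('a \<Rightarrow> real) \<Rightarrow> 'a set \<Rightarrow> bool" where
  "leafwise_potential g S \<longleftrightarrow> (\<forall>W B \<psi> \<theta> h. foliation_box W B \<psi> \<theta> h \<longrightarrow>
     (\<forall>p\<in>W \<inter> S. \<forall>q\<in>W \<inter> S. Cmap p = Cmap q \<longrightarrow> g q - g p = h q - h p))"

lemma leafwise_potentialD:
  "leafwise_potential g S \<Longrightarrow> foliation_box W B \<psi> \<theta> h \<Longrightarrow> p \<in> W \<Longrightarrow> q \<in> W \<Longrightarrow> p \<in> S \<Longrightarrow> q \<in> S \<Longrightarrow>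
    Cmap p = Cmap q \<Longrightarrow> g q - g p = h q - h p"
  unfolding leafwise_potential_def by fast

text \<open>The plaques of all boxes with their Hamiltonians are local potentials on the leaf. On an
  overlap, the plaque of a smaller box inside both is a neighbourhood on which the difference is
  constant.\<close>

lemma leaf_potential_exists:
  assumes "simply_connected (leaf p)"
  shows "\<exists>g. leafwise_potential g (leaf p)"
proof -
  define \<F> where "\<F> = {(W \<inter> leaf p, h) | W h. \<exists>B \<psi> \<theta>. foliation_box W B \<psi> \<theta> h}"
  interpret local_potentials "leaf p" \<F>
  proof
    fix W f assume "(W, f) \<in> \<F>"
    then obtain W' B \<psi> \<theta> where W: "W = W' \<inter> leaf p" and box: "foliation_box W' B \<psi> \<theta> f"
      by (auto simp: \<F>_def)
    show "openin (top_of_set (leaf p)) W" unfolding W by (rule openin_plaque[OF box])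
  next
    fix q assume q: "q \<in> leaf p"
    then have "q \<in> regular" by (simp add: leaf_def)
    from foliation_box_exists[OF this open_UNIV UNIV_I]
    obtain W B \<psi> \<theta> h where "foliation_box W B \<psi> \<theta> h" "q \<in> W" by metis
    then have "(W \<inter> leaf p, h) \<in> \<F> \<and> q \<in> W \<inter> leaf p" using q unfolding \<F>_def by fast
    then show "\<exists>W f. (W, f) \<in> \<F> \<and> q \<in> W" by (intro exI)
  next
    fix W1 f1 W2 f2 q
    assume "(W1, f1) \<in> \<F>" "(W2, f2) \<in> \<F>" and q: "q \<in> W1" "q \<in> W2"
    then obtain V1 B1 \<psi>1 \<theta>1 V2 B2 \<psi>2 \<theta>2 where V1: "W1 = V1 \<inter> leaf p" "foliation_box V1 B1 \<psi>1 \<theta>1 f1"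
      and V2: "W2 = V2 \<inter> leaf p" "foliation_box V2 B2 \<psi>2 \<theta>2 f2"
      unfolding \<F>_def by fast
    have qr: "q \<in> regular" "q \<in> V1 \<inter> V2" "q \<in> leaf p" using q V1(1) V2(1) by (auto simp: leaf_def)
    have op: "open (V1 \<inter> V2)" using foliation_boxD(1)[OF V1(2)] foliation_boxD(1)[OF V2(2)] by (rule open_Int)
    obtain W B \<psi> \<theta> h where box: "foliation_box W B \<psi> \<theta> h" "q \<in> W" "W \<subseteq> V1 \<inter> V2"
      using foliation_box_exists[OF qr(1) op qr(2)] by metis
    have gen: "generates W f1" "generates W f2"
      using generates_subset[OF foliation_boxD(6)[OF V1(2)]] generates_subset[OF foliation_boxD(6)[OF V2(2)]] box(3) by auto
    have "f1 q' - f2 q' = f1 q - f2 q" if "q' \<in> W \<inter> leaf p" for q'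
      using foliation_box_unique[OF box(1) gen, of q' q] that box(2) qr(3) by (simp add: leaf_def)
    moreover have "openin (top_of_set (leaf p)) (W \<inter> leaf p)"
      by (rule openin_plaque[OF box(1)])
    ultimately show "\<exists>N. openin (top_of_set (leaf p)) N \<and> q \<in> N \<and> (\<forall>q'\<in>N \<inter> W1 \<inter> W2. f1 q' - f2 q' = f1 q - f2 q)"
      using box(2) qr(3) by (intro exI[of _ "W \<inter> leaf p"] conjI ballI) blast+
  qed
  show ?thesis
  proof (rule global_potential[OF assms])
    fix W f assume "(W, f) \<in> \<F>"
    then obtain W' B \<psi> \<theta> where W: "W = W' \<inter> leaf p" and box: "foliation_box W' B \<psi> \<theta> f"
      by (auto simp: \<F>_def)
    show "path_connected W" unfolding W by (rule path_connected_plaque[OF box])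
  next
    fix g assume g: "\<And>W f a b. (W, f) \<in> \<F> \<Longrightarrow> a \<in> W \<Longrightarrow> b \<in> W \<Longrightarrow> g b - g a = f b - f a"
    have "leafwise_potential g (leaf p)"
      unfolding leafwise_potential_def
    proof (intro allI impI ballI)
      fix W B \<psi> \<theta> h a b assume "foliation_box W B \<psi> \<theta> h" and ab: "a \<in> W \<inter> leaf p" "b \<in> W \<inter> leaf p"
      then have "(W \<inter> leaf p, h) \<in> \<F>" unfolding \<F>_def by fast
      from g[OF this ab] show "g b - g a = h b - h a" .
    qed
    then show "\<exists>g. leafwise_potential g (leaf p)" by (intro exI[of _ g])
  qed
qed

lemma leafwise_potential_exists:
  assumes sc: "\<And>p. p \<in> regular \<Longrightarrow> simply_connected (leaf p)"
  obtains g where "leafwise_potential g regular"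
proof -
  \<comment> \<open>One choice for each value of \<open>Cmap\<close>, not for each point, so that
    points of the same leaf share their potential.\<close>
  define G where "G y = (SOME g. leafwise_potential g {q \<in> regular. Cmap q = y})" for y
  have G: "leafwise_potential (G (Cmap p)) (leaf p)" if "p \<in> regular" for p
    unfolding G_def leaf_def
    using leaf_potential_exists[OF sc[OF that]] unfolding leaf_def by (rule someI_ex)
  have "leafwise_potential (\<lambda>p. G (Cmap p) p) regular"
    unfolding leafwise_potential_def
  proof (intro allI impI ballI)
    fix W B \<psi> \<theta> h a b
    assume box: "foliation_box W B \<psi> \<theta> h" and ab: "a \<in> W \<inter> regular" "b \<in> W \<inter> regular" "Cmap a = Cmap b"
    then have "a \<in> leaf a" "b \<in> leaf a" by (auto simp: leaf_def)
    then show "G (Cmap b) b - G (Cmap a) a = h b - h a"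
      using leafwise_potentialD[OF G[of a] box, of a b] ab by simp
  qed
  then show ?thesis by (rule that)
qed

text \<open>
  Subtracting from a leafwise potential its values along a local transversal makes it smooth: the
  set of points of a leaf near which the result is smooth is open and closed in the leaf, since in a
  box the potential differs from a smooth function by a function of \<open>Cmap\<close>.
\<close>

lemma local_normalization:
  assumes g: "leafwise_potential g regular" and conn: "\<And>p. p \<in> regular \<Longrightarrow> connected (leaf p)"
    and p0: "p0 \<in> regular"
  obtains V f where "open V" "Cmap p0 \<in> V" "smooth_fun_on A (regular \<inter> Cmap -` V) f"
    "\<And>p q. p \<in> regular \<inter> Cmap -` V \<Longrightarrow> q \<in> regular \<inter> Cmap -` V \<Longrightarrow> Cmap p = Cmap q \<Longrightarrow> f p - g p = f q - g q"
proof -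
  obtain W B \<psi> \<theta> h where box: "foliation_box W B \<psi> \<theta> h" "p0 \<in> W"
    using foliation_box_exists[OF p0 open_UNIV UNIV_I] by metis
  note D = foliation_boxD[OF box(1)]
  \<comment> \<open>The transversal through \<open>p0\<close> in box coordinates: the leaf
    coordinates \<open>r0\<close> and \<open>r1\<close> are frozen at those of \<open>p0\<close>,
    the others run through the values of the integrals. \<open>V\<close> consists of the values for
    which this point lies in the box.\<close>
  define sec where "sec y = (\<chi> k. if k = r0 \<or> k = r1 then \<psi> p0 $ k else y $ k)" for y
  define V where "V = sec -` B"
  define \<tau> where "\<tau> y = \<theta> (sec y)" for y
  \<comment> \<open>Adding \<open>h\<close> on the transversal, instead of normalising to zero
    there, makes \<open>f\<close> coincide with the smooth \<open>h\<close> on all of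
    \<open>W \<inter> N0\<close> (see \<open>f_h\<close>).\<close>
  define f where "f p = g p - g (\<tau> (Cmap p)) + h (\<tau> (Cmap p))" for p
  define N0 where "N0 = regular \<inter> Cmap -` V"
  have "continuous_on UNIV sec"
    unfolding sec_def
  proof (rule continuous_on_vec_lambda)
    fix k show "continuous_on UNIV (\<lambda>y. if k = r0 \<or> k = r1 then \<psi> p0 $ k else y $ k)"
      by (cases "k = r0 \<or> k = r1") (auto intro!: continuous_intros)
  qed
  then have V: "open V" unfolding V_def using D(3) by (intro open_vimage)
  have "sec (Cmap p0) = \<psi> p0"
    using foliation_box_coordinate[OF box] by (auto simp: vec_eq_iff sec_def Cmap_def)
  moreover have "\<psi> p0 \<in> B" using D(5) box(2) by (auto simp: homeomorphism_def)
  ultimately have p0V: "Cmap p0 \<in> V" by (simp add: V_def)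
  have N0: "open N0" unfolding N0_def using open_regular open_Cmap_preimage[OF V] by (rule open_Int)
  have \<tau>: "\<tau> (Cmap p) \<in> W" "Cmap (\<tau> (Cmap p)) = Cmap p" if "p \<in> N0" for p
  proof -
    have s: "sec (Cmap p) \<in> B" using that by (simp add: N0_def V_def)
    then show W: "\<tau> (Cmap p) \<in> W" using D(5) by (auto simp: homeomorphism_def \<tau>_def)
    have "\<psi> (\<tau> (Cmap p)) = sec (Cmap p)" using homeomorphism_apply2[OF D(5) s] by (simp add: \<tau>_def)
    then show "Cmap (\<tau> (Cmap p)) = Cmap p"
      unfolding Cmap_eq_iff using foliation_box_coordinate[OF box(1) W] by (auto simp: sec_def Cmap_def)
  qed
  have f_h: "f q = h q" if q: "q \<in> W \<inter> N0" for q
  proof -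
    have "q \<in> N0" using q by simp
    note t = \<tau>[OF this]
    have "g q - g (\<tau> (Cmap q)) = h q - h (\<tau> (Cmap q))"
      using leafwise_potentialD[OF g box(1) t(1), of q] t q D(2) by (auto simp: N0_def)
    then show ?thesis by (simp add: f_def)
  qed
  have f_g: "f p - g p = f q - g q" if "Cmap p = Cmap q" for p q
    using that by (simp add: f_def)
  define smooth_near where "smooth_near p \<longleftrightarrow> (\<exists>N. open N \<and> p \<in> N \<and> smooth_fun_on A N f)" for p
  \<comment> \<open>In a box \<open>f\<close> and \<open>h1\<close> differ by a function of
    \<open>Cmap\<close>, so smoothness of the difference near \<open>q1\<close> is moved to
    \<open>q2\<close> by the translation \<open>d\<close> in box coordinates, which changes the
    slots \<open>r0\<close> and \<open>r1\<close> alone.\<close>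
  have spread: "smooth_near q2"
    if box1: "foliation_box W1 B1 \<psi>1 \<theta>1 h1" and W1: "W1 \<subseteq> N0" and q: "q1 \<in> W1" "q2 \<in> W1" "Cmap q1 = Cmap q2"
      and s: "smooth_near q1" for W1 B1 \<psi>1 \<theta>1 h1 q1 q2
  proof -
    note D1 = foliation_boxD[OF box1]
    have h1: "smooth_fun_on A W1 h1" using D1(6) by (simp add: generates_def)
    obtain N where N: "open N" "q1 \<in> N" "smooth_fun_on A N f" using s by (auto simp: smooth_near_def)
    have NW: "open (N \<inter> W1)" using N(1) D1(1) by (rule open_Int)
    define u where "u p = f p - h1 p" for p
    have "smooth_fun_on A (N \<inter> W1) u"
      unfolding u_def by (intro smooth_fun_on_diff NW smooth_fun_on_subset[OF N(3)] smooth_fun_on_subset[OF h1]) auto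
    from foliation_box_smooth_pullback[OF box1 NW _ this]
    have us: "smooth_on (\<psi>1 ` (N \<inter> W1)) (u \<circ> \<theta>1)" by simp
    have \<psi>1B: "\<psi>1 p \<in> B1" "\<theta>1 (\<psi>1 p) = p" if "p \<in> W1" for p
      using D1(5) that by (auto simp: homeomorphism_def)
    have \<theta>1W: "\<theta>1 y \<in> W1" "\<psi>1 (\<theta>1 y) = y" if "y \<in> B1" for y
      using D1(5) that by (auto simp: homeomorphism_def)
    have im: "\<psi>1 ` (N \<inter> W1) = B1 \<inter> \<theta>1 -` N"
    proof (intro equalityI subsetI)
      fix y assume "y \<in> B1 \<inter> \<theta>1 -` N"
      then have "\<theta>1 y \<in> N \<inter> W1" "y = \<psi>1 (\<theta>1 y)" using \<theta>1W by auto
      then show "y \<in> \<psi>1 ` (N \<inter> W1)" by (rule rev_image_eqI)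
    next
      fix y assume "y \<in> \<psi>1 ` (N \<inter> W1)"
      then obtain p where "p \<in> N" "p \<in> W1" "y = \<psi>1 p" by blast
      then show "y \<in> B1 \<inter> \<theta>1 -` N" using \<psi>1B[of p] by simp
    qed
    have T1: "open (\<psi>1 ` (N \<inter> W1))" unfolding im
      using D1(5,3) N(1) by (intro continuous_open_preimage) (auto simp: homeomorphism_def)
    define d where "d = \<psi>1 q1 - \<psi>1 q2"
    have d: "d $ k = 0" if "k \<noteq> r0" "k \<noteq> r1" for k
      using foliation_box_coordinate[OF box1 q(1) that] foliation_box_coordinate[OF box1 q(2) that] q(3) that
      by (simp add: d_def Cmap_eq_iff)
    define T2 where "T2 = B1 \<inter> (\<lambda>y. y + d) -` (\<psi>1 ` (N \<inter> W1))"
    have T2: "open T2" "T2 \<subseteq> B1" "\<psi>1 q2 \<in> T2"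
    proof -
      have "open ((\<lambda>y. y + d) -` (\<psi>1 ` (N \<inter> W1)))" using T1 by (intro open_vimage) (auto intro!: continuous_intros)
      then show "open T2" unfolding T2_def using D1(3) by (intro open_Int)
      show "\<psi>1 q2 \<in> T2" using \<psi>1B q N(2) by (auto simp: T2_def d_def)
    qed (auto simp: T2_def)
    have plus_d: "smooth_on T2 (\<lambda>y. y + d)"
      by (intro smooth_on_add T2(1) smooth_on_const smooth_on_bounded_linear bounded_linear_ident)
    have "smooth_on T2 (\<lambda>y. (u \<circ> \<theta>1) (y + d))"
      by (rule smooth_on_compose[OF T2(1) T1 plus_d us]) (auto simp: T2_def)
    moreover have shift: "(u \<circ> \<theta>1) (y + d) = (u \<circ> \<theta>1) y" if y: "y \<in> T2" for y
    proof -
      have B: "y \<in> B1" "y + d \<in> B1" using y im by (auto simp: T2_def)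
      note w = \<theta>1W[OF B(1)] \<theta>1W[OF B(2)]
      have c: "Cmap (\<theta>1 y) = Cmap (\<theta>1 (y + d))"
        unfolding Cmap_eq_iff
        using foliation_box_coordinate[OF box1 w(1)] foliation_box_coordinate[OF box1 w(3)] w(2,4) d by auto
      have reg: "\<theta>1 y \<in> regular" "\<theta>1 (y + d) \<in> regular" using w D1(2) by auto
      have "g (\<theta>1 (y + d)) - g (\<theta>1 y) = h1 (\<theta>1 (y + d)) - h1 (\<theta>1 y)"
        by (rule leafwise_potentialD[OF g box1 w(1,3) reg c])
      then show ?thesis using f_g[OF c] by (simp add: u_def)
    qed
    ultimately have "smooth_on T2 (u \<circ> \<theta>1)"
      using smooth_on_cong[OF T2(1), of "\<lambda>y. (u \<circ> \<theta>1) (y + d)" "u \<circ> \<theta>1"] by simp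
    from foliation_box_smooth_pushforward[OF box1 T2(1,2) this]
    have 1: "smooth_fun_on A (\<theta>1 ` T2) (u \<circ> \<theta>1 \<circ> \<psi>1)" .
    have eq: "\<theta>1 ` T2 = W1 \<inter> \<psi>1 -` T2"
    proof (intro equalityI subsetI)
      fix p assume "p \<in> W1 \<inter> \<psi>1 -` T2"
      then have "\<psi>1 p \<in> T2" "p = \<theta>1 (\<psi>1 p)" using \<psi>1B by auto
      then show "p \<in> \<theta>1 ` T2" by (rule rev_image_eqI)
    next
      fix p assume "p \<in> \<theta>1 ` T2"
      then obtain y where "y \<in> T2" "p = \<theta>1 y" by blast
      then show "p \<in> W1 \<inter> \<psi>1 -` T2" using \<theta>1W[of y] T2(2) by auto
    qed
    have op: "open (\<theta>1 ` T2)" unfolding eq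
      using D1(5,1) T2(1) by (intro continuous_open_preimage) (auto simp: homeomorphism_def)
    have "smooth_fun_on A (\<theta>1 ` T2) (\<lambda>p. h1 p + (u \<circ> \<theta>1 \<circ> \<psi>1) p)"
      using eq by (intro smooth_fun_on_add op 1 smooth_fun_on_subset[OF h1]) auto
    then have "smooth_fun_on A (\<theta>1 ` T2) f"
      by (rule smooth_fun_on_cong[OF op, THEN iffD1, rotated]) (use eq \<psi>1B in \<open>auto simp: u_def\<close>)
    moreover have "q2 \<in> \<theta>1 ` T2" unfolding eq using q T2(3) by simp
    ultimately show ?thesis unfolding smooth_near_def using op by blast
  qed
  have "smooth_near p" if p: "p \<in> N0" for p
  proof -
    let ?s = "\<tau> (Cmap p)"
    have preg: "p \<in> regular" using p by (simp add: N0_def)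
    have s: "?s \<in> W \<inter> N0" "?s \<in> leaf p"
      using \<tau>[OF p] D(2) p by (auto simp: N0_def leaf_def)
    have WN: "open (W \<inter> N0)" using D(1) N0 by (rule open_Int)
    have "smooth_fun_on A W h" using D(6) by (simp add: generates_def)
    then have "smooth_fun_on A (W \<inter> N0) h" by (rule smooth_fun_on_subset) simp
    then have "smooth_fun_on A (W \<inter> N0) f"
      by (rule smooth_fun_on_cong[OF WN, THEN iffD2, rotated]) (rule f_h)
    then have start: "smooth_near ?s" unfolding smooth_near_def using WN s(1) by blast
    show ?thesis
    proof (rule connected_induction_simple[where S = "leaf p" and P = smooth_near, OF conn[OF preg] s(2) _ start])
      show "p \<in> leaf p" using preg by (simp add: leaf_def)
      fix a assume a: "a \<in> leaf p"
      then have aN: "a \<in> regular" "a \<in> N0" using p by (auto simp: leaf_def N0_def)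
      obtain W1 B1 \<psi>1 \<theta>1 h1 where box1: "foliation_box W1 B1 \<psi>1 \<theta>1 h1" "a \<in> W1" "W1 \<subseteq> N0"
        using foliation_box_exists[OF aN(1) N0 aN(2)] by metis
      have "openin (top_of_set (leaf p)) (leaf p \<inter> W1)"
        by (rule openin_open_Int[OF foliation_boxD(1)[OF box1(1)]])
      moreover have "\<forall>x\<in>leaf p \<inter> W1. \<forall>y\<in>leaf p \<inter> W1. smooth_near x \<longrightarrow> smooth_near y"
      proof (intro ballI impI)
        fix x y assume xy: "x \<in> leaf p \<inter> W1" "y \<in> leaf p \<inter> W1" "smooth_near x"
        then have "Cmap x = Cmap y" by (simp add: leaf_def)
        from spread[OF box1(1,3) IntD2[OF xy(1)] IntD2[OF xy(2)] this xy(3)] show "smooth_near y" .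
      qed
      ultimately show "\<exists>T. openin (top_of_set (leaf p)) T \<and> a \<in> T \<and> (\<forall>x\<in>T. \<forall>y\<in>T. smooth_near x \<longrightarrow> smooth_near y)"
        using a box1(2) by (intro exI[of _ "leaf p \<inter> W1"]) simp
    qed
  qed
  then have "smooth_fun_on A N0 f" by (intro smooth_fun_on_local) (simp add: smooth_near_def)
  then show ?thesis unfolding N0_def by (rule that[OF V p0V]) (rule f_g)
qed

text \<open>Each normalised function differs from \<open>g\<close> by a function constant on leaves.
  Means with weights depending on \<open>Cmap\<close> keep this property, so within a plaque their
  increments are those of the box Hamiltonian, and \<open>foliation_box_generates\<close> turns this
  into the Hamiltonian equation.\<close>

theorem hamiltonian_exists:
  assumes sc: "\<And>p. p \<in> regular \<Longrightarrow> simply_connected (leaf p)"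
    and conn: "\<And>p. p \<in> regular \<Longrightarrow> connected (leaf p)"
    and ne: "regular \<noteq> {}"
  shows "\<exists>h. generates regular h"
proof -
  obtain g where g: "leafwise_potential g regular" using leafwise_potential_exists[OF sc] by blast
  have "\<forall>p\<in>regular. \<exists>V f. open V \<and> Cmap p \<in> V \<and> smooth_fun_on A (regular \<inter> Cmap -` V) f \<and>
      (\<forall>a\<in>regular \<inter> Cmap -` V. \<forall>b\<in>regular \<inter> Cmap -` V. Cmap a = Cmap b \<longrightarrow> f a - g a = f b - g b)"
  proof
    fix p assume p: "p \<in> regular"
    show "\<exists>V f. open V \<and> Cmap p \<in> V \<and> smooth_fun_on A (regular \<inter> Cmap -` V) f \<and>
      (\<forall>a\<in>regular \<inter> Cmap -` V. \<forall>b\<in>regular \<inter> Cmap -` V. Cmap a = Cmap b \<longrightarrow> f a - g a = f b - g b)"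
      by (rule local_normalization[OF g conn p]) (assumption | (intro exI conjI ballI impI; assumption))+
  qed
  then obtain V f where V: "\<And>p. p \<in> regular \<Longrightarrow> open (V p)" "\<And>p. p \<in> regular \<Longrightarrow> Cmap p \<in> V p"
    and f: "\<And>p. p \<in> regular \<Longrightarrow> smooth_fun_on A (regular \<inter> Cmap -` V p) (f p)"
    and f_g: "\<And>p a b. p \<in> regular \<Longrightarrow> a \<in> regular \<inter> Cmap -` V p \<Longrightarrow> b \<in> regular \<inter> Cmap -` V p \<Longrightarrow>
      Cmap a = Cmap b \<Longrightarrow> f p a - g a = f p b - g b"
    unfolding bchoice_iff by fast
  \<comment> \<open>Closed balls inside \<open>V p\<close>: a point outside \<open>V p\<close> then
    has a neighbourhood on which the weight vanishes, so the product of the weight with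
    \<open>f p\<close> is smooth there as well.\<close>
  have "\<exists>e>0. cball (Cmap p) e \<subseteq> V p" if "p \<in> regular" for p
    using V[OF that] open_contains_cball by blast
  then obtain e where e: "\<And>p. p \<in> regular \<Longrightarrow> e p > 0" "\<And>p. p \<in> regular \<Longrightarrow> cball (Cmap p) (e p) \<subseteq> V p"
    by metis
  define \<B> where "\<B> = (\<lambda>p. ball (Cmap p) (e p)) ` regular"
  \<comment> \<open>Countably many balls suffice, as \<open>smooth_locally_finite_family\<close>
    takes a sequence of them.\<close>
  obtain \<B>' where \<B>': "\<B>' \<subseteq> \<B>" "countable \<B>'" "\<Union>\<B>' = \<Union>\<B>"
    by (rule Lindelof_openin[of \<B> UNIV]) (auto simp: \<B>_def)
  have cov: "Cmap p \<in> \<Union>\<B>'" if "p \<in> regular" for p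
    unfolding \<B>'(3) using that e(1)[OF that] by (auto simp: \<B>_def intro!: bexI[of _ p])
  then have ne': "\<B>' \<noteq> {}" using ne by blast
  have "\<exists>p. p \<in> regular \<and> from_nat_into \<B>' n = ball (Cmap p) (e p)" for n
    using from_nat_into[OF ne', of n] \<B>'(1) by (auto simp: \<B>_def)
  then obtain c where c: "\<And>n. c n \<in> regular" "\<And>n. from_nat_into \<B>' n = ball (Cmap (c n)) (e (c n))" by metis
  have cover: "Cmap p \<in> (\<Union>n. ball (Cmap (c n)) (e (c n)))" if "p \<in> regular" for p
    using cov[OF that] range_from_nat_into[OF ne' \<B>'(2)] by (simp add: c(2)[symmetric])
  let ?O = "\<Union>n. ball (Cmap (c n)) (e (c n))"
  obtain \<eta> :: "nat \<Rightarrow> real ^ 'm \<Rightarrow> real" where \<eta>: "\<And>n. smooth_on UNIV (\<eta> n)" "\<And>n z. \<eta> n z \<ge> 0"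
      "\<And>n z. \<eta> n z \<noteq> 0 \<Longrightarrow> z \<in> ball (Cmap (c n)) (e (c n))"
    and \<eta>_pos: "\<And>z. z \<in> ?O \<Longrightarrow> \<exists>n. \<eta> n z > 0"
    and \<eta>_fin: "\<And>z. z \<in> ?O \<Longrightarrow> \<exists>N n0. open N \<and> z \<in> N \<and> (\<forall>n\<ge>n0. \<forall>w\<in>N. \<eta> n w = 0)"
  proof (rule smooth_locally_finite_family[of "\<lambda>n. e (c n)" "\<lambda>n. Cmap (c n)", OF e(1)[OF c(1)]])
    fix \<psi> :: "nat \<Rightarrow> real ^ 'm \<Rightarrow> real"
    assume a: "\<And>n. smooth_on UNIV (\<psi> n)" "\<And>n z. \<psi> n z \<ge> 0"
      "\<And>n z. \<psi> n z \<noteq> 0 \<Longrightarrow> z \<in> ball (Cmap (c n)) (e (c n))"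
      "\<And>z. z \<in> ?O \<Longrightarrow> \<exists>n. \<psi> n z > 0"
      "\<And>z. z \<in> ?O \<Longrightarrow> \<exists>N n0. open N \<and> z \<in> N \<and> (\<forall>n\<ge>n0. \<forall>w\<in>N. \<psi> n w = 0)"
    show thesis by (rule that[OF a])
  qed
  define I where "I p = {n. \<eta> n (Cmap p) \<noteq> 0}" for p
  define S0 where "S0 p = (\<Sum>n\<in>I p. \<eta> n (Cmap p))" for p
  define S1 where "S1 p = (\<Sum>n\<in>I p. \<eta> n (Cmap p) * f (c n) p)" for p
  \<comment> \<open>The weights need not add up to one; dividing by their positive sum normalises
    them.\<close>
  define h where "h p = S1 p / S0 p" for p
  have local_sum: "\<exists>N n0. open N \<and> p \<in> N \<and> (\<forall>q\<in>N. I q \<subseteq> {..<n0})" if p: "p \<in> regular" for p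
  proof -
    obtain N n0 where N: "open N" "Cmap p \<in> N" "\<forall>n\<ge>n0. \<forall>w\<in>N. \<eta> n w = 0"
      using \<eta>_fin[OF cover[OF p]] by blast
    have "I q \<subseteq> {..<n0}" if "q \<in> Cmap -` N" for q
    proof
      fix n assume "n \<in> I q"
      then have "\<eta> n (Cmap q) \<noteq> 0" by (simp add: I_def)
      then show "n \<in> {..<n0}" using N(3) that by (metis lessThan_iff not_le vimageD)
    qed
    then show ?thesis using open_Cmap_preimage[OF N(1)] N(2)
      by (intro exI[of _ "Cmap -` N"] exI[of _ n0]) simp
  qed
  have I_fin: "finite (I p)" if "p \<in> regular" for p
    using local_sum[OF that] finite_subset by blast
  have S0_pos: "S0 p > 0" if p: "p \<in> regular" for p
  proof -
    obtain n where "\<eta> n (Cmap p) > 0" using \<eta>_pos[OF cover[OF p]] by blast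
    then have "n \<in> I p" by (simp add: I_def)
    then show ?thesis unfolding S0_def
      using I_fin[OF p] \<eta>(2) \<open>\<eta> n (Cmap p) > 0\<close> by (intro sum_pos2) auto
  qed
  have \<eta>_smooth: "smooth_fun_on A regular (\<lambda>p. \<eta> n (Cmap p))" for n
    by (rule smooth_compose_Cmap[OF open_regular open_UNIV \<eta>(1)]) simp
  have term_smooth: "smooth_fun_on A regular (\<lambda>p. \<eta> n (Cmap p) * f (c n) p)" for n
  proof (rule smooth_fun_on_local)
    fix p assume p: "p \<in> regular"
    let ?V = "V (c n)" and ?K = "cball (Cmap (c n)) (e (c n))"
    show "\<exists>N. open N \<and> p \<in> N \<and> smooth_fun_on A N (\<lambda>p. \<eta> n (Cmap p) * f (c n) p)"
    proof (cases "Cmap p \<in> ?V")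
      case True
      have op: "open (regular \<inter> Cmap -` ?V)"
        using open_regular open_Cmap_preimage[OF V(1)[OF c(1)]] by (rule open_Int)
      have "smooth_fun_on A (regular \<inter> Cmap -` ?V) (\<lambda>p. \<eta> n (Cmap p) * f (c n) p)"
        by (intro smooth_fun_on_mult op f c(1) smooth_fun_on_subset[OF \<eta>_smooth]) simp
      then show ?thesis using op p True by (intro exI[of _ "regular \<inter> Cmap -` ?V"]) simp
    next
      case False
      then have "Cmap p \<in> - ?K" using e(2)[OF c(1), of n] by blast
      moreover have op: "open (Cmap -` (- ?K))" by (intro open_Cmap_preimage open_Compl closed_cball)
      moreover have "smooth_fun_on A (Cmap -` (- ?K)) (\<lambda>p. \<eta> n (Cmap p) * f (c n) p)"
      proof (rule smooth_fun_on_cong[OF op, THEN iffD1, rotated])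
        show "smooth_fun_on A (Cmap -` (- ?K)) (\<lambda>p. 0)" by (rule smooth_fun_on_const)
        fix q assume "q \<in> Cmap -` (- ?K)"
        then have "Cmap q \<notin> ball (Cmap (c n)) (e (c n))" by auto
        then have "\<eta> n (Cmap q) = 0" using \<eta>(3) by blast
        then show "0 = \<eta> n (Cmap q) * f (c n) q" by simp
      qed
      ultimately show ?thesis by (intro exI[of _ "Cmap -` (- ?K)"]) simp
    qed
  qed
  have locally_finite_smooth: "smooth_fun_on A regular (\<lambda>p. \<Sum>n\<in>I p. t n p)"
    if t: "\<And>n. smooth_fun_on A regular (t n)" and t0: "\<And>n p. n \<notin> I p \<Longrightarrow> t n p = 0" for t :: "nat \<Rightarrow> 'a \<Rightarrow> real"
  proof (rule smooth_fun_on_local)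
    fix p assume p: "p \<in> regular"
    obtain N n0 where N: "open N" "p \<in> N" "\<forall>q\<in>N. I q \<subseteq> {..<n0}" using local_sum[OF p] by blast
    have op: "open (N \<inter> regular)" using N(1) open_regular by (rule open_Int)
    have "smooth_fun_on A (N \<inter> regular) (\<lambda>p. \<Sum>n<n0. t n p)"
      by (intro smooth_fun_on_sum op smooth_fun_on_subset[OF t]) simp
    then have "smooth_fun_on A (N \<inter> regular) (\<lambda>p. \<Sum>n\<in>I p. t n p)"
    proof (rule smooth_fun_on_cong[OF op, THEN iffD1, rotated])
      fix q assume "q \<in> N \<inter> regular"
      then have "I q \<subseteq> {..<n0}" using N(3) by blast
      then show "(\<Sum>n<n0. t n q) = (\<Sum>n\<in>I q. t n q)"
        using t0 by (intro sum.mono_neutral_right) auto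
    qed
    then show "\<exists>N. open N \<and> p \<in> N \<and> smooth_fun_on A N (\<lambda>p. \<Sum>n\<in>I p. t n p)"
      using op N(2) p by (intro exI[of _ "N \<inter> regular"]) simp
  qed
  have h_smooth: "smooth_fun_on A regular h"
    unfolding h_def
  proof (rule smooth_fun_on_divide[OF open_regular])
    show "smooth_fun_on A regular S1"
      unfolding S1_def by (rule locally_finite_smooth[OF term_smooth]) (simp add: I_def)
    show "smooth_fun_on A regular S0"
      unfolding S0_def by (rule locally_finite_smooth[OF \<eta>_smooth]) (simp add: I_def)
    show "S0 p \<noteq> 0" if "p \<in> regular" for p using S0_pos[OF that] by simp
  qed
  \<comment> \<open>\<open>I\<close>, the weights and \<open>S0\<close> depend on
    \<open>Cmap\<close> alone, so they agree at \<open>p\<close> and \<open>q\<close>, and only the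
    increments of the \<open>f (c n)\<close> remain, all equal to that of \<open>g\<close>.\<close>
  have h_g: "h q - h p = g q - g p" if pq: "p \<in> regular" "q \<in> regular" "Cmap p = Cmap q" for p q
  proof -
    have IS: "I q = I p" "S0 q = S0 p" using pq(3) by (simp_all add: I_def S0_def)
    have "f (c n) q - f (c n) p = g q - g p" if "n \<in> I p" for n
    proof -
      have "Cmap p \<in> V (c n)" using \<eta>(3)[of n "Cmap p"] that e(2)[OF c(1), of n] by (auto simp: I_def)
      then show ?thesis using f_g[OF c(1), of p n q] pq by simp
    qed
    then have "\<eta> n (Cmap q) * f (c n) q - \<eta> n (Cmap p) * f (c n) p = \<eta> n (Cmap p) * (g q - g p)" if "n \<in> I p" for n
      using that pq(3) by (simp flip: right_diff_distrib)
    then have "S1 q - S1 p = (\<Sum>n\<in>I p. \<eta> n (Cmap p) * (g q - g p))"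
      unfolding S1_def IS(1) sum_subtractf[symmetric] by (rule sum.cong[OF refl])
    also have "\<dots> = S0 p * (g q - g p)" by (simp add: S0_def sum_distrib_right)
    finally show ?thesis using S0_pos[OF pq(1)] IS(2)
      by (simp add: h_def diff_divide_distrib[symmetric])
  qed
  have "generates regular h"
    unfolding generates_def
  proof (intro conjI ballI h_smooth)
    fix \<kappa> p assume \<kappa>: "\<kappa> \<in> A" and p: "p \<in> fst \<kappa> \<inter> regular"
    then have "p \<in> regular" by simp
    from foliation_box_exists[OF this open_UNIV UNIV_I]
    obtain W B \<psi> \<theta> h' where box: "foliation_box W B \<psi> \<theta> h'" "p \<in> W" by metis
    have W: "W \<subseteq> regular" using foliation_boxD(2)[OF box(1)] .
    have "generates W h"
    proof (rule foliation_box_generates[OF box(1) smooth_fun_on_subset[OF h_smooth W]])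
      fix a b assume ab: "a \<in> W" "b \<in> W" "Cmap a = Cmap b"
      then have r: "a \<in> regular" "b \<in> regular" using W by auto
      show "h a - h' a = h b - h' b"
        using h_g[OF r ab(3)] leafwise_potentialD[OF g box(1) ab(1,2) r ab(3)] by linarith
    qed
    then show "X \<kappa> p = hamiltonian_vf bivector h \<kappa> p"
      unfolding generates_def using \<kappa> p box(2) by blast
  qed
  then show ?thesis by (intro exI[of _ h])
qed

end

theorem theorem3p5:
  fixes A :: "('a::{t2_space, second_countable_topology}, 'm::finite) chart set"
    and X :: "('a, 'm) vfield"
    and c :: "nat \<Rightarrow> 'a \<Rightarrow> real"
    and U :: "'a set"
  assumes dim_ge_2: "CARD('m) \<ge> 2"
    and manifold: "smooth_atlas A"
    and orientable: "orientable A"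
    and X: "vector_field A X"
    and c_smooth: "\<And>i. i < CARD('m) - 2 \<Longrightarrow> smooth_fun_on A UNIV (c i)"
    and c_integral: "\<And>i. i < CARD('m) - 2 \<Longrightarrow> first_integral A X (c i)"
    and U_def: "U = {p. independent_differentials_at A (CARD('m) - 2) c p}"
    and U_dense: "closure U = UNIV"
    and invariant_volume: "\<exists>\<Omega>. volume_form A \<Omega> \<and> invariant_form A X \<Omega>"
    and level_sets: "\<And>y :: nat \<Rightarrow> real.
      connected {p \<in> U. \<forall>i < CARD('m) - 2. c i p = y i} \<and>
      simply_connected {p \<in> U. \<forall>i < CARD('m) - 2. c i p = y i}"
  shows "\<exists>\<pi>. poisson_structure A \<pi> \<and> unimodular A \<pi> \<and>
      (\<forall>p\<in>U. has_rank_at A \<pi> p 2) \<and>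
      (\<forall>p\<in>- U. has_rank_at A \<pi> p 0) \<and>
      (\<forall>i < CARD('m) - 2. casimir A \<pi> (c i)) \<and>
      (\<exists>h. smooth_fun_on A U h \<and>
         (\<forall>\<kappa>\<in>A. \<forall>p\<in>fst \<kappa> \<inter> U. X \<kappa> p = hamiltonian_vf \<pi> h \<kappa> p))"
proof -
  let ?n = "CARD('m) - 2"
  obtain r0 r1 :: 'm where r: "r0 \<noteq> r1"
    using dim_ge_2 card_le_Suc0_iff_eq[of "UNIV :: 'm set"] by auto
  \<comment> \<open>This count lets the bijection \<open>b\<close> renumber the given integrals by
    the coordinate indices other than \<open>r0\<close> and \<open>r1\<close>, as
    \<open>integrable_field\<close> expects them.\<close>
  have "card (- {r0, r1}) = ?n"
    using r card_Diff_subset[of "{r0, r1}" UNIV] by (simp add: Compl_eq_Diff_UNIV)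
  then obtain b where b: "bij_betw b (- {r0, r1}) {..<?n}"
    using finite_same_card_bij[of "- {r0, r1}" "{..<?n}"] by auto
  have b_less: "b k < ?n" if "k \<noteq> r0" "k \<noteq> r1" for k
    using bij_betwE[OF b] that by auto
  define b' where "b' = inv_into (- {r0, r1}) b"
  have b': "b' i \<in> - {r0, r1}" "b (b' i) = i" if "i < ?n" for i
    using bij_betwE[OF bij_betw_inv_into[OF b]] bij_betw_inv_into_right[OF b] that
    unfolding b'_def by blast+
  obtain \<Omega> where \<Omega>: "volume_form A \<Omega>" "invariant_form A X \<Omega>" using invariant_volume by blast
  interpret integrable_field A r0 r1 X "\<lambda>k. c (b k)" \<Omega>
    using manifold r X c_smooth c_integral b_less \<Omega> by unfold_locales auto
  have indep: "independent_rows (covectors \<kappa> p) \<longleftrightarrow>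
      (\<forall>a. (\<Sum>i<?n. a i *\<^sub>R differential \<kappa> (c i) p) = 0 \<longrightarrow> (\<forall>i<?n. a i = 0))" for \<kappa> p
  proof
    assume L: "independent_rows (covectors \<kappa> p)"
    show "\<forall>a. (\<Sum>i<?n. a i *\<^sub>R differential \<kappa> (c i) p) = 0 \<longrightarrow> (\<forall>i<?n. a i = 0)"
    proof (intro allI impI)
      fix a i assume 0: "(\<Sum>i<?n. a i *\<^sub>R differential \<kappa> (c i) p) = 0" and i: "i < ?n"
      have "(\<Sum>k\<in>- {r0, r1}. a (b k) *\<^sub>R covectors \<kappa> p k) = 0"
        using 0 sum.reindex_bij_betw[OF b, of "\<lambda>i. a i *\<^sub>R differential \<kappa> (c i) p"] by (simp add: covectors_def)
      then have "a (b (b' i)) = 0"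
        using L[unfolded independent_rows_def, rule_format, of "\<lambda>k. a (b k)"] b'(1)[OF i] by blast
      then show "a i = 0" using b'(2)[OF i] by simp
    qed
  next
    assume R: "\<forall>a. (\<Sum>i<?n. a i *\<^sub>R differential \<kappa> (c i) p) = 0 \<longrightarrow> (\<forall>i<?n. a i = 0)"
    show "independent_rows (covectors \<kappa> p)"
      unfolding independent_rows_def
    proof (intro allI impI ballI)
      fix a k assume 0: "(\<Sum>k\<in>- {r0, r1}. a k *\<^sub>R covectors \<kappa> p k) = 0" and k: "k \<in> - {r0, r1}"
      let ?a = "\<lambda>i. a (inv_into (- {r0, r1}) b i)"
      have inv: "inv_into (- {r0, r1}) b (b k) = k" if "k \<in> - {r0, r1}" for k
        using bij_betw_inv_into_left[OF b that] .
      have "(\<Sum>i<?n. ?a i *\<^sub>R differential \<kappa> (c i) p) = (\<Sum>k\<in>- {r0, r1}. ?a (b k) *\<^sub>R differential \<kappa> (c (b k)) p)"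
        using sum.reindex_bij_betw[OF b, of "\<lambda>i. ?a i *\<^sub>R differential \<kappa> (c i) p"] by simp
      also have "\<dots> = (\<Sum>k\<in>- {r0, r1}. a k *\<^sub>R covectors \<kappa> p k)"
        by (rule sum.cong[OF refl]) (simp add: inv covectors_def del: Compl_iff)
      finally have "\<forall>i<?n. ?a i = 0" using R[rule_format, of ?a] 0 by simp
      then have "?a (b k) = 0" using b_less k by auto
      then show "a k = 0" using inv[OF k] by simp
    qed
  qed
  have U: "U = regular"
    unfolding U_def regular_def independent_differentials_at_def indep ..
  \<comment> \<open>The level-set hypothesis will be applied with the values of the integrals at
    \<open>p\<close>.\<close>
  have leaf: "leaf p = {q \<in> U. \<forall>i < ?n. c i q = c i p}" for p
  proof -
    have "(\<forall>k. k \<noteq> r0 \<longrightarrow> k \<noteq> r1 \<longrightarrow> c (b k) q = c (b k) p) \<longleftrightarrow> (\<forall>i<?n. c i q = c i p)" for q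
      using b_less b' by (metis ComplD insertI1 insertI2)
    then show ?thesis unfolding leaf_def Cmap_eq_iff U by simp
  qed
  \<comment> \<open>A dense set is nonempty because the type of points is.\<close>
  have "regular \<noteq> {}" using U_dense U by auto
  then obtain h where h: "generates regular h"
    using hamiltonian_exists level_sets leaf by auto
  have "casimir A bivector (c i)" if "i < ?n" for i
    using casimir_C[of "b' i"] b'[OF that] by auto
  then show ?thesis
    using poisson_structure_bivector unimodular_bivector rank_regular rank_singular h U U_dense
    unfolding generates_def by (intro exI[of _ bivector] conjI exI[of _ h]) auto
qed

end
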